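(* Let $S=(\mathbb{CP}^1,\Omega,\infty)$ be a stability theory and let $k+l+m=r\le n$. Then the stratum $(k,l,m)$ of $\underline{S^{(n)}}$ is semialgebraically homeomorphic to the stratum $(k,l,m)$ of $(S\setminus\{\infty\})^{(r)}$, where $S\setminus\{\infty\}$ is the monic stability theory on $\mathbb C$ with stability set $\Omega\setminus\{\infty\}$.
   Context: A stability theory is given by a semialgebraic set $\Omega\subseteq\mathbb{CP}^1$, with strata $\Omega_s=\Omega$, $\Omega_{ss}=\overline\Omega\setminus\Omega$, $\Omega_{un}=\mathbb{CP}^1\setminus\overline\Omega$ (Euclidean closure) and marked point $\infty$. A monic stability theory is given by a semialgebraic set $\Omega'\subseteq\mathbb C$ with strata $\Omega'$, $\overline{\Omega'}\setminus\Omega'$, $\mathbb C\setminus\overline{\Omega'}$ (closure in $\mathbb C$). $X^{(n)}=X^n/\Sigma_n$ is the symmetric product (multisets of cardinality $n$), a semialgebraic space. For $X=\mathbb{CP}^1$ or $\mathbb C$, $S^{(n)}$ is $X^{(n)}$ stratified by the sets $(k,l,m)$, $k+l+m=n$, of multisets with exactly $k,l,m$ points (with multiplicity) in the stable, semistable and unstable strata. With $\lambda_n:(\mathbb{CP}^1)^{(n)}\to(\mathbb{CP}^1)^{(n+1)}$ adding the point $\infty$ to a multiset, $\underline{S^{(n)}}$ is $(\mathbb{CP}^1)^{(n)}$ with the stratification defined inductively by $\underline{S^{(0)}}=S^{(0)}$; the strata of $\underline{S^{(n+1)}}$ are the non-empty sets $s\setminus\lambda_n((\mathbb{CP}^1)^{(n)})$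 for $s$ a stratum of $S^{(n+1)}$ and the sets $\lambda_n(t)$ for $t$ a stratum of $\underline{S^{(n)}}$. The stratum of $\underline{S^{(n)}}$ denoted $(k,l,m)$ with $k+l+m=r\le n$ is the set of multisets containing $\infty$ with multiplicity exactly $n-r$ and having exactly $k,l,m$ points in $\Omega_s\setminus\{\infty\},\Omega_{ss}\setminus\{\infty\},\Omega_{un}\setminus\{\infty\}$. *)

theory Defs
  imports "HOL-Analysis.Analysis" "HOL-Library.Multiset"
begin

section \<open>Semialgebraic sets\<close>

text \<open>
  Real coordinate space on an index set \<open>I\<close> is the set \<open>I \<rightarrow>\<^sub>E UNIV\<close> of extensional functions
  (the space of the library's \<open>product_topology\<close>); the index sets used below are all finite.
  An explicit index set is needed because the number of coordinates depends on the cardinality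
  of the multisets considered, which may be zero.
\<close>

inductive_set polynomial_functions :: "'i set \<Rightarrow> (('i \<Rightarrow> real) \<Rightarrow> real) set"
  for I :: "'i set" where
  const: "(\<lambda>x. c) \<in> polynomial_functions I"
| coord: "i \<in> I \<Longrightarrow> (\<lambda>x. x i) \<in> polynomial_functions I"
| add: "p \<in> polynomial_functions I \<Longrightarrow> q \<in> polynomial_functions I
    \<Longrightarrow> (\<lambda>x. p x + q x) \<in> polynomial_functions I"
| mult: "p \<in> polynomial_functions I \<Longrightarrow> q \<in> polynomial_functions I
    \<Longrightarrow> (\<lambda>x. p x * q x) \<in> polynomial_functions I"

text \<open>
  The smallest Boolean algebra of subsets containing the sets \<open>{x. p x > 0}\<close>.  Sets
  \<open>{x. p x = 0}\<close> are obtained as the complement of \<open>{x. p x > 0} \<union> {x. - p x > 0}\<close>.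
\<close>

inductive semialgebraic :: "'i set \<Rightarrow> ('i \<Rightarrow> real) set \<Rightarrow> bool"
  for I :: "'i set" where
  positive: "p \<in> polynomial_functions I \<Longrightarrow> semialgebraic I {x \<in> I \<rightarrow>\<^sub>E UNIV. p x > 0}"
| union: "semialgebraic I A \<Longrightarrow> semialgebraic I B \<Longrightarrow> semialgebraic I (A \<union> B)"
| complement: "semialgebraic I A \<Longrightarrow> semialgebraic I ((I \<rightarrow>\<^sub>E UNIV) - A)"


section \<open>Semialgebraic spaces\<close>

text \<open>
  The semialgebraic spaces needed here (the complex plane, the projective line and their
  symmetric products) are quotients of semialgebraic subsets of real coordinate spaces by
  semialgebraic equivalence relations.  Such a space is recorded by its topology together with
  the quotient map \<open>param\<close>, defined on the semialgebraic set \<open>pdom\<close> in coordinates indexed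
  by \<open>coords\<close>.  A subset of the space is semialgebraic iff its preimage under the quotient map
  is; equivalently (Tarski-Seidenberg) iff it is the image of a semialgebraic subset of \<open>pdom\<close>.
\<close>

record ('i, 'a) sa_space =
  topo :: "'a topology"
  coords :: "'i set"
  pdom :: "('i \<Rightarrow> real) set"
  param :: "('i \<Rightarrow> real) \<Rightarrow> 'a"

definition sa_set :: "('i, 'a) sa_space \<Rightarrow> 'a set \<Rightarrow> bool" where
  "sa_set X A \<longleftrightarrow> A \<subseteq> topspace (topo X) \<and> semialgebraic (coords X) {x \<in> pdom X. param X x \<in> A}"

definition sa_prod :: "('i, 'a) sa_space \<Rightarrow> ('j, 'b) sa_space \<Rightarrow> ('i + 'j, 'a \<times> 'b) sa_space" where
  "sa_prod X Y = \<lparr>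
     topo = prod_topology (topo X) (topo Y),
     coords = coords X <+> coords Y,
     pdom = {x \<in> (coords X <+> coords Y) \<rightarrow>\<^sub>E UNIV. x \<circ> Inl \<in> pdom X \<and> x \<circ> Inr \<in> pdom Y},
     param = (\<lambda>x. (param X (x \<circ> Inl), param Y (x \<circ> Inr))) \<rparr>"

text \<open>
  A map between semialgebraic sets is semialgebraic iff its graph is.  The graph of the inverse
  is the transposed graph, so the inverse of a semialgebraic homeomorphism is again
  semialgebraic.
\<close>

definition semialgebraic_map ::
  "('i, 'a) sa_space \<Rightarrow> 'a set \<Rightarrow> ('j, 'b) sa_space \<Rightarrow> 'b set \<Rightarrow> ('a \<Rightarrow> 'b) \<Rightarrow> bool" where
  "semialgebraic_map X A Y B f \<longleftrightarrow>
     sa_set X A \<and> sa_set Y B \<and> f ` A \<subseteq> B \<and> sa_set (sa_prod X Y) ((\<lambda>x. (x, f x)) ` A)"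

definition semialgebraically_homeomorphic ::
  "('i, 'a) sa_space \<Rightarrow> 'a set \<Rightarrow> ('j, 'b) sa_space \<Rightarrow> 'b set \<Rightarrow> bool" where
  "semialgebraically_homeomorphic X A Y B \<longleftrightarrow>
     (\<exists>f. homeomorphic_map (subtopology (topo X) A) (subtopology (topo Y) B) f \<and>
          semialgebraic_map X A Y B f)"


section \<open>Symmetric products\<close>

definition quotient_topology :: "'a topology \<Rightarrow> ('a \<Rightarrow> 'b) \<Rightarrow> 'b topology" where
  "quotient_topology T q =
     topology (\<lambda>U. U \<subseteq> q ` topspace T \<and> openin T {x \<in> topspace T. q x \<in> U})"

lemma openin_quotient_topology:
  "openin (quotient_topology T q) U \<longleftrightarrow>
     U \<subseteq> q ` topspace T \<and> openin T {x \<in> topspace T. q x \<in> U}"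
proof -
  have "istopology (\<lambda>U. U \<subseteq> q ` topspace T \<and> openin T {x \<in> topspace T. q x \<in> U})"
    unfolding istopology_def
  proof (rule conjI; intro allI impI)
    fix S U
    assume S: "S \<subseteq> q ` topspace T \<and> openin T {x \<in> topspace T. q x \<in> S}"
      and U: "U \<subseteq> q ` topspace T \<and> openin T {x \<in> topspace T. q x \<in> U}"
    have "{x \<in> topspace T. q x \<in> S \<inter> U} = {x \<in> topspace T. q x \<in> S} \<inter> {x \<in> topspace T. q x \<in> U}"
      by auto
    then show "S \<inter> U \<subseteq> q ` topspace T \<and> openin T {x \<in> topspace T. q x \<in> S \<inter> U}"
      using S U by auto
  next
    fix K
    assume K: "\<forall>U\<in>K. U \<subseteq> q ` topspace T \<and> openin T {x \<in> topspace T. q x \<in> U}"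
    have "{x \<in> topspace T. q x \<in> \<Union>K} = (\<Union>U\<in>K. {x \<in> topspace T. q x \<in> U})"
      by auto
    moreover have "openin T (\<Union>U\<in>K. {x \<in> topspace T. q x \<in> U})"
      using K by blast
    ultimately show "\<Union>K \<subseteq> q ` topspace T \<and> openin T {x \<in> topspace T. q x \<in> \<Union>K}"
      using K by auto
  qed
  then show ?thesis
    by (simp add: quotient_topology_def topology_inverse')
qed

lemma topspace_quotient_topology: "topspace (quotient_topology T q) = q ` topspace T"
proof
  show "topspace (quotient_topology T q) \<subseteq> q ` topspace T"
    using openin_quotient_topology[of T q "topspace (quotient_topology T q)"] by simp
  have "{x \<in> topspace T. q x \<in> q ` topspace T} = topspace T" by auto
  then have "openin (quotient_topology T q) (q ` topspace T)"
    by (simp add: openin_quotient_topology)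
  then show "q ` topspace T \<subseteq> topspace (quotient_topology T q)"
    by (rule openin_subset)
qed

lemma quotient_map_quotient_topology: "quotient_map T (quotient_topology T q) q"
  by (simp add: quotient_map_def openin_quotient_topology topspace_quotient_topology)

definition tuple_mset :: "nat \<Rightarrow> (nat \<Rightarrow> 'a) \<Rightarrow> 'a multiset" where
  "tuple_mset n x = mset (map x [0..<n])"

text \<open>
  The topology is the quotient of the product topology by permutations of the coordinates.  The
  coordinate \<open>(i, j)\<close> is the \<open>j\<close>-th coordinate of the \<open>i\<close>-th member of an \<open>n\<close>-tuple.
\<close>

definition sym_prod :: "nat \<Rightarrow> ('i, 'a) sa_space \<Rightarrow> (nat \<times> 'i, 'a multiset) sa_space" where
  "sym_prod n X = \<lparr>
     topo = quotient_topology (product_topology (\<lambda>_. topo X) {..<n}) (tuple_mset n),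
     coords = {..<n} \<times> coords X,
     pdom = {x \<in> ({..<n} \<times> coords X) \<rightarrow>\<^sub>E UNIV. \<forall>i<n. (\<lambda>j. x (i, j)) \<in> pdom X},
     param = (\<lambda>x. tuple_mset n (\<lambda>i. param X (\<lambda>j. x (i, j)))) \<rparr>"

lemma topspace_sym_prod:
  "topspace (topo (sym_prod n X)) = {M. size M = n \<and> set_mset M \<subseteq> topspace (topo X)}"
proof -
  have top: "topspace (topo (sym_prod n X)) = tuple_mset n ` ({..<n} \<rightarrow>\<^sub>E topspace (topo X))"
    by (simp only: sym_prod_def sa_space.simps topspace_quotient_topology
        topspace_product_topology)
  show ?thesis
  proof (intro set_eqI iffI)
    fix M
    assume "M \<in> topspace (topo (sym_prod n X))"
    then obtain x where x: "x \<in> {..<n} \<rightarrow>\<^sub>E topspace (topo X)" and M: "M = tuple_mset n x"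
      unfolding top by blast
    have "size M = n" unfolding M tuple_mset_def by simp
    moreover have "set_mset M = x ` {..<n}" unfolding M tuple_mset_def
      by (simp add: atLeast0LessThan)
    moreover have "x ` {..<n} \<subseteq> topspace (topo X)"
      by (rule image_subsetI) (rule PiE_mem[OF x])
    ultimately show "M \<in> {M. size M = n \<and> set_mset M \<subseteq> topspace (topo X)}" by simp
  next
    fix M
    assume M: "M \<in> {M. size M = n \<and> set_mset M \<subseteq> topspace (topo X)}"
    obtain xs where xs: "mset xs = M" using ex_mset by blast
    let ?x = "restrict ((!) xs) {..<n}"
    have len: "length xs = n" using M xs by auto
    have "map ?x [0..<n] = map ((!) xs) [0..<n]"
      by (rule map_cong) simp_all
    then have "M = tuple_mset n ?x"
      using xs len map_nth[of xs] unfolding tuple_mset_def by metis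
    moreover have "?x \<in> {..<n} \<rightarrow>\<^sub>E topspace (topo X)"
    proof (rule restrict_PiE_iff[THEN iffD2], rule ballI)
      fix i assume "i \<in> {..<n}"
      then have "xs ! i \<in># M" using xs len by (metis lessThan_iff nth_mem set_mset_mset)
      then show "xs ! i \<in> topspace (topo X)" using M by blast
    qed
    ultimately show "M \<in> topspace (topo (sym_prod n X))"
      unfolding top by (rule image_eqI)
  qed
qed


section \<open>The complex projective line\<close>

text \<open>
  A nonzero pair \<open>(u, v)\<close> represents the point \<open>[u : v]\<close>, so the affine coordinate is \<open>u / v\<close>.
\<close>

definition proportional :: "complex \<times> complex \<Rightarrow> complex \<times> complex \<Rightarrow> bool" where
  "proportional p q \<longleftrightarrow>
     p \<noteq> 0 \<and> q \<noteq> 0 \<and> (\<exists>c. c \<noteq> 0 \<and> fst q = c * fst p \<and> snd q = c * snd p)"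

lemma part_equivp_proportional: "part_equivp proportional"
proof (rule part_equivpI)
  show "\<exists>p. proportional p p"
    by (rule exI[of _ "(1, 0)"]) (auto simp: proportional_def zero_prod_def intro!: exI[of _ 1])
  show "symp proportional"
  proof (rule sympI)
    fix p q assume pq: "proportional p q"
    then obtain c where c: "c \<noteq> 0" "fst q = c * fst p" "snd q = c * snd p"
      by (auto simp: proportional_def)
    then have "fst p = inverse c * fst q" "snd p = inverse c * snd q" "inverse c \<noteq> 0"
      by auto
    then show "proportional q p" using pq unfolding proportional_def by blast
  qed
  show "transp proportional"
  proof (rule transpI)
    fix p q r assume pq: "proportional p q" and qr: "proportional q r"
    then obtain c d where "c \<noteq> 0" "fst q = c * fst p" "snd q = c * snd p"
      "d \<noteq> 0" "fst r = d * fst q" "snd r = d * snd q"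
      by (auto simp: proportional_def)
    then have "d * c \<noteq> 0" "fst r = (d * c) * fst p" "snd r = (d * c) * snd p"
      by auto
    then show "proportional p r" using pq qr unfolding proportional_def by blast
  qed
qed

quotient_type cp1 = "complex \<times> complex" / partial: proportional
  by (rule part_equivp_proportional)

definition hpoint :: "complex \<Rightarrow> complex \<Rightarrow> cp1" where
  "hpoint u v = abs_cp1 (u, v)"

definition cp1_infinity :: cp1 where
  "cp1_infinity = hpoint 1 0"

definition cp1_of_complex :: "complex \<Rightarrow> cp1" where
  "cp1_of_complex z = hpoint z 1"

lemma hpoint_eq_iff:
  assumes "(u, v) \<noteq> 0" "(u', v') \<noteq> 0"
  shows "hpoint u v = hpoint u' v' \<longleftrightarrow> (\<exists>c. c \<noteq> 0 \<and> u' = c * u \<and> v' = c * v)"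
proof -
  have refl: "proportional p p" if "p \<noteq> 0" for p
    using that unfolding proportional_def by (auto intro!: exI[of _ 1])
  have "hpoint u v = hpoint u' v' \<longleftrightarrow> proportional (u, v) (u', v')"
    unfolding hpoint_def using Quotient_rel[OF Quotient_cp1, of "(u, v)" "(u', v')"]
      refl[OF assms(1)] refl[OF assms(2)] by auto
  then show ?thesis using assms by (auto simp: proportional_def)
qed

lemma hpoint_exhaust: obtains u v where "(u, v) \<noteq> 0" "x = hpoint u v"
proof -
  have "\<exists>p. p \<noteq> 0 \<and> x = abs_cp1 p"
    by (induction x rule: cp1.abs_induct) (auto simp: proportional_def)
  then show ?thesis using that unfolding hpoint_def by (metis prod.exhaust)
qed

lemma cp1_of_complex_neq_infinity: "cp1_of_complex z \<noteq> cp1_infinity"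
  by (simp add: cp1_of_complex_def cp1_infinity_def hpoint_eq_iff zero_prod_def)

lemma inj_cp1_of_complex: "inj cp1_of_complex"
  by (rule injI) (auto simp: cp1_of_complex_def hpoint_eq_iff zero_prod_def)

lemma cp1_eq_insert_infinity: "UNIV = insert cp1_infinity (range cp1_of_complex)"
proof -
  have "x \<in> insert cp1_infinity (range cp1_of_complex)" for x
  proof -
    obtain u v where uv: "(u, v) \<noteq> 0" "x = hpoint u v" by (rule hpoint_exhaust)
    show ?thesis
    proof (cases "v = 0")
      case True
      then have "u \<noteq> 0" using uv(1) by (auto simp: zero_prod_def)
      have "\<exists>c. c \<noteq> 0 \<and> 1 = c * u \<and> 0 = c * v"
        using True \<open>u \<noteq> 0\<close> by (intro exI[of _ "inverse u"]) auto
      then have "x = cp1_infinity"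
        unfolding uv(2) cp1_infinity_def using uv(1) by (subst hpoint_eq_iff) (auto simp: zero_prod_def)
      then show ?thesis by simp
    next
      case False
      have "\<exists>c. c \<noteq> 0 \<and> u / v = c * u \<and> 1 = c * v"
        using False by (intro exI[of _ "inverse v"]) (auto simp: field_simps)
      then have "x = cp1_of_complex (u / v)"
        unfolding uv(2) cp1_of_complex_def using uv(1) by (subst hpoint_eq_iff) (auto simp: zero_prod_def)
      then show ?thesis by simp
    qed
  qed
  then show ?thesis by blast
qed

text \<open>
  The quotient topology: the punctured plane \<open>- {0}\<close> is open, so being open in it and being open
  in \<open>complex \<times> complex\<close> agree.
\<close>

instantiation cp1 :: topological_space
begin

definition open_cp1 :: "cp1 set \<Rightarrow> bool" where
  "open_cp1 U \<longleftrightarrow> open {p. p \<noteq> 0 \<and> hpoint (fst p) (snd p) \<in> U}"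

instance
proof
  have "{p :: complex \<times> complex. p \<noteq> 0 \<and> hpoint (fst p) (snd p) \<in> UNIV} = - {0}" by auto
  then show "open (UNIV :: cp1 set)" unfolding open_cp1_def by auto
next
  fix S T :: "cp1 set"
  assume ST: "open S" "open T"
  have eq: "{p. p \<noteq> 0 \<and> hpoint (fst p) (snd p) \<in> S \<inter> T} =
    {p. p \<noteq> 0 \<and> hpoint (fst p) (snd p) \<in> S} \<inter> {p. p \<noteq> 0 \<and> hpoint (fst p) (snd p) \<in> T}"
    by auto
  show "open (S \<inter> T)"
    unfolding open_cp1_def eq by (rule open_Int; rule ST[unfolded open_cp1_def])
next
  fix K :: "cp1 set set"
  assume K: "\<forall>S\<in>K. open S"
  have eq: "{p. p \<noteq> 0 \<and> hpoint (fst p) (snd p) \<in> \<Union>K} =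
    (\<Union>S\<in>K. {p. p \<noteq> 0 \<and> hpoint (fst p) (snd p) \<in> S})"
    by auto
  show "open (\<Union>K)"
    unfolding open_cp1_def eq by (rule open_UN) (rule K[unfolded open_cp1_def])
qed

end

text \<open>
  Real and imaginary parts of homogeneous coordinates for the projective line, and of the
  affine coordinate for the complex plane.
\<close>

definition cp1_space :: "(nat, cp1) sa_space" where
  "cp1_space = \<lparr>
     topo = euclidean,
     coords = {..<4},
     pdom = {x \<in> {..<4} \<rightarrow>\<^sub>E UNIV. \<exists>i<4. x i \<noteq> 0},
     param = (\<lambda>x. hpoint (Complex (x 0) (x 1)) (Complex (x 2) (x 3))) \<rparr>"

definition complex_space :: "(nat, complex) sa_space" where
  "complex_space = \<lparr>
     topo = euclidean,
     coords = {..<2},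
     pdom = {..<2} \<rightarrow>\<^sub>E UNIV,
     param = (\<lambda>x. Complex (x 0) (x 1)) \<rparr>"


section \<open>Stability theories and strata\<close>

definition stability_theory :: "cp1 set \<Rightarrow> bool" where
  "stability_theory \<Omega> \<longleftrightarrow> sa_set cp1_space \<Omega>"

definition monic_stability_theory :: "complex set \<Rightarrow> bool" where
  "monic_stability_theory \<Omega> \<longleftrightarrow> sa_set complex_space \<Omega>"

definition stable :: "'a::topological_space set \<Rightarrow> 'a set" where
  "stable \<Omega> = \<Omega>"

definition semistable :: "'a::topological_space set \<Rightarrow> 'a set" where
  "semistable \<Omega> = closure \<Omega> - \<Omega>"

definition unstable :: "'a::topological_space set \<Rightarrow> 'a set" where
  "unstable \<Omega> = - closure \<Omega>"

definition remove_infinity :: "cp1 set \<Rightarrow> complex set" where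
  "remove_infinity \<Omega> = cp1_of_complex -` (\<Omega> - {cp1_infinity})"

lemma semialgebraic_substitution:
  assumes "semialgebraic I B" and g: "\<And>i. i \<in> I \<Longrightarrow> g i \<in> polynomial_functions J"
  shows "semialgebraic J {x \<in> J \<rightarrow>\<^sub>E UNIV. (\<lambda>i\<in>I. g i x) \<in> B}"
  using assms(1)
proof induction
  case (positive p)
  have "(\<lambda>x. p (\<lambda>i\<in>I. g i x)) \<in> polynomial_functions J"
    using positive by induction (auto intro: polynomial_functions.intros g)
  then have "semialgebraic J {x \<in> J \<rightarrow>\<^sub>E UNIV. p (\<lambda>i\<in>I. g i x) > 0}"
    by (rule semialgebraic.positive)
  moreover have "{x \<in> J \<rightarrow>\<^sub>E UNIV. (\<lambda>i\<in>I. g i x) \<in> {y \<in> I \<rightarrow>\<^sub>E UNIV. p y > 0}}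
    = {x \<in> J \<rightarrow>\<^sub>E UNIV. p (\<lambda>i\<in>I. g i x) > 0}"
    by auto
  ultimately show ?case by (simp only:)
next
  case (union A B)
  have "{x \<in> J \<rightarrow>\<^sub>E UNIV. (\<lambda>i\<in>I. g i x) \<in> A \<union> B}
    = {x \<in> J \<rightarrow>\<^sub>E UNIV. (\<lambda>i\<in>I. g i x) \<in> A} \<union> {x \<in> J \<rightarrow>\<^sub>E UNIV. (\<lambda>i\<in>I. g i x) \<in> B}"
    by auto
  then show ?case using semialgebraic.union[OF union.IH] by (simp only:)
next
  case (complement A)
  have "{x \<in> J \<rightarrow>\<^sub>E UNIV. (\<lambda>i\<in>I. g i x) \<in> (I \<rightarrow>\<^sub>E UNIV) - A}
    = (J \<rightarrow>\<^sub>E UNIV) - {x \<in> J \<rightarrow>\<^sub>E UNIV. (\<lambda>i\<in>I. g i x) \<in> A}"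
    by auto
  then show ?case using semialgebraic.complement[OF complement.IH] by (simp only:)
qed

lemma monic_stability_theory_remove_infinity:
  assumes "stability_theory \<Omega>"
  shows "monic_stability_theory (remove_infinity \<Omega>)"
proof -
  define g :: "nat \<Rightarrow> (nat \<Rightarrow> real) \<Rightarrow> real"
    where "g i x = (if i < 2 then x i else if i = 2 then 1 else 0)" for i x
  have g: "g i \<in> polynomial_functions {..<2}" for i
  proof -
    consider "i < 2" | "i = 2" | "i > 2" by linarith
    then show ?thesis
    proof cases
      case 1
      then have "g i = (\<lambda>x. x i)" by (auto simp: g_def)
      then show ?thesis using 1 by (simp add: polynomial_functions.coord)
    next
      case 2
      then have "g i = (\<lambda>x. 1)" by (auto simp: g_def)
      then show ?thesis by (simp add: polynomial_functions.const)
    next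
      case 3
      then have "g i = (\<lambda>x. 0)" by (auto simp: g_def)
      then show ?thesis by (simp add: polynomial_functions.const)
    qed
  qed
  have "semialgebraic {..<4} {x \<in> pdom cp1_space. param cp1_space x \<in> \<Omega>}" (is "semialgebraic _ ?B")
    using assms by (simp add: stability_theory_def sa_set_def cp1_space_def)
  from semialgebraic_substitution[OF this, of g "{..<2}"] g
  have "semialgebraic {..<2} {x \<in> {..<2} \<rightarrow>\<^sub>E UNIV. (\<lambda>i\<in>{..<4}. g i x) \<in> ?B}" by blast
  moreover have "(\<lambda>i\<in>{..<4}. g i x) \<in> ?B \<longleftrightarrow> Complex (x 0) (x 1) \<in> remove_infinity \<Omega>" for x
  proof -
    have "\<exists>i<4. g i x \<noteq> 0" by (rule exI[of _ 2]) (simp add: g_def)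
    moreover have "Complex 1 0 = 1" by (simp add: complex_eq_iff)
    ultimately show ?thesis
      using cp1_of_complex_neq_infinity
      by (auto simp: cp1_space_def remove_infinity_def cp1_of_complex_def g_def)
  qed
  ultimately show ?thesis
    by (simp add: monic_stability_theory_def sa_set_def complex_space_def)
qed

definition points_in :: "'a set \<Rightarrow> 'a multiset \<Rightarrow> nat" where
  "points_in A M = size (filter_mset (\<lambda>x. x \<in> A) M)"

text \<open>The stratum \<open>(k, l, m)\<close> of the \<open>n\<close>-th symmetric product; meant for \<open>k + l + m = n\<close>.\<close>

definition stratum ::
  "'a::topological_space set \<Rightarrow> nat \<Rightarrow> nat \<Rightarrow> nat \<Rightarrow> nat \<Rightarrow> 'a multiset set" where
  "stratum \<Omega> n k l m = {M. size M = n \<and>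
     points_in (stable \<Omega>) M = k \<and>
     points_in (semistable \<Omega>) M = l \<and>
     points_in (unstable \<Omega>) M = m}"

definition strata :: "'a::topological_space set \<Rightarrow> nat \<Rightarrow> 'a multiset set set" where
  "strata \<Omega> n = {stratum \<Omega> n k l m | k l m. k + l + m = n} - {{}}"

text \<open>
  The stratum \<open>(k, l, m)\<close> of the underlined stratification; meant for \<open>k + l + m \<le> n\<close>.
\<close>

definition underlined_stratum ::
  "cp1 set \<Rightarrow> nat \<Rightarrow> nat \<Rightarrow> nat \<Rightarrow> nat \<Rightarrow> cp1 multiset set" where
  "underlined_stratum \<Omega> n k l m = {M. size M = n \<and>
     count M cp1_infinity = n - (k + l + m) \<and>
     points_in (stable \<Omega> - {cp1_infinity}) M = k \<and>
     points_in (semistable \<Omega> - {cp1_infinity}) M = l \<and>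
     points_in (unstable \<Omega> - {cp1_infinity}) M = m}"

primrec underlined_strata :: "cp1 set \<Rightarrow> nat \<Rightarrow> cp1 multiset set set" where
  "underlined_strata \<Omega> 0 = strata \<Omega> 0"
| "underlined_strata \<Omega> (Suc n) =
     ({s - add_mset cp1_infinity ` {M. size M = n} | s. s \<in> strata \<Omega> (Suc n)} - {{}})
     \<union> (\<lambda>t. add_mset cp1_infinity ` t) ` underlined_strata \<Omega> n"

text \<open>
  The sets \<open>underlined_stratum\<close> are exactly the strata of the inductively defined stratification.
\<close>

lemma underlined_stratum_Suc_full:
  assumes "k + l + m = Suc n"
  shows "stratum \<Omega> (Suc n) k l m - add_mset cp1_infinity ` {M. size M = n}
    = underlined_stratum \<Omega> (Suc n) k l m"
proof -
  have im: "M \<in> add_mset cp1_infinity ` {M. size M = n} \<longleftrightarrow> cp1_infinity \<in># M"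
    if "size M = Suc n" for M
  proof
    assume "cp1_infinity \<in># M"
    then obtain N where "M = add_mset cp1_infinity N" by (metis mset_add)
    then show "M \<in> add_mset cp1_infinity ` {M. size M = n}" using that by auto
  qed auto
  have pt: "points_in (A - {cp1_infinity}) M = points_in A M" if "cp1_infinity \<notin># M" for A M
    unfolding points_in_def using that
    by (intro arg_cong[where f = size] filter_mset_cong) auto
  show ?thesis
    using assms im pt by (auto simp: stratum_def underlined_stratum_def not_in_iff)
qed

lemma add_infinity_underlined_stratum:
  assumes "k + l + m \<le> n"
  shows "add_mset cp1_infinity ` underlined_stratum \<Omega> n k l m
    = underlined_stratum \<Omega> (Suc n) k l m"
proof
  show "add_mset cp1_infinity ` underlined_stratum \<Omega> n k l m
      \<subseteq> underlined_stratum \<Omega> (Suc n) k l m"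
    using assms by (auto simp: underlined_stratum_def points_in_def)
  show "underlined_stratum \<Omega> (Suc n) k l m
      \<subseteq> add_mset cp1_infinity ` underlined_stratum \<Omega> n k l m"
  proof
    fix M assume M: "M \<in> underlined_stratum \<Omega> (Suc n) k l m"
    then have "count M cp1_infinity > 0" using assms by (auto simp: underlined_stratum_def)
    then obtain N where N: "M = add_mset cp1_infinity N" by (metis mset_add count_greater_zero_iff)
    then have "N \<in> underlined_stratum \<Omega> n k l m"
      using M assms by (auto simp: underlined_stratum_def points_in_def)
    then show "M \<in> add_mset cp1_infinity ` underlined_stratum \<Omega> n k l m" using N by blast
  qed
qed

lemma underlined_strata_eq:
  "underlined_strata \<Omega> n = {underlined_stratum \<Omega> n k l m | k l m. k + l + m \<le> n} - {{}}"
proof (induction n)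
  case 0
  show ?case
    by (auto simp: strata_def stratum_def underlined_stratum_def points_in_def)
next
  case (Suc n)
  have 1: "{s - add_mset cp1_infinity ` {M. size M = n} | s. s \<in> strata \<Omega> (Suc n)} - {{}}
    = {underlined_stratum \<Omega> (Suc n) k l m | k l m. k + l + m = Suc n} - {{}}" (is "?A = ?B")
  proof
    show "?A \<subseteq> ?B"
      using underlined_stratum_Suc_full unfolding strata_def by fastforce
    show "?B \<subseteq> ?A"
    proof
      fix t assume "t \<in> ?B"
      then obtain k l m where t: "t = underlined_stratum \<Omega> (Suc n) k l m" "t \<noteq> {}"
        and klm: "k + l + m = Suc n" by auto
      have "t = stratum \<Omega> (Suc n) k l m - add_mset cp1_infinity ` {M. size M = n}"
        using underlined_stratum_Suc_full[OF klm] t by simp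
      moreover from this t have "stratum \<Omega> (Suc n) k l m \<in> strata \<Omega> (Suc n)"
        unfolding strata_def using klm by blast
      ultimately show "t \<in> ?A" using t by blast
    qed
  qed
  have 2: "(\<lambda>t. add_mset cp1_infinity ` t) ` underlined_strata \<Omega> n
    = {underlined_stratum \<Omega> (Suc n) k l m | k l m. k + l + m \<le> n} - {{}}" (is "?C = ?D")
  proof
    show "?C \<subseteq> ?D"
    proof
      fix t assume "t \<in> ?C"
      then obtain k l m where klm: "k + l + m \<le> n"
        and t: "t = add_mset cp1_infinity ` underlined_stratum \<Omega> n k l m"
          "underlined_stratum \<Omega> n k l m \<noteq> {}"
        unfolding Suc.IH by auto
      then have "t \<noteq> {}" by simp
      then show "t \<in> ?D"
        using klm t add_infinity_underlined_stratum[OF klm, of \<Omega>] by blast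
    qed
    show "?D \<subseteq> ?C"
    proof
      fix t assume "t \<in> ?D"
      then obtain k l m where klm: "k + l + m \<le> n"
        and t: "t = underlined_stratum \<Omega> (Suc n) k l m" "t \<noteq> {}" by auto
      have eq: "t = add_mset cp1_infinity ` underlined_stratum \<Omega> n k l m"
        using add_infinity_underlined_stratum[OF klm, of \<Omega>] t(1) by simp
      then have "underlined_stratum \<Omega> n k l m \<in> underlined_strata \<Omega> n"
        unfolding Suc.IH using klm t(2) by blast
      then show "t \<in> ?C" using eq by blast
    qed
  qed
  show ?case
    unfolding underlined_strata.simps 1 2 le_Suc_eq by blast
qed

end

theory Submission
  imports Defs "HOL-Computational_Algebra.Polynomial" "HOL-Combinatorics.Permutations"
begin

text \<open>
  The homeomorphism deletes \<open>\<infinity>\<close> from a multiset and reads the remaining points in the affine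
  coordinate (\<open>affine_part\<close>).  Its inverse \<open>add_infinities\<close> puts \<open>n - r\<close> copies of \<open>\<infinity>\<close> back.  Both
  respect the strata because the plane is open in the projective line, so that closures in the plane
  are traces of closures in the projective line (\<open>closure_remove_infinity\<close>).

  Continuity of \<open>add_infinities\<close> is inherited from the quotient maps.  For its inverse, the point is
  that \<open>add_infinities\<close> is open onto the locus where \<open>\<infinity>\<close> has multiplicity exactly \<open>n - r\<close>
  (\<open>open_map_add_infinities\<close>): the multisets with a labelling whose first \<open>r\<close> points are finite and
  form a multiset in a given open set \<open>U\<close> are an open set, and on the locus the other \<open>n - r\<close> points of
  such a labelling have to be \<open>\<infinity>\<close>, so this open set cuts out exactly the image of \<open>U\<close>.

  For semialgebraicity, the graph of the map is given by finitely many alternatives, one for each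
  permutation matching the points on both sides, and each alternative consists of polynomial
  equations (\<open>param_cp1_eq_add_infinities_iff\<close>).  The strata themselves count points in \<open>\<Omega>\<close>,
  in the rest of its closure and outside the closure.  So the closure of a semialgebraic set has to be
  semialgebraic, and this is where the projection theorem of Tarski and Seidenberg enters
  (\<open>semialgebraic_projection\<close>).

  The proof of the projection theorem follows Cohen and Hoermander.  Call two finite families of
  real polynomials in one variable matched if their sign patterns along the real line agree up to
  an increasing reparametrization.  For polynomials whose coefficients depend polynomially on
  parameters, the key claim is that finitely many polynomials in the parameters suffice to decide by
  their signs to which matching class the family belongs (\<open>ex_signs_determined\<close>).  Whether a sign
  condition has a solution depends only on the class, so the projection is a finite union of sets
  given by sign conditions.  The claim is an induction on degrees: the sign of a polynomial \<open>P\<close> of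
  maximal degree at the zeros of another member \<open>Q\<close> is the sign of a combination of \<open>P\<close> and \<open>Q\<close>
  of degree less than \<open>deg P\<close>, and once the signs of \<open>P\<close> at the zeros of the other polynomials and of \<open>P'\<close> are known, \<open>P\<close> is monotone
  between these zeros, so that its own zeros can be matched (\<open>sign_matching_insert\<close>).
\<close>

section \<open>Matched subdivisions of the real line\<close>

text \<open>
  A finite set of pairs \<open>(z, w)\<close> subdivides two copies of the real line, and \<open>matched K t s\<close> says that
  \<open>t\<close> and \<open>s\<close> lie in corresponding cells.  A set of pairs, as opposed to an increasing function on the
  nodes, makes the situation symmetric in the two lines: exchanging them is taking the converse.
\<close>

definition matched :: "(real \<times> real) set \<Rightarrow> real \<Rightarrow> real \<Rightarrow> bool" where
  "matched K t s \<longleftrightarrow> (\<forall>z w. (z, w) \<in> K \<longrightarrow> sgn (t - z) = sgn (s - w))"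

text \<open>
  Applied to the nodes themselves, \<open>matched\<close> says that the pairing of the nodes is an order
  isomorphism.
\<close>

definition coherent :: "(real \<times> real) set \<Rightarrow> bool" where
  "coherent K \<longleftrightarrow> finite K \<and> (\<forall>z w. (z, w) \<in> K \<longrightarrow> matched K z w)"

lemma matchedD: "matched K t s \<Longrightarrow> (z, w) \<in> K \<Longrightarrow> sgn (t - z) = sgn (s - w)"
  by (auto simp: matched_def)

lemma matched_order:
  assumes "matched K t s" "(z, w) \<in> K"
  shows "t < z \<longleftrightarrow> s < w" "z < t \<longleftrightarrow> w < s" "t = z \<longleftrightarrow> s = w"
proof -
  have "sgn (t - z) = sgn (s - w)" using matchedD[OF assms] .
  then show "t < z \<longleftrightarrow> s < w" "z < t \<longleftrightarrow> w < s" "t = z \<longleftrightarrow> s = w"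
    by (metis diff_less_0_iff_less sgn_less, metis diff_gt_0_iff_gt sgn_greater,
        metis eq_iff_diff_eq_0 sgn_eq_0_iff)
qed

lemma matched_converse: "matched (K\<inverse>) s t \<longleftrightarrow> matched K t s"
  by (fastforce simp: matched_def)

lemma matched_reflect:
  "matched (map_prod uminus uminus ` K) t s \<longleftrightarrow> matched K (- t) (- s)"
proof -
  have "sgn (t + z) = sgn (s + w) \<longleftrightarrow> sgn (- t - z) = sgn (- s - w)" for z w :: real
    by (auto simp: sgn_if)
  then show ?thesis by (force simp: matched_def)
qed

lemma coherent_converse: "coherent (K\<inverse>) \<longleftrightarrow> coherent K"
  by (auto simp: coherent_def matched_converse)

lemma coherentD: "coherent K \<Longrightarrow> (z, w) \<in> K \<Longrightarrow> matched K z w"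
  by (auto simp: coherent_def)

lemma matched_between:
  assumes "matched K t s" "matched K t s'" "s \<le> b" "b \<le> s'"
  shows "matched K t b"
  unfolding matched_def
proof (intro allI impI)
  fix z w assume "(z, w) \<in> K"
  then show "sgn (t - z) = sgn (b - w)"
    using matchedD[OF assms(1), of z w] matchedD[OF assms(2), of z w] assms(3,4)
    by (simp add: sgn_if split: if_splits)
qed

lemma finite_sets_separated:
  fixes A B :: "real set"
  assumes "finite A" "finite B" "\<And>a b. a \<in> A \<Longrightarrow> b \<in> B \<Longrightarrow> a < b"
  shows "\<exists>s. (\<forall>a\<in>A. a < s) \<and> (\<forall>b\<in>B. s < b)"
proof (cases "A = {}")
  case True
  show ?thesis
  proof (cases "B = {}")
    case False
    then have "Min B - 1 < b" if "b \<in> B" for b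
      using Min_le[OF assms(2) that] by linarith
    then show ?thesis using True by blast
  qed (use True in auto)
next
  case A: False
  show ?thesis
  proof (cases "B = {}")
    case True
    have "a < Max A + 1" if "a \<in> A" for a
      using Max_ge[OF assms(1) that] by linarith
    then show ?thesis using True by blast
  next
    case False
    then have "Max A < Min B" using A assms by simp
    then obtain s where "Max A < s" "s < Min B" using dense by blast
    then show ?thesis using A False assms by auto
  qed
qed

text \<open>
  The partner of \<open>t\<close> is the partner of a node, or it is a number separating the partners of the nodes
  to the left of \<open>t\<close> from those of the nodes to the right.
\<close>

lemma matched_total:
  assumes "coherent K" shows "\<exists>s. matched K t s"
proof (cases "t \<in> fst ` K")
  case True
  then show ?thesis using coherentD[OF assms] by force
next
  case False
  define A where "A = snd ` {p \<in> K. fst p < t}"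
  define B where "B = snd ` {p \<in> K. t < fst p}"
  have fin: "finite A" "finite B" using assms by (auto simp: A_def B_def coherent_def)
  have "a < b" if ab: "a \<in> A" "b \<in> B" for a b
  proof -
    obtain z z' where "(z, a) \<in> K" "z < t" "(z', b) \<in> K" "t < z'"
      using ab unfolding A_def B_def image_iff by auto
    then show ?thesis using matched_order(1)[OF coherentD[OF assms]] by fastforce
  qed
  then obtain s where s: "\<forall>a\<in>A. a < s" "\<forall>b\<in>B. s < b"
    using finite_sets_separated[OF fin] by blast
  have "matched K t s" unfolding matched_def
  proof (intro allI impI)
    fix z w assume zw: "(z, w) \<in> K"
    then have "t \<noteq> z" using False by force
    then consider "z < t" "w \<in> A" | "t < z" "w \<in> B" using zw unfolding A_def B_def by force
    then show "sgn (t - z) = sgn (s - w)" using s by cases auto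
  qed
  then show ?thesis ..
qed

text \<open>
  The cell of a point that is no node is an open interval.
\<close>

lemma eventually_matched:
  assumes "finite K" "matched K t s" "t \<notin> fst ` K"
  shows "eventually (\<lambda>x. matched K x s) (nhds t)"
proof -
  have "eventually (\<lambda>x. sgn (x - fst p) = sgn (s - snd p)) (nhds t)" if "p \<in> K" for p
  proof -
    have ne: "t \<noteq> fst p" using assms(3) that by force
    have "sgn (t - fst p) = sgn (s - snd p)" using assms(2) that by (auto simp: matched_def)
    moreover have "eventually (\<lambda>x. sgn (x - fst p) = sgn (t - fst p)) (nhds t)"
    proof (cases "t < fst p")
      case True
      then show ?thesis
        using eventually_nhds_in_open[of "{..<fst p}" t] by (auto elim!: eventually_mono)
    next
      case False
      then have "fst p < t" using ne by auto
      then show ?thesis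
        using eventually_nhds_in_open[of "{fst p<..}" t] by (auto elim!: eventually_mono)
    qed
    ultimately show ?thesis by simp
  qed
  then have "eventually (\<lambda>x. \<forall>p\<in>K. sgn (x - fst p) = sgn (s - snd p)) (nhds t)"
    using assms(1) by (simp add: eventually_ball_finite)
  then show ?thesis by (rule eventually_mono) (auto simp: matched_def)
qed

text \<open>
  The situation in which one more polynomial is added to a matched family.  The functions \<open>u\<close> and
  \<open>v\<close> are the values of the new polynomial for two choices of the parameters, and \<open>K\<close> pairs nodes
  that include all critical points.  Hence both functions are monotone on every gap between
  consecutive nodes, in the same direction on corresponding gaps.  Working with functions and not
  with polynomials makes the reflection \<open>x \<mapsto> - x\<close> available at no cost.
\<close>

locale gap_data =
  fixes K :: "(real \<times> real) set" and u u' v v' :: "real \<Rightarrow> real"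
  assumes coherent: "coherent K"
    and deriv_u: "\<And>x. (u has_real_derivative u' x) (at x)"
    and deriv_v: "\<And>x. (v has_real_derivative v' x) (at x)"
    and sgn_deriv: "\<And>t s. matched K t s \<Longrightarrow> sgn (u' t) = sgn (v' s)"
    and sgn_nodes: "\<And>z w. (z, w) \<in> K \<Longrightarrow> sgn (u z) = sgn (v w)"
    and critical_u: "\<And>x. u' x = 0 \<Longrightarrow> x \<in> fst ` K"
    and critical_v: "\<And>x. v' x = 0 \<Longrightarrow> x \<in> snd ` K"
    and at_top: "\<exists>\<sigma>. eventually (\<lambda>x. sgn (u x) = \<sigma>) at_top \<and> eventually (\<lambda>x. sgn (v x) = \<sigma>) at_top"
    and at_bot: "\<exists>\<sigma>. eventually (\<lambda>x. sgn (u x) = \<sigma>) at_bot \<and> eventually (\<lambda>x. sgn (v x) = \<sigma>) at_bot"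
begin

lemma gap_data_converse: "gap_data (K\<inverse>) v v' u u'"
proof
  show "coherent (K\<inverse>)" using coherent by (simp add: coherent_converse)
  show "\<exists>\<sigma>. eventually (\<lambda>x. sgn (v x) = \<sigma>) at_top \<and> eventually (\<lambda>x. sgn (u x) = \<sigma>) at_top"
    using at_top by auto
  show "\<exists>\<sigma>. eventually (\<lambda>x. sgn (v x) = \<sigma>) at_bot \<and> eventually (\<lambda>x. sgn (u x) = \<sigma>) at_bot"
    using at_bot by auto
next
  fix x assume "v' x = 0" then show "x \<in> fst ` K\<inverse>" using critical_v by force
next
  fix x assume "u' x = 0" then show "x \<in> snd ` K\<inverse>" using critical_u by force
qed (use deriv_u deriv_v sgn_deriv sgn_nodes in \<open>auto simp: matched_converse\<close>)

lemma gap_data_uminus: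
  "gap_data K (\<lambda>x. - u x) (\<lambda>x. - u' x) (\<lambda>x. - v x) (\<lambda>x. - v' x)"
proof
  show "\<exists>\<sigma>. eventually (\<lambda>x. sgn (- u x) = \<sigma>) at_top \<and> eventually (\<lambda>x. sgn (- v x) = \<sigma>) at_top"
  proof -
    obtain \<sigma> where "eventually (\<lambda>x. sgn (u x) = \<sigma>) at_top" "eventually (\<lambda>x. sgn (v x) = \<sigma>) at_top"
      using at_top by blast
    then have "eventually (\<lambda>x. sgn (- u x) = - \<sigma>) at_top \<and> eventually (\<lambda>x. sgn (- v x) = - \<sigma>) at_top"
      by (auto simp: sgn_minus)
    then show ?thesis by blast
  qed
  show "\<exists>\<sigma>. eventually (\<lambda>x. sgn (- u x) = \<sigma>) at_bot \<and> eventually (\<lambda>x. sgn (- v x) = \<sigma>) at_bot"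
  proof -
    obtain \<sigma> where "eventually (\<lambda>x. sgn (u x) = \<sigma>) at_bot" "eventually (\<lambda>x. sgn (v x) = \<sigma>) at_bot"
      using at_bot by blast
    then have "eventually (\<lambda>x. sgn (- u x) = - \<sigma>) at_bot \<and> eventually (\<lambda>x. sgn (- v x) = - \<sigma>) at_bot"
      by (auto simp: sgn_minus)
    then show ?thesis by blast
  qed
qed (use coherent sgn_deriv sgn_nodes critical_u critical_v in
      \<open>auto simp: sgn_minus intro!: DERIV_minus deriv_u deriv_v\<close>)

lemma gap_data_reflect:
  "gap_data (map_prod uminus uminus ` K)
     (\<lambda>x. u (- x)) (\<lambda>x. - u' (- x)) (\<lambda>x. v (- x)) (\<lambda>x. - v' (- x))"
proof
  let ?K = "map_prod uminus uminus ` K"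
  note m = matched_reflect[of K]
  show "coherent ?K" using coherent by (auto simp: coherent_def m)
  show "((\<lambda>x. u (- x)) has_real_derivative - u' (- x)) (at x)" for x
    using DERIV_mirror deriv_u by blast
  show "((\<lambda>x. v (- x)) has_real_derivative - v' (- x)) (at x)" for x
    using DERIV_mirror deriv_v by blast
  show "sgn (- u' (- t)) = sgn (- v' (- s))" if "matched ?K t s" for t s
    using sgn_deriv that m by (simp add: sgn_minus)
  show "sgn (u (- z)) = sgn (v (- w))" if "(z, w) \<in> ?K" for z w
    using sgn_nodes that by force
  show "x \<in> fst ` ?K" if "- u' (- x) = 0" for x
    using critical_u[of "- x"] that by (force simp: image_iff)
  show "x \<in> snd ` ?K" if "- v' (- x) = 0" for x
    using critical_v[of "- x"] that by (force simp: image_iff)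
  show "\<exists>\<sigma>. eventually (\<lambda>x. sgn (u (- x)) = \<sigma>) at_top \<and> eventually (\<lambda>x. sgn (v (- x)) = \<sigma>) at_top"
    using at_bot by (simp add: at_bot_mirror eventually_filtermap)
  show "\<exists>\<sigma>. eventually (\<lambda>x. sgn (u (- x)) = \<sigma>) at_bot \<and> eventually (\<lambda>x. sgn (v (- x)) = \<sigma>) at_bot"
    using at_top by (simp add: at_top_mirror eventually_filtermap)
qed

text \<open>
  If \<open>u\<close> is nonnegative and increasing at \<open>t\<close>, it is positive at the right end of the gap of \<open>t\<close>,
  whether this end is a node or \<open>+\<infinity>\<close>.  There \<open>v\<close> has the same sign as \<open>u\<close>, hence \<open>v\<close> is positive
  somewhere in the corresponding gap.
\<close>

lemma positive_to_the_right:
  assumes m: "matched K t s" and t: "t \<notin> fst ` K" and du: "u' t > 0" and ut: "u t \<ge> 0"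
  shows "\<exists>s'. matched K t s' \<and> v s' > 0"
proof -
  have grow: "u t < u x" if x: "t < x" and gap: "\<And>z w. (z, w) \<in> K \<Longrightarrow> t < z \<Longrightarrow> x \<le> z" for x
  proof -
    obtain c where c: "t < c" "c < x" "u x - u t = (x - t) * u' c"
      using MVT2[OF x, of u u'] deriv_u by blast
    have "matched K c s" unfolding matched_def
    proof (intro allI impI)
      fix z w assume zw: "(z, w) \<in> K"
      show "sgn (c - z) = sgn (s - w)"
      proof (cases "t < z")
        case True
        then show ?thesis using gap[OF zw] c matched_order(1)[OF m zw] by simp
      next
        case False
        moreover have "t \<noteq> z" using t zw by force
        ultimately show ?thesis using c matched_order(2)[OF m zw] by simp
      qed
    qed
    then have "sgn (u' c) = sgn (u' t)" using sgn_deriv m by metis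
    then have "u' c > 0" using du by (metis sgn_1_pos)
    then have "(x - t) * u' c > 0" using x by simp
    then show ?thesis using c(3) by linarith
  qed
  show ?thesis
  proof (cases "\<exists>z w. (z, w) \<in> K \<and> t < z")
    case False
    then have pos: "u x > 0" if "t < x" for x using grow[OF that] ut by force
    obtain \<sigma> where \<sigma>: "eventually (\<lambda>x. sgn (u x) = \<sigma>) at_top" "eventually (\<lambda>x. sgn (v x) = \<sigma>) at_top"
      using at_top by blast
    have "eventually (\<lambda>x. sgn (u x) = 1) at_top"
      using eventually_gt_at_top[of t] by (rule eventually_mono) (simp add: pos)
    with \<sigma>(1) have "eventually (\<lambda>x::real. \<sigma> = 1) at_top" by eventually_elim simp
    then have "\<sigma> = 1" by simp
    have "eventually (\<lambda>x. v x > 0 \<and> x > s) at_top"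
      using \<sigma>(2) eventually_gt_at_top[of s]
      by eventually_elim (use \<open>\<sigma> = 1\<close> in \<open>simp add: sgn_1_pos\<close>)
    then obtain s' where s': "v s' > 0" "s' > s"
      using eventually_happens'[OF trivial_limit_at_top_linorder] by blast
    have "matched K t s'" unfolding matched_def
    proof (intro allI impI)
      fix z w assume zw: "(z, w) \<in> K"
      then have "\<not> t < z" using False by blast
      moreover have "t \<noteq> z" using t zw by force
      ultimately have "z < t" by simp
      then show "sgn (t - z) = sgn (s' - w)"
        using matched_order(2)[OF m zw] s' by simp
    qed
    then show ?thesis using s' by blast
  next
    case True
    define R where "R = {p \<in> K. t < fst p}"
    have R: "finite R" "R \<noteq> {}" using coherent True by (auto simp: R_def coherent_def)
    define z where "z = Min (fst ` R)"
    have "z \<in> fst ` R" unfolding z_def using R by (intro Min_in) auto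
    then obtain w where zw: "(z, w) \<in> K" "t < z" by (auto simp: R_def)
    have zmin: "z \<le> a" if "(a, b) \<in> K" "t < a" for a b
      unfolding z_def using R that by (intro Min_le) (force simp: R_def)+
    have "u z > 0" using grow[of z] zw zmin ut by fastforce
    then have vw: "v w > 0" using sgn_nodes[OF zw(1)] by (metis sgn_1_pos)
    have sw: "s < w" using matched_order(1)[OF m zw(1)] zw(2) by simp
    have "isCont v w" using deriv_v DERIV_isCont by blast
    then have "(v \<longlongrightarrow> v w) (at_left w)" by (simp add: isCont_def filterlim_at_split)
    then have "eventually (\<lambda>x. v x > 0) (at_left w)" using vw order_tendstoD(1) by blast
    moreover have "eventually (\<lambda>x. x \<in> {s<..<w}) (at_left w)"
      using sw by (rule eventually_at_leftI[rotated]) simp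
    ultimately have "eventually (\<lambda>x. v x > 0 \<and> x \<in> {s<..<w}) (at_left w)"
      by eventually_elim simp
    then obtain s' where s': "v s' > 0" "s < s'" "s' < w"
      using eventually_happens'[of "at_left w"] by auto
    have "matched K t s'" unfolding matched_def
    proof (intro allI impI)
      fix a b assume ab: "(a, b) \<in> K"
      show "sgn (t - a) = sgn (s' - b)"
      proof (cases "t < a")
        case True
        then have "z \<le> a" using zmin ab by blast
        then have "w \<le> b" using matched_order[OF coherentD[OF coherent zw(1)] ab] by force
        then show ?thesis using True s' by simp
      next
        case False
        then have "a < t" using t ab by force
        then show ?thesis using matched_order[OF m ab] s' by simp
      qed
    qed
    then show ?thesis using s' by blast
  qed
qed


text \<open>
  A decreasing function has to be followed to the left end of the gap instead.
\<close>

lemma positive_in_gap: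
  assumes m: "matched K t s" and t: "t \<notin> fst ` K" and ut: "u t \<ge> 0"
  shows "\<exists>s'. matched K t s' \<and> v s' > 0"
proof (cases "u' t > 0")
  case True
  then show ?thesis using positive_to_the_right assms by blast
next
  case False
  moreover have "u' t \<noteq> 0" using critical_u t by blast
  ultimately have "u' t < 0" by simp
  interpret reflect: gap_data "map_prod uminus uminus ` K"
    "\<lambda>x. u (- x)" "\<lambda>x. - u' (- x)" "\<lambda>x. v (- x)" "\<lambda>x. - v' (- x)"
    by (rule gap_data_reflect)
  have "matched (map_prod uminus uminus ` K) (- t) (- s)"
    using m by (simp add: matched_reflect)
  moreover have "- t \<notin> fst ` map_prod uminus uminus ` K" using t by force
  ultimately obtain s' where "matched (map_prod uminus uminus ` K) (- t) s'" "v (- s') > 0"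
    using reflect.positive_to_the_right[of "- t" "- s"] \<open>u' t < 0\<close> ut by auto
  then show ?thesis by (auto simp: matched_reflect)
qed

lemma negative_in_gap:
  assumes "matched K t s" "t \<notin> fst ` K" "u t \<le> 0"
  shows "\<exists>s'. matched K t s' \<and> v s' < 0"
proof -
  interpret neg: gap_data K "\<lambda>x. - u x" "\<lambda>x. - u' x" "\<lambda>x. - v x" "\<lambda>x. - v' x"
    by (rule gap_data_uminus)
  show ?thesis using neg.positive_in_gap[of t s] assms by auto
qed

lemma zero_between:
  assumes "matched K t a" "matched K t b" "v a > 0" "v b < 0"
  shows "\<exists>c. matched K t c \<and> v c = 0"
proof -
  have cont: "continuous_on A v" for A
    using deriv_v DERIV_isCont by (intro continuous_at_imp_continuous_on) blast
  show ?thesis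
  proof (cases "a \<le> b")
    case True
    obtain c where "a \<le> c" "c \<le> b" "v c = 0"
      using IVT2'[OF _ _ True cont, of 0] assms(3,4) by auto
    then show ?thesis using matched_between assms by blast
  next
    case False
    then have "b \<le> a" by simp
    obtain c where "b \<le> c" "c \<le> a" "v c = 0"
      using IVT'[OF _ _ \<open>b \<le> a\<close> cont, of 0] assms(3,4) by auto
    then show ?thesis using matched_between assms by blast
  qed
qed

text \<open>
  At a zero of \<open>u\<close> in the interior of a gap, \<open>u\<close> changes sign, so \<open>v\<close> takes both signs in the
  corresponding gap.
\<close>

lemma zero_in_gap:
  assumes "matched K t s" "t \<notin> fst ` K" "u t = 0"
  shows "\<exists>s'. matched K t s' \<and> v s' = 0"
proof -
  obtain a b where "matched K t a" "v a > 0" "matched K t b" "v b < 0"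
    using positive_in_gap[OF assms(1,2)] negative_in_gap[OF assms(1,2)] assms(3) by auto
  then show ?thesis using zero_between by blast
qed

text \<open>
  On a gap that contains a zero \<open>a\<close> of \<open>u\<close>, the mean value theorem reads the sign off the side of \<open>a\<close>
  and the direction of monotonicity.
\<close>

lemma sgn_from_zero:
  assumes ms: "matched K t s" "matched K a s" and t: "t \<notin> fst ` K" and a: "u a = 0"
  shows "sgn (u t) = sgn (t - a) * sgn (u' t)"
proof -
  have same: "sgn (u' c) = sgn (u' t)" if "min a t \<le> c" "c \<le> max a t" for c
  proof -
    have "matched (K\<inverse>) s a" "matched (K\<inverse>) s t" using ms by (simp_all add: matched_converse)
    then have "matched (K\<inverse>) s c"
      using that matched_between[of "K\<inverse>" s a t c] matched_between[of "K\<inverse>" s t a c] by fastforce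
    then show ?thesis using sgn_deriv ms(1) by (metis matched_converse)
  qed
  consider "t = a" | "t < a" | "a < t" by linarith
  then show ?thesis
  proof cases
    case 1
    then show ?thesis using a by simp
  next
    case 2
    obtain c where c: "t < c" "c < a" "u a - u t = (a - t) * u' c"
      using MVT2[OF 2, of u u'] deriv_u by blast
    then have "u t = (t - a) * u' c" using a by (simp add: algebra_simps)
    then show ?thesis using same[of c] c by (simp add: sgn_mult)
  next
    case 3
    obtain c where c: "a < c" "c < t" "u t - u a = (t - a) * u' c"
      using MVT2[OF 3, of u u'] deriv_u by blast
    then have "u t = (t - a) * u' c" using a by simp
    then show ?thesis using same[of c] c by (simp add: sgn_mult)
  qed
qed

text \<open>
  By Rolle's theorem a critical point, and thus a node, lies between two zeros of \<open>u\<close>.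
\<close>

lemma zeros_separated:
  assumes "u a = 0" "u a' = 0" "a < a'" "matched K a b" "matched K a' b'"
  shows "b < b'"
proof -
  have "\<exists>c>a. c < a' \<and> u' c = 0"
  proof -
    have "continuous_on {a..a'} u"
      using deriv_u DERIV_isCont by (intro continuous_at_imp_continuous_on) blast
    then obtain c where "a < c" "c < a'" "DERIV u c :> 0"
      using Rolle[OF assms(3)] assms(1,2) deriv_u real_differentiable_def by metis
    then show ?thesis using DERIV_unique deriv_u by blast
  qed
  then obtain c d where c: "a < c" "c < a'" "(c, d) \<in> K" using critical_u by force
  then have "b < d" "d < b'" using matched_order assms(4,5) by blast+
  then show ?thesis by simp
qed

definition zero_pairs :: "(real \<times> real) set" where
  "zero_pairs = {(a, b). u a = 0 \<and> v b = 0 \<and> matched K a b}"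

lemma zero_pairs_order:
  assumes "(a, b) \<in> zero_pairs" "(a', b') \<in> zero_pairs"
  shows "a < a' \<longleftrightarrow> b < b'"
proof -
  interpret conv: gap_data "K\<inverse>" v v' u u' by (rule gap_data_converse)
  show ?thesis
    using assms zeros_separated[of a a' b b'] conv.zeros_separated[of b b' a a']
    unfolding zero_pairs_def by (auto simp: matched_converse)
qed

lemma coherent_extension:
  assumes "finite {x. u x = 0}" "finite {x. v x = 0}"
  shows "coherent (K \<union> zero_pairs)"
proof -
  have "finite ({x. u x = 0} \<times> {x. v x = 0})" using assms by blast
  then have "finite zero_pairs" by (rule rev_finite_subset) (auto simp: zero_pairs_def)
  then have fin: "finite (K \<union> zero_pairs)" using coherent by (simp add: coherent_def)
  have zz: "sgn (a - a') = sgn (b - b')"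
    if "(a, b) \<in> zero_pairs" "(a', b') \<in> zero_pairs" for a b a' b'
    using zero_pairs_order[OF that] zero_pairs_order[OF that(2,1)] by (auto simp: sgn_if)
  have kz: "sgn (a - z) = sgn (b - w)" if "(a, b) \<in> zero_pairs" "(z, w) \<in> K" for a b z w
    using that matchedD by (auto simp: zero_pairs_def)
  have zk: "sgn (z - a) = sgn (w - b)" if "(a, b) \<in> zero_pairs" "(z, w) \<in> K" for a b z w
    using kz[OF that] sgn_minus[of "a - z"] sgn_minus[of "b - w"] by simp
  have "matched (K \<union> zero_pairs) z w" if "(z, w) \<in> K \<union> zero_pairs" for z w
    using that zz kz zk coherentD[OF coherent] unfolding matched_def by blast
  then show ?thesis using fin by (simp add: coherent_def)
qed

text \<open>
  Inside a gap there are two cases.  If one of the functions has a zero there, then so has the other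
  by \<open>zero_in_gap\<close>, these zeros are paired, and \<open>sgn_from_zero\<close> gives the signs on either side of
  them.  Otherwise neither function changes sign on the gap, and \<open>v\<close> takes the sign of \<open>u\<close> somewhere
  in it by \<open>positive_in_gap\<close> and \<open>negative_in_gap\<close>.
\<close>

lemma sgn_extension:
  assumes ts: "matched (K \<union> zero_pairs) t s"
  shows "sgn (u t) = sgn (v s)"
proof -
  interpret conv: gap_data "K\<inverse>" v v' u u' by (rule gap_data_converse)
  have m: "matched K t s" using ts by (auto simp: matched_def)
  show ?thesis
  proof (cases "t \<in> fst ` K \<or> s \<in> snd ` K")
    case True
    then obtain z w where zw: "(z, w) \<in> K" "t = z \<or> s = w" by force
    then have "t = z" "s = w" using matched_order(3)[OF m zw(1)] by auto
    then show ?thesis using sgn_nodes zw by blast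
  next
    case False
    then have t: "t \<notin> fst ` K" and s: "s \<notin> snd ` K" by auto
    then have s': "s \<notin> fst ` K\<inverse>" by force
    have m': "matched (K\<inverse>) s t" using m by (simp add: matched_converse)
    \<comment> \<open>A pair of zeros in the gap determines both signs.\<close>
    have via_pair: ?thesis if "(a, b) \<in> zero_pairs" "matched K t b" for a b
    proof -
      have ab: "u a = 0" "v b = 0" "matched K a b" using that by (auto simp: zero_pairs_def)
      have "sgn (u t) = sgn (t - a) * sgn (u' t)"
        using sgn_from_zero[OF that(2) ab(3) t ab(1)] .
      moreover have "matched (K\<inverse>) b t" using that(2) by (simp add: matched_converse)
      then have "sgn (v s) = sgn (s - b) * sgn (v' s)"
        using conv.sgn_from_zero[OF m' _ s' ab(2)] by simp
      moreover have "sgn (t - a) = sgn (s - b)" using matchedD[OF ts] that by blast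
      moreover have "sgn (u' t) = sgn (v' s)" using sgn_deriv m by blast
      ultimately show ?thesis by simp
    qed
    \<comment> \<open>A zero of \<open>v\<close> in the gap has a partner, since \<open>zero_in_gap\<close> holds with the roles exchanged.\<close>
    have from_v: ?thesis if b: "v b = 0" "matched K t b" for b
    proof -
      have "b \<notin> fst ` K\<inverse>" using t matched_order(3)[OF b(2)] by force
      moreover have "matched (K\<inverse>) b t" using b by (simp add: matched_converse)
      ultimately obtain a where "matched (K\<inverse>) b a" "u a = 0"
        using conv.zero_in_gap b(1) by blast
      then have "(a, b) \<in> zero_pairs" using b by (simp add: zero_pairs_def matched_converse)
      then show ?thesis using via_pair b(2) by blast
    qed
    consider "u t = 0" | "v s = 0" | "u t > 0" "v s < 0" | "u t < 0" "v s > 0" | "sgn (u t) = sgn (v s)"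
      by (cases "u t" "0::real" rule: linorder_cases; cases "v s" "0::real" rule: linorder_cases) auto
    then show ?thesis
    proof cases
      case 1
      then show ?thesis using zero_in_gap[OF m t] from_v by blast
    next
      case 2
      then show ?thesis using from_v m by blast
    next
      case 3
      then show ?thesis using positive_in_gap[OF m t] zero_between[of t _ s] m from_v by fastforce
    next
      case 4
      then show ?thesis using negative_in_gap[OF m t] zero_between[of t s] m from_v by fastforce
    qed
  qed
qed

end

section \<open>Sign matchings of real polynomials\<close>

text \<open>
  In the applications, \<open>S\<close> consists of the pairs of specializations \<open>(P x, P y)\<close> of the members \<open>P\<close> of a family at
  two parameters \<open>x\<close> and \<open>y\<close>.
\<close>

definition sign_matching :: "(real \<times> real) set \<Rightarrow> (real poly \<times> real poly) set \<Rightarrow> bool" where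
  "sign_matching K S \<longleftrightarrow> coherent K \<and>
     (\<forall>t s. matched K t s \<longrightarrow> (\<forall>f g. (f, g) \<in> S \<longrightarrow> sgn (poly f t) = sgn (poly g s)))"

lemma sign_matchingD:
  "sign_matching K S \<Longrightarrow> matched K t s \<Longrightarrow> (f, g) \<in> S \<Longrightarrow> sgn (poly f t) = sgn (poly g s)"
  by (auto simp: sign_matching_def)

lemma sign_matching_coherent: "sign_matching K S \<Longrightarrow> coherent K"
  by (simp add: sign_matching_def)

lemma sign_matching_converse: "sign_matching K S \<Longrightarrow> sign_matching (K\<inverse>) (S\<inverse>)"
  by (auto simp: sign_matching_def coherent_converse matched_converse)

text \<open>
  At a zero that is no node, the polynomial would vanish on the whole cell.
\<close>

lemma sign_matching_root:
  assumes K: "sign_matching K S" and fg: "(f, g) \<in> S" and f: "f \<noteq> 0" "poly f t = 0"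
  shows "t \<in> fst ` K"
proof (rule ccontr)
  assume t: "t \<notin> fst ` K"
  have coh: "coherent K" using K by (rule sign_matching_coherent)
  obtain s where s: "matched K t s" using matched_total[OF coh] by blast
  have "poly g s = 0" using sign_matchingD[OF K s fg] f(2) by (simp add: sgn_0_0)
  have "eventually (\<lambda>x. matched K x s) (nhds t)"
    using eventually_matched[OF _ s t] coh by (simp add: coherent_def)
  then have "eventually (\<lambda>x. poly f x = 0) (nhds t)"
  proof (rule eventually_mono)
    fix x assume "matched K x s"
    then show "poly f x = 0" using sign_matchingD[OF K _ fg] \<open>poly g s = 0\<close> by (metis sgn_0 sgn_0_0)
  qed
  then obtain U where U: "open U" "t \<in> U" "\<forall>x\<in>U. poly f x = 0"
    unfolding eventually_nhds by blast
  then have "finite U" using poly_roots_finite[OF f(1)] by (auto intro: rev_finite_subset)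
  then show False using U(1,2) finite_imp_not_open by blast
qed

text \<open>
  Nodes at which no member of the family vanishes can be dropped, because all signs are constant
  across them.  This discards the zeros of the auxiliary polynomials, at which nothing is known
  about the sign of the polynomial that is to be added.
\<close>

lemma sign_matching_roots_only:
  assumes K: "sign_matching K S" and zero: "\<forall>f g. (f, g) \<in> S \<longrightarrow> (f = 0 \<longleftrightarrow> g = 0)"
    and L_def: "L = {(z, w) \<in> K. \<exists>f g. (f, g) \<in> S \<and> f \<noteq> 0 \<and> poly f z = 0}"
  shows "sign_matching L S"
    and "\<And>f g t. (f, g) \<in> S \<Longrightarrow> f \<noteq> 0 \<Longrightarrow> poly f t = 0 \<Longrightarrow> t \<in> fst ` L"
    and "\<And>f g s. (f, g) \<in> S \<Longrightarrow> g \<noteq> 0 \<Longrightarrow> poly g s = 0 \<Longrightarrow> s \<in> snd ` L"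
proof -
  have coh: "coherent K" using K by (rule sign_matching_coherent)
  have LK: "L \<subseteq> K" by (auto simp: L_def)
  show 1: "t \<in> fst ` L" if fg: "(f, g) \<in> S" "f \<noteq> 0" "poly f t = 0" for f g t
  proof -
    obtain w where "(t, w) \<in> K" using sign_matching_root[OF K fg] by force
    then have "(t, w) \<in> L" using fg by (auto simp: L_def)
    then show ?thesis by force
  qed
  show 2: "s \<in> snd ` L" if fg: "(f, g) \<in> S" "g \<noteq> 0" "poly g s = 0" for f g s
  proof -
    have "(g, f) \<in> S\<inverse>" using fg by simp
    then obtain z where zs: "(z, s) \<in> K"
      using sign_matching_root[OF sign_matching_converse[OF K] _ fg(2,3)] by force
    then have "sgn (poly f z) = sgn (poly g s)"
      using sign_matchingD[OF K coherentD[OF coh] fg(1)] by blast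
    then have "poly f z = 0" using fg(3) by (simp add: sgn_0_0)
    moreover have "f \<noteq> 0" using zero fg by blast
    ultimately have "(z, s) \<in> L" using zs fg(1) by (auto simp: L_def)
    then show ?thesis by force
  qed
  have cohL: "coherent L"
    using coh LK unfolding coherent_def matched_def by (meson finite_subset subsetD)
  have "sgn (poly f t) = sgn (poly g s)" if ts: "matched L t s" and fg: "(f, g) \<in> S" for t s f g
  proof -
    obtain s' where s': "matched K t s'" using matched_total[OF coh] by blast
    then have Ls': "matched L t s'" using LK by (auto simp: matched_def)
    have "sgn (poly g s) = sgn (poly g s')"
    proof (cases "g = 0 \<or> s = s'")
      case False
      have no: "poly g c \<noteq> 0" if c: "min s s' \<le> c" "c \<le> max s s'" for c
      proof
        assume "poly g c = 0"
        then obtain z where z: "(z, c) \<in> L" using 2[OF fg] False by force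
        have "s = c \<longleftrightarrow> s' = c" using matched_order(3)[OF ts z] matched_order(3)[OF Ls' z] by blast
        moreover have "s < c \<longleftrightarrow> s' < c" using matched_order(1)[OF ts z] matched_order(1)[OF Ls' z] by blast
        ultimately show False using False c by (auto simp: min_def max_def split: if_splits)
      qed
      show ?thesis
      proof (rule ccontr)
        assume ne: "sgn (poly g s) \<noteq> sgn (poly g s')"
        have "poly g s \<noteq> 0" "poly g s' \<noteq> 0" by (intro no; simp)+
        then have neg: "poly g s * poly g s' < 0" using ne by (auto simp: sgn_if mult_less_0_iff split: if_splits)
        have "s < s' \<or> s' < s" using False by auto
        then show False
          using poly_IVT[of s s' g] poly_IVT[of s' s g] neg no by (fastforce simp: mult.commute)
      qed
    qed auto
    then show ?thesis using sign_matchingD[OF K s' fg] by simp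
  qed
  then show "sign_matching L S" using cohL by (simp add: sign_matching_def)
qed

lemma eventually_sgn_poly_at_top:
  fixes p :: "real poly"
  shows "eventually (\<lambda>x. sgn (poly p x) = sgn (lead_coeff p)) at_top"
proof -
  have pos: "eventually (\<lambda>x. poly q x > 0) at_top" if q: "lead_coeff q > 0" for q :: "real poly"
  proof -
    obtain n where "\<forall>x\<ge>n. lead_coeff q \<le> poly q x" using poly_pinfty_gt_lc[OF q] by blast
    then have "\<forall>x\<ge>n. poly q x > 0" using q by fastforce
    then show ?thesis unfolding eventually_at_top_linorder by blast
  qed
  consider "p = 0" | "lead_coeff p > 0" | "lead_coeff (- p) > 0"
    by (cases "lead_coeff p" "0::real" rule: linorder_cases) auto
  then show ?thesis
  proof cases
    case 2
    then show ?thesis using pos[OF 2] by (auto elim: eventually_mono)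
  next
    case 3
    then show ?thesis using pos[OF 3] by (auto elim: eventually_mono)
  qed simp
qed

lemma eventually_sgn_poly_at_bot:
  fixes p :: "real poly"
  shows "eventually (\<lambda>x. sgn (poly p x) = sgn (lead_coeff p * (- 1) ^ degree p)) at_bot"
proof -
  have "lead_coeff (pcompose p [:0, - 1:]) = lead_coeff p * (- 1) ^ degree p"
    by (subst lead_coeff_comp) auto
  then have "eventually (\<lambda>x. sgn (poly p (- x)) = sgn (lead_coeff p * (- 1) ^ degree p)) at_top"
    using eventually_sgn_poly_at_top[of "pcompose p [:0, - 1:]"] by (simp add: poly_pcompose)
  then show ?thesis by (simp add: at_bot_mirror eventually_filtermap)
qed

text \<open>
  Only the zeros of the members of \<open>T\<close> are kept as nodes.  They contain the critical points of \<open>u\<close>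
  and \<open>v\<close>, and the signs of \<open>u\<close> and \<open>v\<close> at the nodes agree by assumption, so pairing the zeros of \<open>u\<close>
  and \<open>v\<close> in corresponding gaps extends the matching.
\<close>

lemma sign_matching_insert:
  assumes K: "sign_matching K S" and T: "T \<subseteq> S"
    and zero: "\<forall>f g. (f, g) \<in> T \<longrightarrow> (f = 0 \<longleftrightarrow> g = 0)"
    and deriv: "(pderiv u, pderiv v) \<in> T"
    and deg: "degree u > 0" "degree v = degree u" and lead: "sgn (lead_coeff u) = sgn (lead_coeff v)"
    and nodes: "\<And>f g t s. (f, g) \<in> T \<Longrightarrow> f \<noteq> 0 \<Longrightarrow> poly f t = 0 \<Longrightarrow> poly g s = 0 \<Longrightarrow>
      matched K t s \<Longrightarrow> sgn (poly u t) = sgn (poly v s)"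
  shows "\<exists>K'. sign_matching K' (insert (u, v) T)"
proof -
  have KT: "sign_matching K T" using K T by (auto simp: sign_matching_def)
  define L where "L = {(z, w) \<in> K. \<exists>f g. (f, g) \<in> T \<and> f \<noteq> 0 \<and> poly f z = 0}"
  note L = sign_matching_roots_only[OF KT zero L_def]
  have uv: "pderiv u \<noteq> 0" "pderiv v \<noteq> 0" using deg by (auto simp: pderiv_eq_0_iff)
  interpret gap_data L "poly u" "poly (pderiv u)" "poly v" "poly (pderiv v)"
  proof
    show "coherent L" using L(1) by (rule sign_matching_coherent)
    show "(poly u has_real_derivative poly (pderiv u) x) (at x)" for x by (rule poly_DERIV)
    show "(poly v has_real_derivative poly (pderiv v) x) (at x)" for x by (rule poly_DERIV)
    show "sgn (poly (pderiv u) t) = sgn (poly (pderiv v) s)" if "matched L t s" for t s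
      using sign_matchingD[OF L(1) that deriv] .
    show "sgn (poly u z) = sgn (poly v w)" if zw: "(z, w) \<in> L" for z w
    proof -
      obtain f g where fg: "(f, g) \<in> T" "f \<noteq> 0" "poly f z = 0" "(z, w) \<in> K"
        using zw by (auto simp: L_def)
      have m: "matched K z w" using coherentD[OF sign_matching_coherent[OF K] fg(4)] .
      have "poly g w = 0" using sign_matchingD[OF KT m fg(1)] fg(3) by (simp add: sgn_0_0)
      then show ?thesis using nodes fg m by blast
    qed
    show "x \<in> fst ` L" if "poly (pderiv u) x = 0" for x using L(2)[OF deriv uv(1) that] .
    show "x \<in> snd ` L" if "poly (pderiv v) x = 0" for x using L(3)[OF deriv uv(2) that] .
    show "\<exists>\<sigma>. eventually (\<lambda>x. sgn (poly u x) = \<sigma>) at_top \<and> eventually (\<lambda>x. sgn (poly v x) = \<sigma>) at_top"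
      using eventually_sgn_poly_at_top[of u] eventually_sgn_poly_at_top[of v] lead by auto
    show "\<exists>\<sigma>. eventually (\<lambda>x. sgn (poly u x) = \<sigma>) at_bot \<and> eventually (\<lambda>x. sgn (poly v x) = \<sigma>) at_bot"
      using eventually_sgn_poly_at_bot[of u] eventually_sgn_poly_at_bot[of v] lead deg(2)
      by (auto simp: sgn_mult)
  qed
  have "u \<noteq> 0" "v \<noteq> 0" using deg by auto
  then have coh: "coherent (L \<union> zero_pairs)"
    using coherent_extension poly_roots_finite by blast
  have "sgn (poly f t) = sgn (poly g s)"
    if "matched (L \<union> zero_pairs) t s" "(f, g) \<in> insert (u, v) T" for f g t s
  proof -
    have "matched L t s" using that(1) by (auto simp: matched_def)
    then show ?thesis using sgn_extension[OF that(1)] sign_matchingD[OF L(1)] that(2) by auto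
  qed
  then show ?thesis using coh unfolding sign_matching_def by blast
qed

section \<open>Polynomials depending on parameters\<close>

definition sign_equal :: "('a \<Rightarrow> real) set \<Rightarrow> 'a \<Rightarrow> 'a \<Rightarrow> bool" where
  "sign_equal C x y \<longleftrightarrow> (\<forall>c\<in>C. sgn (c x) = sgn (c y))"

lemma sign_equal_mono: "sign_equal D x y \<Longrightarrow> C \<subseteq> D \<Longrightarrow> sign_equal C x y"
  by (auto simp: sign_equal_def)

lemma polynomial_functions_uminus:
  "p \<in> polynomial_functions I \<Longrightarrow> (\<lambda>x. - p x) \<in> polynomial_functions I"
  using polynomial_functions.mult[OF polynomial_functions.const[of "- 1"]] by fastforce

lemma polynomial_functions_diff:
  "p \<in> polynomial_functions I \<Longrightarrow> q \<in> polynomial_functions I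
    \<Longrightarrow> (\<lambda>x. p x - q x) \<in> polynomial_functions I"
  using polynomial_functions.add[OF _ polynomial_functions_uminus] by fastforce

lemma polynomial_functions_power:
  "p \<in> polynomial_functions I \<Longrightarrow> (\<lambda>x. p x ^ n) \<in> polynomial_functions I"
  by (induction n) (auto intro: polynomial_functions.intros)

lemma polynomial_functions_sum:
  "(\<And>a. a \<in> A \<Longrightarrow> f a \<in> polynomial_functions I)
    \<Longrightarrow> (\<lambda>x. \<Sum>a\<in>A. f a x) \<in> polynomial_functions I"
  by (induction A rule: infinite_finite_induct) (auto intro: polynomial_functions.intros)

lemmas polynomial_function_intros =
  polynomial_functions.intros polynomial_functions_uminus polynomial_functions_diff
  polynomial_functions_power polynomial_functions_sum

text \<open>
  Polynomials in one variable whose coefficients are polynomial functions of the parameters.  The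
  number \<open>n\<close> bounds the degree strictly and uniformly.  The actual degree may drop at some parameters.
\<close>

definition poly_family :: "'i set \<Rightarrow> nat \<Rightarrow> (('i \<Rightarrow> real) \<Rightarrow> real poly) \<Rightarrow> bool" where
  "poly_family I n P \<longleftrightarrow>
     (\<forall>k. (\<lambda>x. coeff (P x) k) \<in> polynomial_functions I) \<and> (\<forall>x. \<forall>k\<ge>n. coeff (P x) k = 0)"

lemma poly_family_coeff: "poly_family I n P \<Longrightarrow> (\<lambda>x. coeff (P x) k) \<in> polynomial_functions I"
  by (simp add: poly_family_def)

lemma poly_family_zero: "poly_family I n P \<Longrightarrow> n \<le> k \<Longrightarrow> coeff (P x) k = 0"
  by (simp add: poly_family_def)

lemma poly_family_degree:
  assumes "poly_family I (Suc n) P" "coeff (P x) n \<noteq> 0"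
  shows "degree (P x) = n"
proof (rule antisym)
  show "degree (P x) \<le> n" using poly_family_zero[OF assms(1)] by (intro degree_le) auto
  show "n \<le> degree (P x)" using assms(2) by (rule le_degree)
qed

lemma poly_family_mono: "poly_family I n P \<Longrightarrow> n \<le> m \<Longrightarrow> poly_family I m P"
  by (auto simp: poly_family_def)

lemma poly_family_cutoff:
  assumes "\<And>k. (\<lambda>x. coeff (P x) k) \<in> polynomial_functions I"
  shows "poly_family I n (\<lambda>x. poly_cutoff n (P x))"
proof -
  have "(\<lambda>x. coeff (poly_cutoff n (P x)) k) \<in> polynomial_functions I" for k
    using assms by (cases "k < n") (auto simp: coeff_poly_cutoff intro: polynomial_functions.const)
  then show ?thesis by (simp add: poly_family_def coeff_poly_cutoff)
qed

lemma poly_family_pderiv: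
  assumes "poly_family I (Suc n) P"
  shows "poly_family I n (\<lambda>x. pderiv (P x))"
  unfolding poly_family_def
proof (intro conjI allI impI)
  show "(\<lambda>x. coeff (pderiv (P x)) k) \<in> polynomial_functions I" for k
    unfolding coeff_pderiv by (intro polynomial_function_intros poly_family_coeff[OF assms])
  show "coeff (pderiv (P x)) k = 0" if "n \<le> k" for x k
    using that poly_family_zero[OF assms] by (simp add: coeff_pderiv)
qed

text \<open>
  One step of pseudo-division of \<open>P\<close> by \<open>Q\<close>, when \<open>n\<close> is the degree of \<open>P\<close> and \<open>e\<close> that of \<open>Q\<close>.
  Multiplying \<open>P\<close> by the square of the leading coefficient of \<open>Q\<close> avoids fractions and preserves
  signs.  Since the degree of \<open>Q\<close> depends on the parameter, all exponents \<open>e\<close> are used.  The cutoff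
  enforces the degree bound at parameters where \<open>e\<close> is not the degree.
\<close>

definition reduction ::
  "nat \<Rightarrow> nat \<Rightarrow> ('a \<Rightarrow> real poly) \<Rightarrow> ('a \<Rightarrow> real poly) \<Rightarrow> 'a \<Rightarrow> real poly" where
  "reduction n e P Q = (\<lambda>x. poly_cutoff n
     (smult ((coeff (Q x) e)\<^sup>2) (P x) - monom (coeff (P x) n * coeff (Q x) e) (n - e) * Q x))"

lemma poly_family_reduction:
  assumes "poly_family I a P" "poly_family I b Q"
  shows "poly_family I n (reduction n e P Q)"
  unfolding reduction_def
proof (rule poly_family_cutoff)
  fix k
  have "(\<lambda>x. (coeff (Q x) e)\<^sup>2 * coeff (P x) k - coeff (P x) n * coeff (Q x) e *
      (if k < n - e then 0 else coeff (Q x) (k - (n - e)))) \<in> polynomial_functions I"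
    by (cases "k < n - e")
      (auto intro!: polynomial_function_intros poly_family_coeff[OF assms(1)] poly_family_coeff[OF assms(2)])
  then show "(\<lambda>x. coeff (smult ((coeff (Q x) e)\<^sup>2) (P x) -
      monom (coeff (P x) n * coeff (Q x) e) (n - e) * Q x) k) \<in> polynomial_functions I"
    by (simp add: coeff_monom_mult if_distrib cong: if_cong)
qed

lemma sgn_reduction_at_root:
  assumes P: "poly_family I (Suc n) P" and Q: "poly_family I (Suc n) Q"
    and e: "e = degree (Q x)" and nz: "Q x \<noteq> 0" and root: "poly (Q x) t = 0"
  shows "sgn (poly (reduction n e P Q x) t) = sgn (poly (P x) t)"
proof -
  let ?h = "smult ((coeff (Q x) e)\<^sup>2) (P x) - monom (coeff (P x) n * coeff (Q x) e) (n - e) * Q x"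
  have lc: "coeff (Q x) e \<noteq> 0" using nz e by simp
  then have en: "e \<le> n" using poly_family_zero[OF Q] not_less_eq_eq by blast
  have "coeff ?h k = 0" if "n \<le> k" for k
  proof (cases "k = n")
    case True
    then show ?thesis using en by (simp add: coeff_monom_mult power2_eq_square)
  next
    case False
    then have "Suc n \<le> k" "k - (n - e) > e" using that en by auto
    then show ?thesis
      using poly_family_zero[OF P, of k] e coeff_eq_0[of "Q x" "k - (n - e)"] by (simp add: coeff_monom_mult)
  qed
  then have "poly_cutoff n ?h = ?h" by (intro poly_eqI) (auto simp: coeff_poly_cutoff)
  then have "poly (reduction n e P Q x) t = (coeff (Q x) e)\<^sup>2 * poly (P x) t"
    using root by (simp add: reduction_def)
  moreover have "sgn ((coeff (Q x) e)\<^sup>2) = 1" using lc by (auto simp: sgn_if)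
  ultimately show ?thesis by (simp add: sgn_mult)
qed

definition signs_determined_by ::
  "(('i \<Rightarrow> real) \<Rightarrow> real) set \<Rightarrow> (('i \<Rightarrow> real) \<Rightarrow> real poly) set \<Rightarrow> bool" where
  "signs_determined_by C \<P> \<longleftrightarrow>
     (\<forall>x y. sign_equal C x y \<longrightarrow> (\<exists>K. sign_matching K ((\<lambda>P. (P x, P y)) ` \<P>)))"

text \<open>
  The members of \<open>\<A>\<close> have degree less than \<open>n\<close>, those of \<open>\<B>\<close> and \<open>P\<close> at most \<open>n\<close>.  The family \<open>\<B>\<close> is
  kept while \<open>P\<close> is traded for polynomials of degree less than \<open>n\<close>.  Where the top coefficient of \<open>P\<close>
  vanishes, its truncation replaces it.  Elsewhere its derivative and its reductions by all other
  polynomials do.  The coefficients have to be among the sign conditions to ensure that each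
  polynomial has the same degree at both parameters.
\<close>

lemma signs_determined_step:
  assumes n: "n > 0" and P: "poly_family I (Suc n) P"
    and fin: "finite \<A>" "finite \<B>"
    and A: "\<And>Q. Q \<in> \<A> \<Longrightarrow> poly_family I n Q" and B: "\<And>Q. Q \<in> \<B> \<Longrightarrow> poly_family I (Suc n) Q"
    and IH: "\<And>\<A>'. finite \<A>' \<Longrightarrow> (\<And>Q. Q \<in> \<A>' \<Longrightarrow> poly_family I n Q) \<Longrightarrow>
      \<exists>C. finite C \<and> C \<subseteq> polynomial_functions I \<and> signs_determined_by C (\<A>' \<union> \<B>)"
  shows "\<exists>C. finite C \<and> C \<subseteq> polynomial_functions I \<and> signs_determined_by C (insert P (\<A> \<union> \<B>))"
proof -
  define P' where "P' = (\<lambda>x. pderiv (P x))"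
  define \<Q> where "\<Q> = insert P' (\<A> \<union> \<B>)"
  have P': "poly_family I n P'" unfolding P'_def using P by (rule poly_family_pderiv)
  have Q: "poly_family I (Suc n) Q" if "Q \<in> \<Q>" for Q
    using that A B P' poly_family_mono[of I n _ "Suc n"] by (auto simp: \<Q>_def)
  have finQ: "finite \<Q>" using fin by (simp add: \<Q>_def)
  define R where "R = (\<lambda>(e, Q). reduction n e P Q) ` ({..n} \<times> \<Q>)"
  have "\<exists>C. finite C \<and> C \<subseteq> polynomial_functions I \<and>
      signs_determined_by C (insert (\<lambda>x. poly_cutoff n (P x)) \<A> \<union> \<B>)"
    using fin A poly_family_cutoff[OF poly_family_coeff[OF P]] by (intro IH) auto
  then obtain C1 where C1: "finite C1" "C1 \<subseteq> polynomial_functions I"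
    "signs_determined_by C1 (insert (\<lambda>x. poly_cutoff n (P x)) \<A> \<union> \<B>)" by blast
  have "\<exists>C. finite C \<and> C \<subseteq> polynomial_functions I \<and> signs_determined_by C (insert P' (\<A> \<union> R) \<union> \<B>)"
  proof (rule IH)
    show "finite (insert P' (\<A> \<union> R))" using fin finQ by (simp add: R_def)
    show "poly_family I n Q'" if "Q' \<in> insert P' (\<A> \<union> R)" for Q'
      using that A P' poly_family_reduction[OF P Q] by (auto simp: R_def)
  qed
  then obtain C2 where C2: "finite C2" "C2 \<subseteq> polynomial_functions I"
    "signs_determined_by C2 (insert P' (\<A> \<union> R) \<union> \<B>)" by blast
  \<comment> \<open>These conditions fix the degrees and the leading signs.\<close>
  define C3 where "C3 = (\<lambda>(k, Q). (\<lambda>x. coeff (Q x) k)) ` ({..n} \<times> insert P \<Q>)"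
  have C3: "finite C3" "C3 \<subseteq> polynomial_functions I"
    using finQ poly_family_coeff[OF Q] poly_family_coeff[OF P] by (auto simp: C3_def)
  have "\<exists>K. sign_matching K ((\<lambda>P. (P x, P y)) ` insert P (\<A> \<union> \<B>))"
    if xy: "sign_equal (C1 \<union> C2 \<union> C3) x y" for x y
  proof -
    have coeffs: "sgn (coeff (Q x) k) = sgn (coeff (Q y) k)" if "Q \<in> insert P \<Q>" for Q k
    proof (cases "k \<le> n")
      case True
      then have "(\<lambda>x. coeff (Q x) k) \<in> C1 \<union> C2 \<union> C3" using that by (force simp: C3_def)
      with xy[unfolded sign_equal_def] show ?thesis by (rule bspec)
    next
      case False
      then show ?thesis using that P Q poly_family_zero[of I "Suc n" Q k] by force
    qed
    then have nonzero: "coeff (Q x) k = 0 \<longleftrightarrow> coeff (Q y) k = 0" if "Q \<in> insert P \<Q>" for Q k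
      using that by (metis sgn_0_0)
    show ?thesis
    proof (cases "coeff (P x) n = 0")
      case True
      then have "coeff (P x) k = 0" "coeff (P y) k = 0" if "n \<le> k" for k
        using that nonzero[of P n] poly_family_zero[OF P, of k] by (cases "k = n"; simp)+
      then have "poly_cutoff n (P x) = P x" "poly_cutoff n (P y) = P y"
        by (auto intro!: poly_eqI simp: coeff_poly_cutoff)
      moreover have "\<exists>K. sign_matching K ((\<lambda>P. (P x, P y)) ` (insert (\<lambda>x. poly_cutoff n (P x)) \<A> \<union> \<B>))"
        using C1(3) sign_equal_mono[OF xy, of C1] unfolding signs_determined_by_def by blast
      ultimately show ?thesis by simp
    next
      case False
      obtain K where K: "sign_matching K ((\<lambda>P. (P x, P y)) ` (insert P' (\<A> \<union> R) \<union> \<B>))"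
        using C2(3) sign_equal_mono[OF xy, of C2] unfolding signs_determined_by_def by blast
      let ?T = "(\<lambda>P. (P x, P y)) ` \<Q>"
      have deg: "degree (P x) = n" "degree (P y) = n"
        using False nonzero[of P n] by (auto intro: poly_family_degree[OF P])
      have degQ: "degree (Q x) = degree (Q y)" if "Q \<in> \<Q>" for Q
        using nonzero[of Q] that unfolding degree_def by simp
      have "\<exists>K'. sign_matching K' (insert (P x, P y) ?T)"
      proof (rule sign_matching_insert[OF K])
        show "?T \<subseteq> (\<lambda>P. (P x, P y)) ` (insert P' (\<A> \<union> R) \<union> \<B>)" by (auto simp: \<Q>_def)
        show "\<forall>f g. (f, g) \<in> ?T \<longrightarrow> (f = 0 \<longleftrightarrow> g = 0)"
          using nonzero by (force simp: poly_eq_iff)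
        show "(pderiv (P x), pderiv (P y)) \<in> ?T" by (auto simp: \<Q>_def P'_def)
        show "degree (P x) > 0" "degree (P y) = degree (P x)" using deg n by auto
        show "sgn (lead_coeff (P x)) = sgn (lead_coeff (P y))" using coeffs deg by simp
        show "sgn (poly (P x) t) = sgn (poly (P y) s)"
          if fg: "(f, g) \<in> ?T" "f \<noteq> 0" "poly f t = 0" "poly g s = 0" and ts: "matched K t s" for f g t s
        proof -
          obtain Q' where Q': "Q' \<in> \<Q>" "f = Q' x" "g = Q' y" using fg(1) by blast
          define e where "e = degree (Q' x)"
          have "coeff (Q' x) e \<noteq> 0" using fg(2) Q'(2) by (simp add: e_def)
          then have en: "e \<le> n" and gnz: "Q' y \<noteq> 0"
            using poly_family_zero[OF Q[OF Q'(1)]] not_less_eq_eq nonzero[of Q' e] Q'(1) by auto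
          have e': "e = degree (Q' y)" using degQ[OF Q'(1)] by (simp add: e_def)
          have "reduction n e P Q' \<in> R" using en Q'(1) by (force simp: R_def)
          then have "sgn (poly (reduction n e P Q' x) t) = sgn (poly (reduction n e P Q' y) s)"
            by (intro sign_matchingD[OF K ts]) blast
          then show ?thesis
            using sgn_reduction_at_root[OF P Q[OF Q'(1)] e_def, of t]
              sgn_reduction_at_root[OF P Q[OF Q'(1)] e', of s] fg Q' gnz by simp
        qed
      qed
      then show ?thesis by (auto simp: sign_matching_def \<Q>_def)
    qed
  qed
  then have "signs_determined_by (C1 \<union> C2 \<union> C3) (insert P (\<A> \<union> \<B>))"
    by (auto simp: signs_determined_by_def)
  then show ?thesis using C1 C2 C3 by (intro exI[of _ "C1 \<union> C2 \<union> C3"]) auto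
qed

text \<open>
  A polynomial that is constant in the variable has no useful derivative, but its sign is the sign of
  its coefficient.
\<close>

lemma signs_determined_step_constant:
  assumes P: "poly_family I 1 P" and C: "finite C" "C \<subseteq> polynomial_functions I" "signs_determined_by C \<P>"
  shows "\<exists>C. finite C \<and> C \<subseteq> polynomial_functions I \<and> signs_determined_by C (insert P \<P>)"
proof -
  let ?C = "insert (\<lambda>x. coeff (P x) 0) C"
  have const: "poly (P x) t = coeff (P x) 0" for x t
  proof -
    have "P x = [:coeff (P x) 0:]"
      using poly_family_zero[OF P] by (intro poly_eqI) (auto simp: coeff_pCons split: nat.split)
    then show ?thesis by (metis mult_zero_right add.right_neutral poly_0 poly_pCons)
  qed
  have "\<exists>K. sign_matching K ((\<lambda>P. (P x, P y)) ` insert P \<P>)" if xy: "sign_equal ?C x y" for x y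
  proof -
    obtain K where "sign_matching K ((\<lambda>P. (P x, P y)) ` \<P>)"
      using C(3) sign_equal_mono[OF xy, of C] unfolding signs_determined_by_def by blast
    then have "sign_matching K ((\<lambda>P. (P x, P y)) ` insert P \<P>)"
      using xy const by (auto simp: sign_matching_def sign_equal_def)
    then show ?thesis ..
  qed
  then have "signs_determined_by ?C (insert P \<P>)" by (simp add: signs_determined_by_def)
  then show ?thesis using C poly_family_coeff[OF P] by (intro exI[of _ ?C]) auto
qed

text \<open>
  Induction on the degree bound, and for a fixed bound on the number of polynomials that attain it.
\<close>

theorem ex_signs_determined:
  assumes "finite \<A>" "\<And>P. P \<in> \<A> \<Longrightarrow> poly_family I n P"
  shows "\<exists>C. finite C \<and> C \<subseteq> polynomial_functions I \<and> signs_determined_by C \<A>"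
  using assms
proof (induction n arbitrary: \<A>)
  case 0
  have zero: "P x = 0" if "P \<in> \<A>" for P x
    using 0(2)[OF that] by (auto simp: poly_family_def poly_eq_iff)
  have "sign_matching {} ((\<lambda>P. (P x, P y)) ` \<A>)" for x y
    by (auto simp: sign_matching_def coherent_def zero)
  then have "signs_determined_by {} \<A>" unfolding signs_determined_by_def by blast
  then show ?case by (intro exI[of _ "{}"]) auto
next
  case (Suc n)
  have "\<exists>C. finite C \<and> C \<subseteq> polynomial_functions I \<and> signs_determined_by C (\<A>' \<union> \<B>)"
    if "finite \<B>" "\<And>P. P \<in> \<B> \<Longrightarrow> poly_family I (Suc n) P"
      "finite \<A>'" "\<And>P. P \<in> \<A>' \<Longrightarrow> poly_family I n P" for \<A>' \<B>
    using that
  proof (induction \<B> arbitrary: \<A>' rule: finite_induct)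
    case empty
    then show ?case using Suc.IH[of \<A>'] by simp
  next
    case (insert P \<B>)
    have P: "poly_family I (Suc n) P" using insert.prems by simp
    show ?case
    proof (cases "n = 0")
      case True
      obtain C where "finite C" "C \<subseteq> polynomial_functions I" "signs_determined_by C (\<A>' \<union> \<B>)"
        using insert.IH[of \<A>'] insert.prems by auto
      then show ?thesis
        using signs_determined_step_constant[of I P C "\<A>' \<union> \<B>"] P True by simp
    next
      case False
      have "\<exists>C. finite C \<and> C \<subseteq> polynomial_functions I \<and> signs_determined_by C (insert P (\<A>' \<union> \<B>))"
      proof (rule signs_determined_step[OF _ P])
        show "\<exists>C. finite C \<and> C \<subseteq> polynomial_functions I \<and> signs_determined_by C (\<A>'' \<union> \<B>)"
          if "finite \<A>''" "\<And>Q. Q \<in> \<A>'' \<Longrightarrow> poly_family I n Q" for \<A>''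
          using insert.IH[of \<A>''] insert.prems that by blast
      qed (use False insert in auto)
      then show ?thesis by simp
    qed
  qed
  from this[of \<A> "{}"] show ?case using Suc.prems by simp
qed

section \<open>The Tarski-Seidenberg projection theorem\<close>

lemma semialgebraic_subset: "semialgebraic I A \<Longrightarrow> A \<subseteq> I \<rightarrow>\<^sub>E UNIV"
  by (induction rule: semialgebraic.induct) auto

lemma semialgebraic_space: "semialgebraic I (I \<rightarrow>\<^sub>E UNIV)"
  using semialgebraic.positive[OF polynomial_functions.const[of 1]] by simp

lemma semialgebraic_empty: "semialgebraic I {}"
  using semialgebraic.complement[OF semialgebraic_space[of I]] by simp

lemma semialgebraic_UN:
  "finite F \<Longrightarrow> (\<And>a. a \<in> F \<Longrightarrow> semialgebraic I (A a)) \<Longrightarrow> semialgebraic I (\<Union>a\<in>F. A a)"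
  by (induction F rule: finite_induct) (auto intro: semialgebraic_empty semialgebraic.union)

text \<open>
  Predicates instead of sets, so that semialgebraicity follows the logical structure of a formula.
\<close>

definition sa_pred :: "'i set \<Rightarrow> (('i \<Rightarrow> real) \<Rightarrow> bool) \<Rightarrow> bool" where
  "sa_pred I P \<longleftrightarrow> semialgebraic I {x \<in> I \<rightarrow>\<^sub>E UNIV. P x}"

lemma sa_pred_mem: "semialgebraic I A \<Longrightarrow> sa_pred I (\<lambda>x. x \<in> A)"
  using semialgebraic_subset[of I A] by (simp add: sa_pred_def Collect_conj_eq Int_absorb1)

lemma sa_pred_cong:
  "(\<And>x. x \<in> I \<rightarrow>\<^sub>E UNIV \<Longrightarrow> P x \<longleftrightarrow> Q x) \<Longrightarrow> sa_pred I P \<longleftrightarrow> sa_pred I Q"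
  unfolding sa_pred_def by (metis (mono_tags, lifting) Collect_cong)

lemma sa_pred_not: "sa_pred I P \<Longrightarrow> sa_pred I (\<lambda>x. \<not> P x)"
proof -
  assume "sa_pred I P"
  then have "semialgebraic I ((I \<rightarrow>\<^sub>E UNIV) - {x \<in> I \<rightarrow>\<^sub>E UNIV. P x})"
    unfolding sa_pred_def by (rule semialgebraic.complement)
  moreover have "(I \<rightarrow>\<^sub>E UNIV) - {x \<in> I \<rightarrow>\<^sub>E UNIV. P x} = {x \<in> I \<rightarrow>\<^sub>E UNIV. \<not> P x}" by auto
  ultimately show ?thesis by (simp add: sa_pred_def)
qed

lemma sa_pred_bex:
  assumes "finite F" "\<And>a. a \<in> F \<Longrightarrow> sa_pred I (P a)"
  shows "sa_pred I (\<lambda>x. \<exists>a\<in>F. P a x)"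
proof -
  have "{x \<in> I \<rightarrow>\<^sub>E UNIV. \<exists>a\<in>F. P a x} = (\<Union>a\<in>F. {x \<in> I \<rightarrow>\<^sub>E UNIV. P a x})" by auto
  moreover have "semialgebraic I (\<Union>a\<in>F. {x \<in> I \<rightarrow>\<^sub>E UNIV. P a x})"
    using assms by (intro semialgebraic_UN) (auto simp: sa_pred_def)
  ultimately show ?thesis by (simp only: sa_pred_def)
qed

lemma sa_pred_ball:
  assumes "finite F" "\<And>a. a \<in> F \<Longrightarrow> sa_pred I (P a)"
  shows "sa_pred I (\<lambda>x. \<forall>a\<in>F. P a x)"
  using sa_pred_not[OF sa_pred_bex[OF assms(1) sa_pred_not[OF assms(2)]]] by simp

lemma sa_pred_disj: "sa_pred I P \<Longrightarrow> sa_pred I Q \<Longrightarrow> sa_pred I (\<lambda>x. P x \<or> Q x)"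
proof -
  assume "sa_pred I P" "sa_pred I Q"
  then have "sa_pred I (\<lambda>x. \<exists>R\<in>{P, Q}. R x)" by (intro sa_pred_bex) auto
  then show ?thesis by simp
qed

lemma sa_pred_conj: "sa_pred I P \<Longrightarrow> sa_pred I Q \<Longrightarrow> sa_pred I (\<lambda>x. P x \<and> Q x)"
  using sa_pred_not[OF sa_pred_disj[OF sa_pred_not sa_pred_not]] by simp

lemma sa_pred_iff: "sa_pred I P \<Longrightarrow> sa_pred I Q \<Longrightarrow> sa_pred I (\<lambda>x. P x \<longleftrightarrow> Q x)"
  using sa_pred_disj[OF sa_pred_conj[of I P Q] sa_pred_not[OF sa_pred_disj[of I P Q]]]
  by (rule iffD1[OF sa_pred_cong, rotated]) auto

lemma sa_pred_const: "sa_pred I (\<lambda>x. b)"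
  by (cases b) (auto simp: sa_pred_def semialgebraic_space semialgebraic_empty)

lemma sa_pred_less:
  assumes "p \<in> polynomial_functions I" "q \<in> polynomial_functions I"
  shows "sa_pred I (\<lambda>x. p x < q x)"
  using semialgebraic.positive[OF polynomial_functions_diff[OF assms(2,1)]] by (simp add: sa_pred_def)

lemma sa_pred_eq:
  assumes "p \<in> polynomial_functions I" "q \<in> polynomial_functions I"
  shows "sa_pred I (\<lambda>x. p x = q x)"
  using sa_pred_not[OF sa_pred_disj[OF sa_pred_less[OF assms] sa_pred_less[OF assms(2,1)]]]
  by (rule iffD1[OF sa_pred_cong, rotated]) auto

lemma sa_pred_substitution:
  assumes "semialgebraic I B" "\<And>i. i \<in> I \<Longrightarrow> g i \<in> polynomial_functions J"
  shows "sa_pred J (\<lambda>x. (\<lambda>i\<in>I. g i x) \<in> B)"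
  unfolding sa_pred_def by (rule semialgebraic_substitution[OF assms])

text \<open>
  A cardinality condition is a finite disjunction over the possible sets of indices.
\<close>

lemma sa_pred_card:
  assumes "finite F" "\<And>a. a \<in> F \<Longrightarrow> sa_pred I (P a)"
  shows "sa_pred I (\<lambda>x. card {a \<in> F. P a x} = k)"
proof -
  have "sa_pred I (\<lambda>x. \<exists>S\<in>{S \<in> Pow F. card S = k}. \<forall>a\<in>F. P a x \<longleftrightarrow> a \<in> S)"
    using assms by (intro sa_pred_bex sa_pred_ball sa_pred_iff sa_pred_const) auto
  moreover have "(\<exists>S\<in>{S \<in> Pow F. card S = k}. \<forall>a\<in>F. P a x \<longleftrightarrow> a \<in> S) \<longleftrightarrow> card {a \<in> F. P a x} = k" for x
  proof
    assume "\<exists>S\<in>{S \<in> Pow F. card S = k}. \<forall>a\<in>F. P a x \<longleftrightarrow> a \<in> S"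
    then obtain S where "S \<subseteq> F" "card S = k" "\<forall>a\<in>F. P a x \<longleftrightarrow> a \<in> S" by blast
    moreover from this have "{a \<in> F. P a x} = S" by blast
    ultimately show "card {a \<in> F. P a x} = k" by simp
  qed (intro bexI[of _ "{a \<in> F. P a x}"], auto)
  ultimately show ?thesis by simp
qed

lemma polynomial_function_as_family:
  assumes "p \<in> polynomial_functions (insert j I)" "j \<notin> I"
  shows "\<exists>P n. poly_family I n P \<and> (\<forall>x t. p (x(j := t)) = poly (P x) t)"
  using assms(1)
proof induction
  case (const c)
  have "poly_family I 1 (\<lambda>x. [:c:])"
    by (auto simp: poly_family_def coeff_pCons split: nat.split intro: polynomial_functions.const)
  then show ?case by (intro exI[of _ "\<lambda>x. [:c:]"]) auto
next
  case (coord i)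
  show ?case
  proof (cases "i = j")
    case True
    have "poly_family I 2 (\<lambda>x. [:0, 1:])"
      by (auto simp: poly_family_def coeff_pCons split: nat.split intro: polynomial_functions.const)
    then show ?thesis using True by (intro exI[of _ "\<lambda>x. [:0, 1:]"]) auto
  next
    case False
    then have i: "i \<in> I" using coord by auto
    have "(\<lambda>x. coeff [:x i:] k) \<in> polynomial_functions I" for k
      using i by (cases k) (auto simp: coeff_pCons intro: polynomial_functions.intros)
    then have "poly_family I 1 (\<lambda>x. [:x i:])"
      by (auto simp: poly_family_def coeff_pCons split: nat.split)
    then show ?thesis using False by (intro exI[of _ "\<lambda>x. [:x i:]"]) auto
  qed
next
  case (add p q)
  then obtain P n Q m where P: "poly_family I n P" "\<And>x t. p (x(j := t)) = poly (P x) t"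
    and Q: "poly_family I m Q" "\<And>x t. q (x(j := t)) = poly (Q x) t" by blast
  have "poly_family I (max n m) (\<lambda>x. P x + Q x)"
    using P(1) Q(1) unfolding poly_family_def by (auto intro: polynomial_functions.add)
  moreover have "\<forall>x t. p (x(j := t)) + q (x(j := t)) = poly (P x + Q x) t"
    by (intro allI) (simp only: P(2) Q(2) poly_add)
  ultimately show ?case by blast
next
  case (mult p q)
  then obtain P n Q m where P: "poly_family I n P" "\<And>x t. p (x(j := t)) = poly (P x) t"
    and Q: "poly_family I m Q" "\<And>x t. q (x(j := t)) = poly (Q x) t" by blast
  have "poly_family I (n + m) (\<lambda>x. P x * Q x)"
    unfolding poly_family_def coeff_mult
  proof (intro conjI allI impI)
    show "(\<lambda>x. \<Sum>i\<le>k. coeff (P x) i * coeff (Q x) (k - i)) \<in> polynomial_functions I" for k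
      by (intro polynomial_function_intros poly_family_coeff[OF P(1)] poly_family_coeff[OF Q(1)])
    show "(\<Sum>i\<le>k. coeff (P x) i * coeff (Q x) (k - i)) = 0" if "n + m \<le> k" for x k
    proof (rule sum.neutral, rule ballI)
      fix i
      have "n \<le> i \<or> m \<le> k - i" using that by linarith
      then show "coeff (P x) i * coeff (Q x) (k - i) = 0"
        using poly_family_zero[OF P(1)] poly_family_zero[OF Q(1)] by auto
    qed
  qed
  moreover have "\<forall>x t. p (x(j := t)) * q (x(j := t)) = poly (P x * Q x) t"
    by (intro allI) (simp only: P(2) Q(2) poly_mult)
  ultimately show ?case by blast
qed

definition sign_invariant :: "'i set \<Rightarrow> (('i \<Rightarrow> real) \<Rightarrow> real) set \<Rightarrow> ('i \<Rightarrow> real) set \<Rightarrow> bool" where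
  "sign_invariant I S A \<longleftrightarrow>
     (\<forall>x\<in>I \<rightarrow>\<^sub>E UNIV. \<forall>y\<in>I \<rightarrow>\<^sub>E UNIV. sign_equal S x y \<longrightarrow> (x \<in> A \<longleftrightarrow> y \<in> A))"

lemma ex_sign_invariant:
  assumes "semialgebraic I A"
  shows "\<exists>S. finite S \<and> S \<subseteq> polynomial_functions I \<and> sign_invariant I S A"
  using assms
proof induction
  case (positive p)
  have "p x > 0 \<longleftrightarrow> p y > 0" if "sign_equal {p} x y" for x y
    using that sgn_1_pos[of "p x"] sgn_1_pos[of "p y"] by (simp add: sign_equal_def)
  then have "sign_invariant I {p} {x \<in> I \<rightarrow>\<^sub>E UNIV. p x > 0}"
    by (simp add: sign_invariant_def)
  then show ?case using positive by blast
next
  case (union A B)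
  obtain S where S: "finite S" "S \<subseteq> polynomial_functions I" "sign_invariant I S A"
    using union.IH(1) by blast
  obtain T where T: "finite T" "T \<subseteq> polynomial_functions I" "sign_invariant I T B"
    using union.IH(2) by blast
  have "sign_invariant I (S \<union> T) (A \<union> B)"
    unfolding sign_invariant_def
  proof (intro ballI impI)
    fix x y assume xy: "x \<in> I \<rightarrow>\<^sub>E UNIV" "y \<in> I \<rightarrow>\<^sub>E UNIV" and eq: "sign_equal (S \<union> T) x y"
    have "x \<in> A \<longleftrightarrow> y \<in> A"
      using S(3) xy sign_equal_mono[OF eq, of S] by (simp add: sign_invariant_def)
    moreover have "x \<in> B \<longleftrightarrow> y \<in> B"
      using T(3) xy sign_equal_mono[OF eq, of T] by (simp add: sign_invariant_def)
    ultimately show "x \<in> A \<union> B \<longleftrightarrow> y \<in> A \<union> B" by simp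
  qed
  then show ?case using S T by (intro exI[of _ "S \<union> T"] conjI) auto
next
  case (complement A)
  have "sign_invariant I S ((I \<rightarrow>\<^sub>E UNIV) - A)" if "sign_invariant I S A" for S
    using that by (simp add: sign_invariant_def)
  then show ?case using complement.IH by blast
qed

text \<open>
  There are finitely many sign vectors, and the set is the union of the cells of those that occur.
\<close>

lemma semialgebraic_if_sign_invariant:
  assumes C: "finite C" "C \<subseteq> polynomial_functions I" and A: "A \<subseteq> I \<rightarrow>\<^sub>E UNIV"
    and inv: "\<And>x y. x \<in> A \<Longrightarrow> y \<in> I \<rightarrow>\<^sub>E UNIV \<Longrightarrow> sign_equal C x y \<Longrightarrow> y \<in> A"
  shows "semialgebraic I A"
proof -
  define signs where "signs x = (\<lambda>c\<in>C. sgn (c x))" for x :: "'a \<Rightarrow> real"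
  have "sgn t \<in> {- 1, 0, 1}" for t :: real by (simp add: sgn_if)
  then have "signs ` A \<subseteq> C \<rightarrow>\<^sub>E {- 1, 0, 1}" 
    by (intro image_subsetI) (simp only: signs_def restrict_PiE_iff, blast)
  then have fin: "finite (signs ` A)" by (rule finite_subset) (use C(1) in \<open>simp add: finite_PiE\<close>)
  have "sa_pred I (\<lambda>x. \<exists>\<sigma>\<in>signs ` A. \<forall>c\<in>C. sgn (c x) = \<sigma> c)"
  proof (intro sa_pred_bex[OF fin] sa_pred_ball[OF C(1)])
    fix \<sigma> :: "(('a \<Rightarrow> real) \<Rightarrow> real) \<Rightarrow> real" and c assume "c \<in> C"
    then have c: "c \<in> polynomial_functions I" using C(2) by blast
    note const = polynomial_functions.const[of _ I]
    have "sa_pred I (\<lambda>x. (c x < 0 \<and> \<sigma> c = - 1) \<or> (c x = 0 \<and> \<sigma> c = 0) \<or> (0 < c x \<and> \<sigma> c = 1))"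
      by (intro sa_pred_disj sa_pred_conj sa_pred_less sa_pred_eq sa_pred_const c const)
    then show "sa_pred I (\<lambda>x. sgn (c x) = \<sigma> c)"
      by (rule iffD1[OF sa_pred_cong, rotated]) (auto simp: sgn_if)
  qed
  moreover have "(\<exists>\<sigma>\<in>signs ` A. \<forall>c\<in>C. sgn (c x) = \<sigma> c) \<longleftrightarrow> x \<in> A" if x: "x \<in> I \<rightarrow>\<^sub>E UNIV" for x
  proof
    assume "\<exists>\<sigma>\<in>signs ` A. \<forall>c\<in>C. sgn (c x) = \<sigma> c"
    then obtain a where "a \<in> A" "sign_equal C a x" by (auto simp: signs_def sign_equal_def)
    then show "x \<in> A" using inv x by blast
  qed (auto simp: signs_def)
  ultimately have "sa_pred I (\<lambda>x. x \<in> A)"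
    by (rule iffD1[OF sa_pred_cong, rotated])
  then show ?thesis using Int_absorb1[OF A] by (simp add: sa_pred_def Collect_conj_eq)
qed

text \<open>
  If \<open>x\<close> and \<open>y\<close> have the same signs at the polynomials of \<open>ex_signs_determined\<close>, then a point of \<open>A\<close>
  above \<open>x\<close> has a matched point above \<open>y\<close> with the same signs at the polynomials that define \<open>A\<close>.
\<close>

lemma semialgebraic_project_coordinate:
  assumes A: "semialgebraic (insert j I) A" and j: "j \<notin> I"
  shows "semialgebraic I ((\<lambda>a. restrict a I) ` A)"
proof -
  obtain S where S: "finite S" "S \<subseteq> polynomial_functions (insert j I)"
    and inv: "\<And>x y. x \<in> insert j I \<rightarrow>\<^sub>E UNIV \<Longrightarrow> y \<in> insert j I \<rightarrow>\<^sub>E UNIV \<Longrightarrow> sign_equal S x y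
      \<Longrightarrow> x \<in> A \<longleftrightarrow> y \<in> A"
    using ex_sign_invariant[OF A] by (auto simp: sign_invariant_def)
  have "\<forall>p\<in>S. \<exists>P n. poly_family I n P \<and> (\<forall>x t. p (x(j := t)) = poly (P x) t)"
    using S(2) polynomial_function_as_family[OF _ j] by blast
  then obtain F N where F: "\<And>p. p \<in> S \<Longrightarrow> poly_family I (N p) (F p)"
    "\<And>p x t. p \<in> S \<Longrightarrow> p (x(j := t)) = poly (F p x) t"
    by metis
  have "N p \<le> Max (N ` S)" if "p \<in> S" for p using S(1) that by simp
  then have "\<And>P. P \<in> F ` S \<Longrightarrow> poly_family I (Max (N ` S)) P" using F(1) poly_family_mono by blast
  then obtain C where C: "finite C" "C \<subseteq> polynomial_functions I" "signs_determined_by C (F ` S)"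
    using ex_signs_determined[of "F ` S" I "Max (N ` S)"] S(1) by blast
  show ?thesis
  proof (rule semialgebraic_if_sign_invariant[OF C(1,2)])
    show "(\<lambda>a. restrict a I) ` A \<subseteq> I \<rightarrow>\<^sub>E UNIV" by auto
    fix x y assume "x \<in> (\<lambda>a. restrict a I) ` A" and y: "y \<in> I \<rightarrow>\<^sub>E UNIV" and xy: "sign_equal C x y"
    then obtain a where a: "a \<in> A" "x = restrict a I" by blast
    have aE: "a \<in> insert j I \<rightarrow>\<^sub>E UNIV" using a(1) semialgebraic_subset[OF A] by blast
    have ax: "a = x(j := a j)"
      using aE a(2) by (auto simp: fun_eq_iff PiE_def extensional_def restrict_def)
    obtain K where K: "sign_matching K ((\<lambda>P. (P x, P y)) ` F ` S)"
      using C(3) xy unfolding signs_determined_by_def by blast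
    obtain s where s: "matched K (a j) s"
      using matched_total sign_matching_coherent[OF K] by blast
    have "sgn (p a) = sgn (p (y(j := s)))" if "p \<in> S" for p
    proof -
      have "sgn (poly (F p x) (a j)) = sgn (poly (F p y) s)"
        using that by (intro sign_matchingD[OF K s]) auto
      then show ?thesis using F(2)[OF that] ax by metis
    qed
    then have "sign_equal S a (y(j := s))" by (simp add: sign_equal_def)
    moreover have "y(j := s) \<in> insert j I \<rightarrow>\<^sub>E UNIV" using y by (auto simp: PiE_def extensional_def)
    ultimately have "y(j := s) \<in> A" using inv aE a(1) by blast
    moreover have "restrict (y(j := s)) I = y"
      using y j by (auto simp: fun_eq_iff PiE_def extensional_def restrict_def)
    ultimately show "y \<in> (\<lambda>a. restrict a I) ` A" by (metis imageI)
  qed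
qed

theorem semialgebraic_projection:
  assumes "finite J" "I \<inter> J = {}" "semialgebraic (I \<union> J) A"
  shows "semialgebraic I ((\<lambda>a. restrict a I) ` A)"
  using assms
proof (induction J arbitrary: A rule: finite_induct)
  case empty
  have "restrict a I = a" if "a \<in> A" for a
    using semialgebraic_subset[OF empty(2)] that by (auto simp: PiE_restrict)
  then have "(\<lambda>a. restrict a I) ` A = A" by force
  then show ?case using empty(2) by (simp only: Un_empty_right)
next
  case (insert j J)
  have "semialgebraic (I \<union> J) ((\<lambda>a. restrict a (I \<union> J)) ` A)"
    using insert by (intro semialgebraic_project_coordinate[of j]) auto
  then have "semialgebraic I ((\<lambda>a. restrict a I) ` (\<lambda>a. restrict a (I \<union> J)) ` A)"
    using insert by (intro insert.IH) auto
  moreover have "restrict (restrict a (I \<union> J)) I = restrict a I" for a :: "'a \<Rightarrow> real"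
    by (simp add: Int_absorb1)
  ultimately show ?case by (simp only: image_image)
qed

text \<open>
  Projection as quantifier elimination.  The formula with free variables in \<open>I \<union> J\<close> is \<open>P\<close>, whereas
  \<open>Q\<close> separates the two groups of variables.
\<close>

lemma sa_pred_ex:
  assumes "finite J" "I \<inter> J = {}" "sa_pred (I \<union> J) P"
    and "\<And>a. a \<in> (I \<union> J) \<rightarrow>\<^sub>E UNIV \<Longrightarrow> P a \<longleftrightarrow> Q (restrict a I) (restrict a J)"
  shows "sa_pred I (\<lambda>x. \<exists>y\<in>J \<rightarrow>\<^sub>E UNIV. Q x y)"
proof -
  have "{x \<in> I \<rightarrow>\<^sub>E UNIV. \<exists>y\<in>J \<rightarrow>\<^sub>E UNIV. Q x y} = (\<lambda>a. restrict a I) ` {a \<in> (I \<union> J) \<rightarrow>\<^sub>E UNIV. P a}"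
  proof (intro equalityI subsetI)
    fix x assume "x \<in> {x \<in> I \<rightarrow>\<^sub>E UNIV. \<exists>y\<in>J \<rightarrow>\<^sub>E UNIV. Q x y}"
    then obtain y where xy: "x \<in> I \<rightarrow>\<^sub>E UNIV" "y \<in> J \<rightarrow>\<^sub>E UNIV" "Q x y" by blast
    define a where "a = (\<lambda>i. if i \<in> I then x i else y i)"
    have a: "a \<in> (I \<union> J) \<rightarrow>\<^sub>E UNIV" "restrict a I = x" "restrict a J = y"
      using xy assms(2) by (auto simp: a_def fun_eq_iff PiE_def extensional_def restrict_def)
    then have "P a" using assms(4) xy(3) by simp
    then show "x \<in> (\<lambda>a. restrict a I) ` {a \<in> (I \<union> J) \<rightarrow>\<^sub>E UNIV. P a}" using a by force
  next
    fix x assume "x \<in> (\<lambda>a. restrict a I) ` {a \<in> (I \<union> J) \<rightarrow>\<^sub>E UNIV. P a}"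
    then obtain a where "a \<in> (I \<union> J) \<rightarrow>\<^sub>E UNIV" "P a" "x = restrict a I" by blast
    then show "x \<in> {x \<in> I \<rightarrow>\<^sub>E UNIV. \<exists>y\<in>J \<rightarrow>\<^sub>E UNIV. Q x y}" using assms(4) by auto
  qed
  then show ?thesis
    using semialgebraic_projection[OF assms(1,2)] assms(3) by (simp add: sa_pred_def)
qed

section \<open>Closures of semialgebraic sets\<close>

text \<open>
  The defining formula of the closure is eliminated with coordinates \<open>0, \<dots>, d - 1\<close> for the point \<open>x\<close>,
  \<open>d, \<dots>, 2 d - 1\<close> for the point \<open>b\<close>, and \<open>2 d\<close> for the radius \<open>e\<close>.
\<close>

lemma semialgebraic_closure:
  fixes d :: nat
  assumes B: "semialgebraic {..<d} B"
  shows "semialgebraic {..<d}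
    {x \<in> {..<d} \<rightarrow>\<^sub>E UNIV. \<forall>e>0. \<exists>b\<in>B. (\<Sum>i<d. (x i - b i)\<^sup>2) < e}"
proof -
  let ?I = "{..<d}" and ?J = "{d..<2 * d}" and ?E = "{2 * d}"
  define Q where "Q x e y \<longleftrightarrow> (\<lambda>i\<in>?I. y (d + i)) \<in> B \<and> (\<Sum>i<d. (x i - y (d + i))\<^sup>2) < e"
    for x y :: "nat \<Rightarrow> real" and e :: real
  have "sa_pred (?I \<union> ?E) (\<lambda>x. \<exists>y\<in>?J \<rightarrow>\<^sub>E UNIV. Q x (x (2 * d)) y)"
  proof (rule sa_pred_ex)
    show "sa_pred (?I \<union> ?E \<union> ?J)
      (\<lambda>a. (\<lambda>i\<in>?I. a (d + i)) \<in> B \<and> (\<Sum>i<d. (a i - a (d + i))\<^sup>2) < a (2 * d))"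
      by (intro sa_pred_conj sa_pred_less sa_pred_substitution[OF B] polynomial_function_intros) auto
    show "((\<lambda>i\<in>?I. a (d + i)) \<in> B \<and> (\<Sum>i<d. (a i - a (d + i))\<^sup>2) < a (2 * d)) \<longleftrightarrow>
      Q (restrict a (?I \<union> ?E)) (restrict a (?I \<union> ?E) (2 * d)) (restrict a ?J)" for a
    proof -
      have "(\<lambda>i\<in>?I. a (d + i)) = (\<lambda>i\<in>?I. restrict a ?J (d + i))" by (rule restrict_ext) simp
      then show ?thesis by (simp add: Q_def)
    qed
  qed auto
  then have "sa_pred (?I \<union> ?E) (\<lambda>a. 0 < a (2 * d) \<and> \<not> (\<exists>y\<in>?J \<rightarrow>\<^sub>E UNIV. Q a (a (2 * d)) y))"
    by (intro sa_pred_conj sa_pred_less sa_pred_not) (auto intro: polynomial_functions.intros)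
  then have "sa_pred ?I (\<lambda>x. \<exists>t\<in>?E \<rightarrow>\<^sub>E UNIV. 0 < t (2 * d) \<and> \<not> (\<exists>y\<in>?J \<rightarrow>\<^sub>E UNIV. Q x (t (2 * d)) y))"
    by (rule sa_pred_ex[rotated 2]) (auto simp: Q_def)
  then have "sa_pred ?I (\<lambda>x. \<not> (\<exists>t\<in>?E \<rightarrow>\<^sub>E UNIV. 0 < t (2 * d) \<and> \<not> (\<exists>y\<in>?J \<rightarrow>\<^sub>E UNIV. Q x (t (2 * d)) y)))"
    by (rule sa_pred_not)
  moreover have "\<not> (\<exists>t\<in>?E \<rightarrow>\<^sub>E UNIV. 0 < t (2 * d) \<and> \<not> (\<exists>y\<in>?J \<rightarrow>\<^sub>E UNIV. Q x (t (2 * d)) y)) \<longleftrightarrow>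
    (\<forall>e>0. \<exists>b\<in>B. (\<Sum>i<d. (x i - b i)\<^sup>2) < e)" for x
  proof -
    define R where "R e \<longleftrightarrow> (\<exists>b\<in>B. (\<Sum>i<d. (x i - b i)\<^sup>2) < e)" for e
    have Q: "(\<exists>y\<in>?J \<rightarrow>\<^sub>E UNIV. Q x e y) \<longleftrightarrow> R e" for e
      unfolding R_def
    proof
      assume "\<exists>y\<in>?J \<rightarrow>\<^sub>E UNIV. Q x e y"
      then obtain y where "(\<lambda>i\<in>?I. y (d + i)) \<in> B" "(\<Sum>i<d. (x i - y (d + i))\<^sup>2) < e"
        by (auto simp: Q_def)
      then show "\<exists>b\<in>B. (\<Sum>i<d. (x i - b i)\<^sup>2) < e" by (intro bexI) auto
    next
      assume "\<exists>b\<in>B. (\<Sum>i<d. (x i - b i)\<^sup>2) < e"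
      then obtain b where b: "b \<in> B" "(\<Sum>i<d. (x i - b i)\<^sup>2) < e" by blast
      let ?y = "\<lambda>k\<in>?J. b (k - d)"
      have "b \<in> ?I \<rightarrow>\<^sub>E UNIV" using b(1) semialgebraic_subset[OF B] by blast
      then have "(\<lambda>i\<in>?I. ?y (d + i)) = b"
        by (auto simp: fun_eq_iff PiE_def extensional_def restrict_def)
      then have "Q x e ?y" using b by (simp add: Q_def)
      moreover have "?y \<in> ?J \<rightarrow>\<^sub>E UNIV" by simp
      ultimately show "\<exists>y\<in>?J \<rightarrow>\<^sub>E UNIV. Q x e y" by blast
    qed
    have "(\<exists>t\<in>?E \<rightarrow>\<^sub>E UNIV. 0 < t (2 * d) \<and> \<not> R (t (2 * d))) \<longleftrightarrow> (\<exists>e>0. \<not> R e)"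
    proof
      assume "\<exists>e>0. \<not> R e"
      then obtain e where "e > 0" "\<not> R e" by blast
      then show "\<exists>t\<in>?E \<rightarrow>\<^sub>E UNIV. 0 < t (2 * d) \<and> \<not> R (t (2 * d))"
        by (intro bexI[of _ "\<lambda>_\<in>?E. e"]) auto
    qed blast
    then show ?thesis unfolding Q R_def[symmetric] by simp
  qed
  ultimately have "sa_pred ?I (\<lambda>x. \<forall>e>0. \<exists>b\<in>B. (\<Sum>i<d. (x i - b i)\<^sup>2) < e)" by simp
  then show ?thesis by (simp add: sa_pred_def)
qed

lemma hpoint_scale:
  assumes "c \<noteq> 0" "p \<noteq> 0"
  shows "hpoint (c * fst p) (c * snd p) = hpoint (fst p) (snd p)"
proof -
  have p: "(fst p, snd p) \<noteq> 0" using assms(2) by simp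
  have cp: "(c * fst p, c * snd p) \<noteq> 0"
    using assms by (auto simp: zero_prod_def prod_eq_iff)
  have "\<exists>d. d \<noteq> 0 \<and> fst p = d * (c * fst p) \<and> snd p = d * (c * snd p)"
    using assms(1) by (intro exI[of _ "inverse c"]) simp
  then show ?thesis unfolding hpoint_eq_iff[OF cp p] .
qed

text \<open>
  The preimage of the image is the union of the images of \<open>U\<close> under scaling.
\<close>

lemma open_hpoint_image:
  assumes "open U" "0 \<notin> U"
  shows "open ((\<lambda>p. hpoint (fst p) (snd p)) ` U)"
proof -
  let ?scale = "\<lambda>c p :: complex \<times> complex. (c * fst p, c * snd p)"
  have "{q. q \<noteq> 0 \<and> hpoint (fst q) (snd q) \<in> (\<lambda>p. hpoint (fst p) (snd p)) ` U}
      = (\<Union>c\<in>- {0}. ?scale c -` U)"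
  proof (intro equalityI subsetI)
    fix q assume "q \<in> {q. q \<noteq> 0 \<and> hpoint (fst q) (snd q) \<in> (\<lambda>p. hpoint (fst p) (snd p)) ` U}"
    then obtain p where p: "p \<in> U" "q \<noteq> 0" "hpoint (fst q) (snd q) = hpoint (fst p) (snd p)" by blast
    moreover from p(1) assms(2) have "p \<noteq> 0" by blast
    ultimately obtain c where "c \<noteq> 0" "fst p = c * fst q" "snd p = c * snd q"
      by (auto simp: hpoint_eq_iff)
    then have "?scale c q = p" by (simp add: prod_eq_iff)
    then show "q \<in> (\<Union>c\<in>- {0}. ?scale c -` U)" using \<open>c \<noteq> 0\<close> p(1) by auto
  next
    fix q assume "q \<in> (\<Union>c\<in>- {0}. ?scale c -` U)"
    then obtain c where c: "c \<noteq> 0" "?scale c q \<in> U" by auto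
    then have "q \<noteq> 0" using assms(2) by (auto simp: zero_prod_def)
    then have "hpoint (fst q) (snd q) = hpoint (fst (?scale c q)) (snd (?scale c q))"
      using hpoint_scale[OF c(1)] by simp
    then show "q \<in> {q. q \<noteq> 0 \<and> hpoint (fst q) (snd q) \<in> (\<lambda>p. hpoint (fst p) (snd p)) ` U}"
      using c \<open>q \<noteq> 0\<close> by blast
  qed
  moreover have "open (?scale c -` U)" for c
    by (intro open_vimage assms continuous_intros)
  ultimately show ?thesis unfolding open_cp1_def by (simp add: open_UN)
qed

text \<open>
  The quotient map from the punctured plane onto the projective line is continuous and open.
\<close>

lemma hpoint_in_closure_iff:
  assumes "p \<noteq> 0"
  shows "hpoint (fst p) (snd p) \<in> closure \<Omega> \<longleftrightarrow> p \<in> closure {q. q \<noteq> 0 \<and> hpoint (fst q) (snd q) \<in> \<Omega>}"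
    (is "_ \<longleftrightarrow> p \<in> closure ?B")
proof
  assume h: "hpoint (fst p) (snd p) \<in> closure \<Omega>"
  show "p \<in> closure ?B"
    unfolding closure_iff_nhds_not_empty
  proof (intro allI impI)
    fix A V assume "V \<subseteq> A" "open V" "p \<in> V"
    let ?U = "V - {0}"
    have "open ((\<lambda>p. hpoint (fst p) (snd p)) ` ?U)"
      using \<open>open V\<close> by (intro open_hpoint_image) auto
    moreover have "hpoint (fst p) (snd p) \<in> (\<lambda>p. hpoint (fst p) (snd p)) ` ?U"
      using \<open>p \<in> V\<close> assms by blast
    ultimately have "\<Omega> \<inter> (\<lambda>p. hpoint (fst p) (snd p)) ` ?U \<noteq> {}"
      using h by (meson closure_iff_nhds_not_empty subset_refl)
    then show "?B \<inter> A \<noteq> {}" using \<open>V \<subseteq> A\<close> by blast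
  qed
next
  assume p: "p \<in> closure ?B"
  show "hpoint (fst p) (snd p) \<in> closure \<Omega>"
    unfolding closure_iff_nhds_not_empty
  proof (intro allI impI)
    fix A V :: "cp1 set" assume "V \<subseteq> A" "open V" "hpoint (fst p) (snd p) \<in> V"
    then have "open {q. q \<noteq> 0 \<and> hpoint (fst q) (snd q) \<in> V}" "p \<in> {q. q \<noteq> 0 \<and> hpoint (fst q) (snd q) \<in> V}"
      using assms by (auto simp: open_cp1_def)
    then have "?B \<inter> {q. q \<noteq> 0 \<and> hpoint (fst q) (snd q) \<in> V} \<noteq> {}"
      using p by (meson closure_iff_nhds_not_empty subset_refl)
    then show "\<Omega> \<inter> A \<noteq> {}" using \<open>V \<subseteq> A\<close> by blast
  qed
qed

definition homogeneous :: "(nat \<Rightarrow> real) \<Rightarrow> complex \<times> complex" where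
  "homogeneous x = (Complex (x 0) (x 1), Complex (x 2) (x 3))"

lemma dist_homogeneous: "(dist (homogeneous x) (homogeneous y))\<^sup>2 = (\<Sum>i<4. (x i - y i)\<^sup>2)"
proof -
  have "{..<4::nat} = {0, 1, 2, 3}" by auto
  then show ?thesis
    by (simp add: homogeneous_def dist_norm norm_Pair cmod_power2)
qed

lemma homogeneous_neq_0: "homogeneous x \<noteq> 0 \<longleftrightarrow> (\<exists>i<4. x i \<noteq> 0)"
proof -
  have "(\<exists>i<4. x i \<noteq> 0) \<longleftrightarrow> (\<exists>i\<in>{0, 1, 2, 3}. x i \<noteq> 0)"
  proof -
    have "{..<4::nat} = {0, 1, 2, 3}" by auto
    then have "(\<exists>i\<in>{..<4}. x i \<noteq> 0) \<longleftrightarrow> (\<exists>i\<in>{0, 1, 2, 3}. x i \<noteq> 0)" by (simp only:)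
    then show ?thesis by (simp only: Bex_def lessThan_iff)
  qed
  moreover have "Complex a b = 0 \<longleftrightarrow> a = 0 \<and> b = 0" for a b by (simp add: complex_eq_iff)
  ultimately show ?thesis by (auto simp: homogeneous_def zero_prod_def)
qed

lemma ex_homogeneous: "\<exists>x\<in>{..<4} \<rightarrow>\<^sub>E UNIV. homogeneous x = p"
proof
  let ?x = "\<lambda>i\<in>{..<4}. if i = 0 then Re (fst p) else if i = 1 then Im (fst p)
    else if i = 2 then Re (snd p) else Im (snd p)"
  show "homogeneous ?x = p" by (simp add: homogeneous_def prod_eq_iff)
  show "?x \<in> {..<4} \<rightarrow>\<^sub>E UNIV" by (rule restrict_PiE_iff[THEN iffD2]) blast
qed

lemma pdom_cp1_space: "pdom cp1_space = {x \<in> {..<4} \<rightarrow>\<^sub>E UNIV. homogeneous x \<noteq> 0}"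
  unfolding cp1_space_def sa_space.simps homogeneous_neq_0 by (rule refl)

lemma param_cp1_space: "param cp1_space x = hpoint (fst (homogeneous x)) (snd (homogeneous x))"
  unfolding cp1_space_def sa_space.simps homogeneous_def fst_conv snd_conv by (rule refl)

text \<open>
  The closure is computed in homogeneous coordinates, where \<open>semialgebraic_closure\<close> applies.
\<close>

theorem stability_theory_closure:
  assumes "stability_theory \<Omega>"
  shows "stability_theory (closure \<Omega>)"
proof -
  define B where "B = {x \<in> pdom cp1_space. param cp1_space x \<in> \<Omega>}"
  have B: "semialgebraic {..<4} B"
    using assms by (simp add: B_def stability_theory_def sa_set_def cp1_space_def)
  let ?C = "{q. q \<noteq> 0 \<and> hpoint (fst q) (snd q) \<in> \<Omega>}"
  have memB: "x \<in> B \<longleftrightarrow> x \<in> {..<4} \<rightarrow>\<^sub>E UNIV \<and> homogeneous x \<in> ?C" for x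
    by (simp add: B_def pdom_cp1_space param_cp1_space)
  have BC: "homogeneous ` B = ?C"
  proof (intro equalityI subsetI)
    fix q assume q: "q \<in> ?C"
    obtain x where x: "x \<in> {..<4} \<rightarrow>\<^sub>E UNIV" "homogeneous x = q" using ex_homogeneous by blast
    then have "x \<in> B" unfolding memB using q by (simp only:)
    then show "q \<in> homogeneous ` B" unfolding x(2)[symmetric] by (rule imageI)
  next
    fix q assume "q \<in> homogeneous ` B"
    then obtain x where "x \<in> B" "q = homogeneous x" by (rule imageE)
    then show "q \<in> ?C" unfolding memB by (simp only:)
  qed
  have iff: "param cp1_space x \<in> closure \<Omega> \<longleftrightarrow> (\<forall>e>0. \<exists>b\<in>B. (\<Sum>i<4. (x i - b i)\<^sup>2) < e)"
    if x: "homogeneous x \<noteq> 0" for x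
  proof -
    have "param cp1_space x \<in> closure \<Omega> \<longleftrightarrow> homogeneous x \<in> closure (homogeneous ` B)"
      unfolding param_cp1_space BC by (rule hpoint_in_closure_iff[OF x])
    also have "\<dots> \<longleftrightarrow> (\<forall>e>0. \<exists>b\<in>B. dist (homogeneous x) (homogeneous b) < e)"
      by (simp only: closure_approachable bex_simps dist_commute[of _ "homogeneous x"])
    also have "\<dots> \<longleftrightarrow> (\<forall>e>0. \<exists>b\<in>B. (dist (homogeneous x) (homogeneous b))\<^sup>2 < e)"
    proof (intro iffI allI impI)
      fix e :: real assume *: "\<forall>e>0. \<exists>b\<in>B. dist (homogeneous x) (homogeneous b) < e" and e: "e > 0"
      then obtain b where "b \<in> B" "dist (homogeneous x) (homogeneous b) < sqrt e" by (metis real_sqrt_gt_zero)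
      then have "(dist (homogeneous x) (homogeneous b))\<^sup>2 < (sqrt e)\<^sup>2" by (intro power_strict_mono) auto
      then show "\<exists>b\<in>B. (dist (homogeneous x) (homogeneous b))\<^sup>2 < e" using \<open>b \<in> B\<close> e by auto
    next
      fix e :: real assume *: "\<forall>e>0. \<exists>b\<in>B. (dist (homogeneous x) (homogeneous b))\<^sup>2 < e" and e: "e > 0"
      then have "e\<^sup>2 > 0" by simp
      then obtain b where "b \<in> B" "(dist (homogeneous x) (homogeneous b))\<^sup>2 < e\<^sup>2" using * by blast
      then have "dist (homogeneous x) (homogeneous b) < e"
        using e power2_less_imp_less[of "dist (homogeneous x) (homogeneous b)" e] by simp
      then show "\<exists>b\<in>B. dist (homogeneous x) (homogeneous b) < e" using \<open>b \<in> B\<close> by blast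
    qed
    finally show ?thesis by (simp only: dist_homogeneous)
  qed
  have "sa_pred {..<4} (\<lambda>x. (\<exists>i\<in>{..<4}. x i \<noteq> 0) \<and>
      x \<in> {x \<in> {..<4} \<rightarrow>\<^sub>E UNIV. \<forall>e>0. \<exists>b\<in>B. (\<Sum>i<4. (x i - b i)\<^sup>2) < e})"
    by (intro sa_pred_conj sa_pred_mem semialgebraic_closure[OF B] sa_pred_bex sa_pred_not sa_pred_eq
        polynomial_functions.intros finite_lessThan)
  then have "semialgebraic {..<4} {x \<in> pdom cp1_space. param cp1_space x \<in> closure \<Omega>}"
    unfolding sa_pred_def
  proof (rule back_subst[of "semialgebraic {..<4}"], intro set_eqI)
    fix x
    have "(\<exists>i\<in>{..<4}. x i \<noteq> 0) \<longleftrightarrow> homogeneous x \<noteq> 0"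
      unfolding homogeneous_neq_0 by (simp only: Bex_def lessThan_iff)
    then show "x \<in> {x \<in> {..<4} \<rightarrow>\<^sub>E UNIV. (\<exists>i\<in>{..<4}. x i \<noteq> 0) \<and>
        x \<in> {x \<in> {..<4} \<rightarrow>\<^sub>E UNIV. \<forall>e>0. \<exists>b\<in>B. (\<Sum>i<4. (x i - b i)\<^sup>2) < e}}
      \<longleftrightarrow> x \<in> {x \<in> pdom cp1_space. param cp1_space x \<in> closure \<Omega>}"
      using iff[of x] unfolding pdom_cp1_space mem_Collect_eq by argo
  qed
  moreover have "coords cp1_space = {..<4}" "topo cp1_space = euclidean" by (simp_all add: cp1_space_def)
  ultimately show ?thesis by (simp add: stability_theory_def sa_set_def)
qed

section \<open>The affine chart and symmetric products\<close>

text \<open>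
  In homogeneous coordinates the affine coordinate is the continuous function \<open>u / v\<close> on the open set
  \<open>v \<noteq> 0\<close>.
\<close>

lemma open_cp1_of_complex_image:
  assumes "open U" shows "open (cp1_of_complex ` U)"
proof -
  have "{p. p \<noteq> 0 \<and> hpoint (fst p) (snd p) \<in> cp1_of_complex ` U}
      = {p \<in> {p. snd p \<noteq> 0}. fst p / snd p \<in> U}"
  proof (intro equalityI subsetI)
    fix p assume "p \<in> {p. p \<noteq> 0 \<and> hpoint (fst p) (snd p) \<in> cp1_of_complex ` U}"
    then obtain z where "p \<noteq> 0" "z \<in> U" "hpoint (fst p) (snd p) = hpoint z 1"
      by (auto simp: cp1_of_complex_def)
    moreover from this have "\<exists>c. c \<noteq> 0 \<and> z = c * fst p \<and> 1 = c * snd p"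
      by (subst (asm) hpoint_eq_iff) (auto simp: zero_prod_def)
    ultimately obtain c where c: "z \<in> U" "z = c * fst p" "1 = c * snd p" by blast
    then have "snd p \<noteq> 0" by auto
    then have "fst p / snd p = z" using c(2,3) by (simp add: divide_eq_eq mult_ac)
    then show "p \<in> {p \<in> {p. snd p \<noteq> 0}. fst p / snd p \<in> U}"
      using c(1) \<open>snd p \<noteq> 0\<close> by simp
  next
    fix p assume p: "p \<in> {p \<in> {p. snd p \<noteq> 0}. fst p / snd p \<in> U}"
    then have "\<exists>c. c \<noteq> 0 \<and> fst p / snd p = c * fst p \<and> 1 = c * snd p"
      by (intro exI[of _ "inverse (snd p)"]) (auto simp: field_simps)
    then have "hpoint (fst p) (snd p) = cp1_of_complex (fst p / snd p)"
      unfolding cp1_of_complex_def using p by (subst hpoint_eq_iff) (auto simp: zero_prod_def)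
    then show "p \<in> {p. p \<noteq> 0 \<and> hpoint (fst p) (snd p) \<in> cp1_of_complex ` U}"
      using p by (auto simp: zero_prod_def)
  qed
  moreover have "open {p \<in> {p :: complex \<times> complex. snd p \<noteq> 0}. fst p / snd p \<in> U}"
  proof (rule continuous_open_preimage[unfolded vimage_def Int_def, simplified, OF _ _ assms])
    show "continuous_on {p :: complex \<times> complex. snd p \<noteq> 0} (\<lambda>p. fst p / snd p)"
      by (intro continuous_intros) auto
    show "open {p :: complex \<times> complex. snd p \<noteq> 0}"
      by (intro open_Collect_neq continuous_intros)
  qed
  ultimately show ?thesis by (simp add: open_cp1_def)
qed

lemma open_cp1_of_complex_vimage:
  assumes "open V" shows "open (cp1_of_complex -` V)"
proof -
  have "open ((\<lambda>z. (z, 1)) -` {p. p \<noteq> 0 \<and> hpoint (fst p) (snd p) \<in> V})"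
    using assms by (intro open_vimage continuous_intros) (simp add: open_cp1_def)
  moreover have "(\<lambda>z. (z, 1)) -` {p. p \<noteq> 0 \<and> hpoint (fst p) (snd p) \<in> V} = cp1_of_complex -` V"
    by (auto simp: cp1_of_complex_def zero_prod_def)
  ultimately show ?thesis by simp
qed

lemma continuous_on_cp1_of_complex: "continuous_on UNIV cp1_of_complex"
  using open_cp1_of_complex_vimage by (simp add: continuous_on_open_vimage)

definition affine_coordinate :: "cp1 \<Rightarrow> complex" where
  "affine_coordinate = inv cp1_of_complex"

lemma affine_coordinate_of_complex [simp]: "affine_coordinate (cp1_of_complex z) = z"
  by (simp add: affine_coordinate_def inj_cp1_of_complex)

lemma range_cp1_of_complex: "range cp1_of_complex = - {cp1_infinity}"
  using cp1_eq_insert_infinity cp1_of_complex_neq_infinity by fastforce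

lemma cp1_of_affine_coordinate [simp]: "x \<noteq> cp1_infinity \<Longrightarrow> cp1_of_complex (affine_coordinate x) = x"
  unfolding affine_coordinate_def by (rule f_inv_into_f) (simp add: range_cp1_of_complex)

lemma continuous_on_affine_coordinate: "continuous_on (- {cp1_infinity}) affine_coordinate"
proof -
  have "open (- {cp1_infinity})" using open_cp1_of_complex_image[of UNIV] by (simp add: range_cp1_of_complex)
  moreover have "affine_coordinate -` U \<inter> - {cp1_infinity} = cp1_of_complex ` U" for U
    using range_cp1_of_complex by (auto simp: image_iff) (metis cp1_of_affine_coordinate)
  ultimately show ?thesis
    by (metis (no_types) continuous_on_open_vimage open_cp1_of_complex_image)
qed

lemma remove_infinity_eq: "remove_infinity \<Omega> = cp1_of_complex -` \<Omega>"
  using cp1_of_complex_neq_infinity by (auto simp: remove_infinity_def)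

text \<open>
  The affine chart is an open embedding.
\<close>

lemma closure_remove_infinity: "closure (remove_infinity \<Omega>) = remove_infinity (closure \<Omega>)"
  unfolding remove_infinity_eq
proof (intro equalityI subsetI)
  fix z assume z: "z \<in> closure (cp1_of_complex -` \<Omega>)"
  have "cp1_of_complex z \<in> closure \<Omega>"
    unfolding closure_iff_nhds_not_empty
  proof (intro allI impI)
    fix A V :: "cp1 set" assume "V \<subseteq> A" "open V" "cp1_of_complex z \<in> V"
    then have "open (cp1_of_complex -` V)" "z \<in> cp1_of_complex -` V"
      by (simp_all add: open_cp1_of_complex_vimage)
    then have "cp1_of_complex -` \<Omega> \<inter> cp1_of_complex -` V \<noteq> {}"
      using z by (meson closure_iff_nhds_not_empty subset_refl)
    then show "\<Omega> \<inter> A \<noteq> {}" using \<open>V \<subseteq> A\<close> by blast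
  qed
  then show "z \<in> cp1_of_complex -` closure \<Omega>" by simp
next
  fix z assume "z \<in> cp1_of_complex -` closure \<Omega>"
  then have z: "cp1_of_complex z \<in> closure \<Omega>" by simp
  show "z \<in> closure (cp1_of_complex -` \<Omega>)"
    unfolding closure_iff_nhds_not_empty
  proof (intro allI impI)
    fix A V :: "complex set" assume "V \<subseteq> A" "open V" "z \<in> V"
    then have "open (cp1_of_complex ` V)" "cp1_of_complex z \<in> cp1_of_complex ` V"
      by (simp_all add: open_cp1_of_complex_image)
    then have "\<Omega> \<inter> cp1_of_complex ` V \<noteq> {}"
      using z by (meson closure_iff_nhds_not_empty subset_refl)
    then show "cp1_of_complex -` \<Omega> \<inter> A \<noteq> {}" using \<open>V \<subseteq> A\<close> by blast
  qed
qed

lemma tuple_mset_eq_iff: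
  "tuple_mset n x = tuple_mset n y \<longleftrightarrow> (\<exists>\<sigma>. \<sigma> permutes {..<n} \<and> (\<forall>i<n. y i = x (\<sigma> i)))"
proof
  assume "tuple_mset n x = tuple_mset n y"
  then have "mset (map y [0..<n]) = mset (map x [0..<n])" by (simp add: tuple_mset_def)
  then obtain \<sigma> where \<sigma>: "\<sigma> permutes {..<length (map x [0..<n])}" "permute_list \<sigma> (map x [0..<n]) = map y [0..<n]"
    by (rule mset_eq_permutation)
  have "y i = x (\<sigma> i)" if "i < n" for i
  proof -
    have "\<sigma> i < n" using permutes_in_image[OF \<sigma>(1), of i] that by simp
    have "map y [0..<n] ! i = map x [0..<n] ! \<sigma> i"
      using that by (subst \<sigma>(2)[symmetric], subst permute_list_nth[OF \<sigma>(1)]) auto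
    then show ?thesis using that \<open>\<sigma> i < n\<close> by simp
  qed
  then show "\<exists>\<sigma>. \<sigma> permutes {..<n} \<and> (\<forall>i<n. y i = x (\<sigma> i))" using \<sigma>(1) by auto
next
  assume "\<exists>\<sigma>. \<sigma> permutes {..<n} \<and> (\<forall>i<n. y i = x (\<sigma> i))"
  then obtain \<sigma> where \<sigma>: "\<sigma> permutes {..<n}" "\<And>i. i < n \<Longrightarrow> y i = x (\<sigma> i)" by blast
  have "\<sigma> i < n" if "i < n" for i using permutes_in_image[OF \<sigma>(1), of i] that by simp
  then have "permute_list \<sigma> (map x [0..<n]) = map y [0..<n]"
    using \<sigma> by (intro nth_equalityI) (auto simp: permute_list_nth)
  then have "mset (map y [0..<n]) = mset (map x [0..<n])"
    using mset_permute_list[of \<sigma> "map x [0..<n]"] \<sigma>(1) by simp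
  then show "tuple_mset n x = tuple_mset n y" by (simp add: tuple_mset_def)
qed

lemma tuple_mset_cong: "(\<And>i. i < n \<Longrightarrow> x i = y i) \<Longrightarrow> tuple_mset n x = tuple_mset n y"
  unfolding tuple_mset_def by (intro arg_cong[where f = mset] map_cong) auto

lemma points_in_tuple_mset: "points_in A (tuple_mset n x) = card {i \<in> {..<n}. x i \<in> A}"
proof -
  have "points_in A (tuple_mset n x) = length (filter (\<lambda>i. x i \<in> A) [0..<n])"
    by (simp only: points_in_def tuple_mset_def mset_filter[symmetric] size_mset filter_map length_map o_def)
  also have "\<dots> = card {i \<in> {..<n}. x i \<in> A}"
    by (subst distinct_card[symmetric]) (auto intro: arg_cong[where f = card])
  finally show ?thesis .
qed

lemma points_in_singleton: "points_in {a} M = count M a"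
proof -
  have "filter_mset (\<lambda>x. x \<in> {a}) M = replicate_mset (count M a) a"
    using filter_eq_replicate_mset[of a M] by (simp add: eq_commute)
  then show ?thesis by (simp add: points_in_def)
qed

lemma size_tuple_mset: "size (tuple_mset n x) = n"
  by (simp add: tuple_mset_def)

abbreviation tuple_topology :: "nat \<Rightarrow> 'a topology \<Rightarrow> (nat \<Rightarrow> 'a) topology" where
  "tuple_topology n T \<equiv> product_topology (\<lambda>_. T) {..<n}"

abbreviation mset_topology :: "nat \<Rightarrow> 'a topology \<Rightarrow> 'a multiset topology" where
  "mset_topology n T \<equiv> quotient_topology (tuple_topology n T) (tuple_mset n)"

text \<open>
  The preimage of the image of \<open>V\<close> is the union of the finitely many permuted copies of \<open>V\<close>.
\<close>

lemma open_map_tuple_mset: "open_map (tuple_topology n T) (mset_topology n T) (tuple_mset n)"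
  unfolding open_map_def
proof (intro allI impI)
  fix V assume V: "openin (tuple_topology n T) V"
  let ?P = "\<lambda>\<sigma> x. \<lambda>i\<in>{..<n}. x (\<sigma> i) :: 'a"
  have ext: "v \<in> extensional {..<n}" if "v \<in> V" for v
    using openin_subset[OF V] that by (auto simp: PiE_def)
  have "{x \<in> topspace (tuple_topology n T). tuple_mset n x \<in> tuple_mset n ` V}
      = (\<Union>\<sigma>\<in>{\<sigma>. \<sigma> permutes {..<n}}. {x \<in> topspace (tuple_topology n T). ?P \<sigma> x \<in> V})"
  proof (intro equalityI subsetI)
    fix x assume x: "x \<in> {x \<in> topspace (tuple_topology n T). tuple_mset n x \<in> tuple_mset n ` V}"
    then obtain v where v: "v \<in> V" "tuple_mset n x = tuple_mset n v" by blast
    then obtain \<sigma> where \<sigma>: "\<sigma> permutes {..<n}" "\<forall>i<n. v i = x (\<sigma> i)"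
      unfolding tuple_mset_eq_iff by blast
    then have "?P \<sigma> x = v" using ext[OF v(1)] by (auto simp: fun_eq_iff extensional_def)
    then show "x \<in> (\<Union>\<sigma>\<in>{\<sigma>. \<sigma> permutes {..<n}}. {x \<in> topspace (tuple_topology n T). ?P \<sigma> x \<in> V})"
      using x v(1) \<sigma>(1) by blast
  next
    fix x assume "x \<in> (\<Union>\<sigma>\<in>{\<sigma>. \<sigma> permutes {..<n}}. {x \<in> topspace (tuple_topology n T). ?P \<sigma> x \<in> V})"
    then obtain \<sigma> where \<sigma>: "\<sigma> permutes {..<n}" "x \<in> topspace (tuple_topology n T)" "?P \<sigma> x \<in> V"
      by blast
    then have "tuple_mset n x = tuple_mset n (?P \<sigma> x)" unfolding tuple_mset_eq_iff by auto
    then show "x \<in> {x \<in> topspace (tuple_topology n T). tuple_mset n x \<in> tuple_mset n ` V}"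
      using \<sigma> by blast
  qed
  moreover have "openin (tuple_topology n T) {x \<in> topspace (tuple_topology n T). ?P \<sigma> x \<in> V}"
    if "\<sigma> permutes {..<n}" for \<sigma>
  proof (rule openin_continuous_map_preimage[OF _ V])
    show "continuous_map (tuple_topology n T) (tuple_topology n T) (?P \<sigma>)"
      unfolding continuous_map_componentwise
    proof (intro conjI ballI)
      fix k assume k: "k \<in> {..<n}"
      then have "\<sigma> k \<in> {..<n}" using permutes_in_image[OF that] by blast
      then show "continuous_map (tuple_topology n T) T (\<lambda>x. ?P \<sigma> x k)"
        using k continuous_map_product_projection[of "\<sigma> k" "{..<n}" "\<lambda>_. T"] by simp
    qed auto
  qed
  ultimately have "openin (tuple_topology n T)
      {x \<in> topspace (tuple_topology n T). tuple_mset n x \<in> tuple_mset n ` V}"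
    by (auto intro: openin_Union)
  then show "openin (mset_topology n T) (tuple_mset n ` V)"
    using openin_subset[OF V] unfolding openin_quotient_topology by (auto intro: image_mono)
qed

section \<open>Adding points at infinity\<close>

definition add_infinities :: "nat \<Rightarrow> complex multiset \<Rightarrow> cp1 multiset" where
  "add_infinities k N = image_mset cp1_of_complex N + replicate_mset k cp1_infinity"

definition affine_part :: "cp1 multiset \<Rightarrow> complex multiset" where
  "affine_part M = image_mset affine_coordinate (filter_mset (\<lambda>x. x \<noteq> cp1_infinity) M)"

lemma affine_part_add_infinities [simp]: "affine_part (add_infinities k N) = N"
  by (simp add: affine_part_def add_infinities_def filter_mset_image_mset cp1_of_complex_neq_infinity
      multiset.map_comp o_def)

lemma add_infinities_affine_part:
  assumes "count M cp1_infinity = k" shows "add_infinities k (affine_part M) = M"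
proof -
  have "image_mset cp1_of_complex (affine_part M) = filter_mset (\<lambda>x. x \<noteq> cp1_infinity) M"
    unfolding affine_part_def multiset.map_comp o_def
    by (rule trans[OF image_mset_cong[of _ _ "\<lambda>x. x"]]) auto
  moreover have "filter_mset (\<lambda>x. x = cp1_infinity) M = replicate_mset k cp1_infinity"
    using filter_eq_replicate_mset[of cp1_infinity M] assms by (simp add: eq_commute)
  ultimately show ?thesis
    unfolding add_infinities_def using multiset_partition[of M "\<lambda>x. x \<noteq> cp1_infinity"] by simp
qed

lemma count_add_infinities: "count (add_infinities k N) cp1_infinity = k"
proof -
  have "cp1_infinity \<notin># image_mset cp1_of_complex N"
    using cp1_of_complex_neq_infinity by (auto simp: eq_commute)
  then have "count (image_mset cp1_of_complex N) cp1_infinity = 0" by (simp only: not_in_iff)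
  then show ?thesis by (simp add: add_infinities_def)
qed

lemma size_add_infinities: "size (add_infinities k N) = size N + k"
  by (simp add: add_infinities_def)

lemma points_in_add_infinities:
  "points_in (A - {cp1_infinity}) (add_infinities k N) = points_in (cp1_of_complex -` A) N"
proof -
  have "filter_mset (\<lambda>x. x \<in> A - {cp1_infinity}) (replicate_mset k cp1_infinity) = {#}"
    by (induction k) auto
  then show ?thesis
    by (simp add: points_in_def add_infinities_def filter_mset_image_mset cp1_of_complex_neq_infinity)
qed

lemma add_infinities_in_stratum_iff:
  assumes "k + l + m = r" "r \<le> n" "size N = r"
  shows "add_infinities (n - r) N \<in> underlined_stratum \<Omega> n k l m
    \<longleftrightarrow> N \<in> stratum (remove_infinity \<Omega>) r k l m"
proof -
  have "cp1_of_complex -` stable \<Omega> = stable (remove_infinity \<Omega>)"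
    "cp1_of_complex -` semistable \<Omega> = semistable (remove_infinity \<Omega>)"
    "cp1_of_complex -` unstable \<Omega> = unstable (remove_infinity \<Omega>)"
    by (auto simp: stable_def semistable_def unstable_def closure_remove_infinity) (auto simp: remove_infinity_eq)
  then show ?thesis
    using assms by (simp add: underlined_stratum_def stratum_def points_in_add_infinities
        size_add_infinities count_add_infinities)
qed

text \<open>
  The lift of \<open>add_infinities\<close> to tuples.
\<close>

definition pad_tuple :: "nat \<Rightarrow> (nat \<Rightarrow> complex) \<Rightarrow> nat \<Rightarrow> cp1" where
  "pad_tuple r z i = (if i < r then cp1_of_complex (z i) else cp1_infinity)"

lemma add_infinities_tuple_mset:
  assumes "r \<le> n" shows "add_infinities (n - r) (tuple_mset r z) = tuple_mset n (pad_tuple r z)"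
proof -
  have "[0..<n] = [0..<r] @ [r..<n]" using upt_add_eq_append[of 0 r "n - r"] assms by simp
  then have "tuple_mset n (pad_tuple r z)
      = mset (map (pad_tuple r z) [0..<r]) + mset (map (pad_tuple r z) [r..<n])"
    by (simp only: tuple_mset_def map_append mset_append)
  also have "map (pad_tuple r z) [0..<r] = map (cp1_of_complex \<circ> z) [0..<r]"
    by (rule map_cong) (auto simp: pad_tuple_def)
  also have "map (pad_tuple r z) [r..<n] = map (\<lambda>_. cp1_infinity) [r..<n]"
    by (rule map_cong) (auto simp: pad_tuple_def)
  finally show ?thesis
    unfolding add_infinities_def tuple_mset_def by (simp add: map_replicate_const multiset.map_comp o_def)
qed

abbreviation "sym_complex r \<equiv> mset_topology r (euclidean :: complex topology)"
abbreviation "sym_cp1 n \<equiv> mset_topology n (euclidean :: cp1 topology)"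

lemma continuous_map_add_infinities:
  assumes "r \<le> n"
  shows "continuous_map (sym_complex r) (sym_cp1 n) (add_infinities (n - r))"
proof (rule continuous_compose_quotient_map[OF quotient_map_quotient_topology])
  let ?pad = "\<lambda>z. restrict (pad_tuple r z) {..<n}"
  have "continuous_map (tuple_topology r euclidean) (tuple_topology n euclidean) ?pad"
    unfolding continuous_map_componentwise
  proof (intro conjI ballI)
    fix k assume k: "k \<in> {..<n}"
    show "continuous_map (tuple_topology r euclidean) euclidean (\<lambda>z. ?pad z k)"
    proof (cases "k < r")
      case True
      have "continuous_map (tuple_topology r euclidean) euclidean (\<lambda>z :: nat \<Rightarrow> complex. z k)"
        using True by (intro continuous_map_product_projection) auto
      moreover have "continuous_map euclidean euclidean cp1_of_complex"
        using continuous_on_cp1_of_complex by simp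
      ultimately have "continuous_map (tuple_topology r euclidean) euclidean (cp1_of_complex \<circ> (\<lambda>z. z k))"
        by (rule continuous_map_compose)
      then show ?thesis using True k by (simp add: pad_tuple_def o_def)
    qed (use k in \<open>simp add: pad_tuple_def\<close>)
  qed auto
  then have "continuous_map (tuple_topology r euclidean) (sym_cp1 n) (tuple_mset n \<circ> ?pad)"
    by (rule continuous_map_compose) (rule quotient_imp_continuous_map[OF quotient_map_quotient_topology])
  moreover have "tuple_mset n \<circ> ?pad = add_infinities (n - r) \<circ> tuple_mset r"
    using add_infinities_tuple_mset[OF assms] by (auto simp: fun_eq_iff intro: tuple_mset_cong)
  ultimately show "continuous_map (tuple_topology r euclidean) (sym_cp1 n) (add_infinities (n - r) \<circ> tuple_mset r)"
    by simp
qed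

text \<open>
  The tuples whose first \<open>r\<close> entries are finite form an open box, on which the map to the symmetric
  product of the plane is continuous.
\<close>

lemma openin_affine_preimage:
  assumes "r \<le> n" and U: "openin (sym_complex r) U"
  shows "openin (tuple_topology n euclidean)
    {x \<in> {..<n} \<rightarrow>\<^sub>E UNIV. (\<forall>i<r. x i \<noteq> cp1_infinity) \<and> tuple_mset r (\<lambda>i. affine_coordinate (x i)) \<in> U}"
proof -
  let ?T = "tuple_topology n (euclidean :: cp1 topology)"
  define D where "D = {x \<in> {..<n} \<rightarrow>\<^sub>E UNIV. \<forall>i<r. x i \<noteq> cp1_infinity}"
  have "open (- {cp1_infinity})"
    using open_cp1_of_complex_image[of UNIV] by (simp add: range_cp1_of_complex)
  then have "openin ?T (PiE {..<n} (\<lambda>i. if i < r then - {cp1_infinity} else UNIV))"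
    by (intro product_topology_basis) auto
  moreover have "D = PiE {..<n} (\<lambda>i. if i < r then - {cp1_infinity} else UNIV)"
  proof (intro equalityI subsetI)
    fix x assume "x \<in> D"
    then have "x \<in> extensional {..<n}" "\<And>i. i < r \<Longrightarrow> x i \<noteq> cp1_infinity"
      by (auto simp: D_def PiE_def)
    then show "x \<in> PiE {..<n} (\<lambda>i. if i < r then - {cp1_infinity} else UNIV)"
      by (intro PiE_I) (auto simp: extensional_def)
  next
    fix x assume x: "x \<in> PiE {..<n} (\<lambda>i. if i < r then - {cp1_infinity} else UNIV)"
    then have "x \<in> {..<n} \<rightarrow>\<^sub>E UNIV" by (simp add: PiE_def)
    moreover have "x i \<noteq> cp1_infinity" if "i < r" for i
      using PiE_mem[OF x, of i] that assms(1) by simp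
    ultimately show "x \<in> D" unfolding D_def by blast
  qed
  ultimately have D: "openin ?T D" by simp
  let ?\<rho> = "\<lambda>x. \<lambda>i\<in>{..<r}. affine_coordinate (x i)"
  have "continuous_map (subtopology ?T D) (tuple_topology r euclidean) ?\<rho>"
    unfolding continuous_map_componentwise
  proof (intro conjI ballI)
    fix k assume k: "k \<in> {..<r}"
    have "continuous_map (subtopology ?T D) euclidean (\<lambda>x. x k)"
      using k assms(1) by (intro continuous_map_from_subtopology continuous_map_product_projection) auto
    then have "continuous_map (subtopology ?T D) (subtopology euclidean (- {cp1_infinity})) (\<lambda>x. x k)"
      using k by (auto simp: continuous_map_in_subtopology D_def)
    moreover have "continuous_map (subtopology euclidean (- {cp1_infinity})) euclidean affine_coordinate"
      using continuous_on_affine_coordinate by simp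
    ultimately have "continuous_map (subtopology ?T D) euclidean (affine_coordinate \<circ> (\<lambda>x. x k))"
      by (rule continuous_map_compose)
    then show "continuous_map (subtopology ?T D) euclidean (\<lambda>x. ?\<rho> x k)"
      using k by (simp add: o_def)
  qed auto
  then have "continuous_map (subtopology ?T D) (sym_complex r) (tuple_mset r \<circ> ?\<rho>)"
    by (rule continuous_map_compose) (rule quotient_imp_continuous_map[OF quotient_map_quotient_topology])
  then have "openin (subtopology ?T D) {x \<in> topspace (subtopology ?T D). (tuple_mset r \<circ> ?\<rho>) x \<in> U}"
    using U by (rule openin_continuous_map_preimage)
  then have "openin ?T {x \<in> topspace (subtopology ?T D). (tuple_mset r \<circ> ?\<rho>) x \<in> U}"
    using D openin_trans_full by blast
  moreover have "tuple_mset r (?\<rho> x) = tuple_mset r (\<lambda>i. affine_coordinate (x i))" for x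
    by (rule tuple_mset_cong) simp
  then have "{x \<in> topspace (subtopology ?T D). (tuple_mset r \<circ> ?\<rho>) x \<in> U}
    = {x \<in> {..<n} \<rightarrow>\<^sub>E UNIV. (\<forall>i<r. x i \<noteq> cp1_infinity) \<and> tuple_mset r (\<lambda>i. affine_coordinate (x i)) \<in> U}"
    by (auto simp: D_def)
  ultimately show ?thesis by simp
qed

text \<open>
  If the first \<open>r\<close> entries are finite, then the \<open>n - r\<close> infinite ones are all of the others.
\<close>

lemma pad_tuple_affine_coordinate:
  assumes "r \<le> n" "\<And>i. i < r \<Longrightarrow> x i \<noteq> cp1_infinity"
    and "count (tuple_mset n x) cp1_infinity = n - r" "i < n"
  shows "pad_tuple r (\<lambda>i. affine_coordinate (x i)) i = x i"
proof -
  have "card {i \<in> {..<n}. x i \<in> {cp1_infinity}} = card {r..<n}"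
    using assms(3) by (simp only: points_in_singleton[symmetric] points_in_tuple_mset) simp
  moreover have "{i \<in> {..<n}. x i \<in> {cp1_infinity}} \<subseteq> {r..<n}"
    using assms(2) by (auto simp: not_less[symmetric])
  ultimately have at_infinity: "{i \<in> {..<n}. x i \<in> {cp1_infinity}} = {r..<n}"
    by (intro card_subset_eq) auto
  have tail: "x i = cp1_infinity" if "r \<le> i"
  proof -
    have "i \<in> {i \<in> {..<n}. x i \<in> {cp1_infinity}}" unfolding at_infinity using that assms(4) by simp
    then show ?thesis by simp
  qed
  show ?thesis
  proof (cases "i < r")
    case True
    then show ?thesis using cp1_of_affine_coordinate[OF assms(2)] by (simp only: pad_tuple_def if_True)
  next
    case False
    then show ?thesis using tail by (simp add: pad_tuple_def)
  qed
qed

text \<open>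
  The image of \<open>U\<close> is the trace on the locus of the image of an open set \<open>V\<close> of tuples: a tuple in \<open>V\<close>
  starts with a labelling of a member of \<open>U\<close>, and its other entries are arbitrary.  The multiplicity
  of \<open>\<infinity>\<close> forces these entries to be infinite.
\<close>

lemma open_map_add_infinities:
  assumes "r \<le> n"
  shows "open_map (sym_complex r) (subtopology (sym_cp1 n) {M. count M cp1_infinity = n - r})
    (add_infinities (n - r))"
  unfolding open_map_def
proof (intro allI impI)
  fix U assume U: "openin (sym_complex r) U"
  let ?L = "{M. count M cp1_infinity = n - r}"
  define V where "V = {x \<in> {..<n} \<rightarrow>\<^sub>E UNIV.
    (\<forall>i<r. x i \<noteq> cp1_infinity) \<and> tuple_mset r (\<lambda>i. affine_coordinate (x i)) \<in> U}"
  have "openin (tuple_topology n euclidean) V"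
    unfolding V_def by (rule openin_affine_preimage[OF assms U])
  then have W: "openin (sym_cp1 n) (tuple_mset n ` V)"
    using open_map_tuple_mset unfolding open_map_def by blast
  have "add_infinities (n - r) ` U = tuple_mset n ` V \<inter> ?L"
  proof (intro equalityI subsetI)
    fix M assume "M \<in> add_infinities (n - r) ` U"
    then obtain N where N: "N \<in> U" "M = add_infinities (n - r) N" by blast
    then have "N \<in> tuple_mset r ` ({..<r} \<rightarrow>\<^sub>E UNIV)"
      using openin_subset[OF U] by (auto simp: topspace_quotient_topology)
    then obtain z where z: "N = tuple_mset r z" by blast
    let ?x = "restrict (pad_tuple r z) {..<n}"
    have "tuple_mset r (\<lambda>i. affine_coordinate (?x i)) = N"
      unfolding z using assms by (intro tuple_mset_cong) (simp add: pad_tuple_def)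
    then have "?x \<in> V"
      using N(1) assms cp1_of_complex_neq_infinity by (auto simp: V_def pad_tuple_def)
    moreover have "tuple_mset n ?x = M"
      unfolding N(2) z add_infinities_tuple_mset[OF assms] by (rule tuple_mset_cong) simp
    ultimately show "M \<in> tuple_mset n ` V \<inter> ?L"
      using N(2) count_add_infinities by force
  next
    fix M assume "M \<in> tuple_mset n ` V \<inter> ?L"
    then obtain x where x: "x \<in> V" "M = tuple_mset n x" "count M cp1_infinity = n - r" by blast
    have "add_infinities (n - r) (tuple_mset r (\<lambda>i. affine_coordinate (x i))) = M"
      unfolding add_infinities_tuple_mset[OF assms] x(2)
      using x by (intro tuple_mset_cong pad_tuple_affine_coordinate[OF assms]) (auto simp: V_def)
    then show "M \<in> add_infinities (n - r) ` U" using x(1) by (force simp: V_def)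
  qed
  then show "openin (subtopology (sym_cp1 n) ?L) (add_infinities (n - r) ` U)"
    using W by (auto simp: openin_subtopology)
qed

lemma topo_sym_prod: "topo (sym_prod n X) = mset_topology n (topo X)"
  unfolding sym_prod_def sa_space.simps by (rule refl)

lemma topo_cp1_space: "topo cp1_space = euclidean"
  unfolding cp1_space_def by (rule sa_space.simps)

lemma topo_complex_space: "topo complex_space = euclidean"
  unfolding complex_space_def by (rule sa_space.simps)

lemma homeomorphic_map_affine_part:
  assumes "r \<le> n"
  shows "homeomorphic_map (subtopology (sym_cp1 n) {M. count M cp1_infinity = n - r}) (sym_complex r) affine_part"
proof -
  let ?L = "{M. count M cp1_infinity = n - r}"
  have C: "topspace (sym_complex r) = {N. size N = r}"
    using topspace_sym_prod[of r complex_space] unfolding topo_sym_prod topo_complex_space by simp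
  have P: "topspace (sym_cp1 n) = {M. size M = n}"
    using topspace_sym_prod[of n cp1_space] unfolding topo_sym_prod topo_cp1_space by simp
  have size: "size (affine_part M) = r" if "size M = n" "M \<in> ?L" for M
    using size_add_infinities[of "n - r" "affine_part M"] add_infinities_affine_part[of M "n - r"] that assms
    by simp
  have image: "add_infinities (n - r) ` topspace (sym_complex r) = topspace (subtopology (sym_cp1 n) ?L)"
  proof (intro equalityI subsetI)
    fix M assume "M \<in> topspace (subtopology (sym_cp1 n) ?L)"
    then have M: "size M = n" "M \<in> ?L" by (auto simp: P)
    then have "M = add_infinities (n - r) (affine_part M)" by (simp add: add_infinities_affine_part)
    then show "M \<in> add_infinities (n - r) ` topspace (sym_complex r)" using size[OF M] C by blast
  qed (use assms in \<open>auto simp: C P size_add_infinities count_add_infinities\<close>)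
  have "continuous_map (sym_complex r) (subtopology (sym_cp1 n) ?L) (add_infinities (n - r))"
    using continuous_map_add_infinities[OF assms] by (auto simp: continuous_map_in_subtopology count_add_infinities)
  moreover have "inj_on (add_infinities (n - r)) (topspace (sym_complex r))"
    by (rule inj_on_inverseI[of _ affine_part]) simp
  ultimately have "homeomorphic_map (sym_complex r) (subtopology (sym_cp1 n) ?L) (add_infinities (n - r))"
    using open_map_add_infinities[OF assms] image by (intro bijective_open_imp_homeomorphic_map)
  then obtain g where g: "homeomorphic_maps (sym_complex r) (subtopology (sym_cp1 n) ?L) (add_infinities (n - r)) g"
    unfolding homeomorphic_map_maps by blast
  have "homeomorphic_map (subtopology (sym_cp1 n) ?L) (sym_complex r) g"
    using g homeomorphic_maps_map by blast
  moreover have "g M = affine_part M" if "M \<in> topspace (subtopology (sym_cp1 n) ?L)" for M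
  proof -
    have "add_infinities (n - r) (g M) = M" using g that by (simp add: homeomorphic_maps_def)
    then show ?thesis by (metis affine_part_add_infinities)
  qed
  ultimately show ?thesis by (rule homeomorphic_map_eq)
qed

section \<open>Semialgebraicity of the strata and of the graph\<close>

lemma semialgebraic_diff:
  assumes "semialgebraic I A" "semialgebraic I B" shows "semialgebraic I (A - B)"
proof -
  have "A - B = (I \<rightarrow>\<^sub>E UNIV) - (((I \<rightarrow>\<^sub>E UNIV) - A) \<union> B)"
    using semialgebraic_subset[OF assms(1)] by blast
  then show ?thesis
    using semialgebraic.complement[OF semialgebraic.union[OF semialgebraic.complement[OF assms(1)] assms(2)]]
    by (simp only:)
qed

lemma sa_set_diff:
  assumes "sa_set X A" "sa_set X B" shows "sa_set X (A - B)"
proof -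
  have "{x \<in> pdom X. param X x \<in> A - B} = {x \<in> pdom X. param X x \<in> A} - {x \<in> pdom X. param X x \<in> B}"
    by blast
  moreover have "semialgebraic (coords X) ({x \<in> pdom X. param X x \<in> A} - {x \<in> pdom X. param X x \<in> B})"
    using assms unfolding sa_set_def by (intro semialgebraic_diff) blast+
  ultimately have "semialgebraic (coords X) {x \<in> pdom X. param X x \<in> A - B}" by (simp only:)
  then show ?thesis using assms(1) unfolding sa_set_def by blast
qed

lemma sa_pred_Inl:
  assumes "sa_pred I P" shows "sa_pred (I <+> J) (\<lambda>x. P (x \<circ> Inl))"
proof -
  have "sa_pred (I <+> J) (\<lambda>x. (\<lambda>i\<in>I. x (Inl i)) \<in> {y \<in> I \<rightarrow>\<^sub>E UNIV. P y})"
    using assms[unfolded sa_pred_def] by (rule sa_pred_substitution) (rule polynomial_functions.coord, blast)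
  moreover have "(\<lambda>i\<in>I. x (Inl i)) \<in> {y \<in> I \<rightarrow>\<^sub>E UNIV. P y} \<longleftrightarrow> P (x \<circ> Inl)"
    if "x \<in> (I <+> J) \<rightarrow>\<^sub>E UNIV" for x :: "_ \<Rightarrow> real"
  proof -
    have "(\<lambda>i\<in>I. x (Inl i)) = x \<circ> Inl"
    proof
      fix i show "(\<lambda>i\<in>I. x (Inl i)) i = (x \<circ> Inl) i"
      proof (cases "i \<in> I")
        case False
        then have "Inl i \<notin> I <+> J" by blast
        then show ?thesis using PiE_arb[OF that] False by simp
      qed simp
    qed
    moreover have "(\<lambda>i\<in>I. x (Inl i)) \<in> I \<rightarrow>\<^sub>E UNIV" by simp
    ultimately show ?thesis by simp
  qed
  ultimately show ?thesis by (rule iffD1[OF sa_pred_cong, rotated])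
qed

lemma sa_pred_Inr:
  assumes "sa_pred J P" shows "sa_pred (I <+> J) (\<lambda>x. P (x \<circ> Inr))"
proof -
  have "sa_pred (I <+> J) (\<lambda>x. (\<lambda>j\<in>J. x (Inr j)) \<in> {y \<in> J \<rightarrow>\<^sub>E UNIV. P y})"
    using assms[unfolded sa_pred_def] by (rule sa_pred_substitution) (rule polynomial_functions.coord, blast)
  moreover have "(\<lambda>j\<in>J. x (Inr j)) \<in> {y \<in> J \<rightarrow>\<^sub>E UNIV. P y} \<longleftrightarrow> P (x \<circ> Inr)"
    if "x \<in> (I <+> J) \<rightarrow>\<^sub>E UNIV" for x :: "_ \<Rightarrow> real"
  proof -
    have "(\<lambda>j\<in>J. x (Inr j)) = x \<circ> Inr"
    proof
      fix j show "(\<lambda>j\<in>J. x (Inr j)) j = (x \<circ> Inr) j"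
      proof (cases "j \<in> J")
        case False
        then have "Inr j \<notin> I <+> J" by blast
        then show ?thesis using PiE_arb[OF that] False by simp
      qed simp
    qed
    moreover have "(\<lambda>j\<in>J. x (Inr j)) \<in> J \<rightarrow>\<^sub>E UNIV" by simp
    ultimately show ?thesis by simp
  qed
  ultimately show ?thesis by (rule iffD1[OF sa_pred_cong, rotated])
qed

lemma sa_pred_member:
  assumes "semialgebraic I B" "i < n"
  shows "sa_pred ({..<n} \<times> I) (\<lambda>x. (\<lambda>j. x (i, j)) \<in> B)"
proof -
  have "sa_pred ({..<n} \<times> I) (\<lambda>x. (\<lambda>j\<in>I. x (i, j)) \<in> B)"
    using assms(2) by (intro sa_pred_substitution[OF assms(1)] polynomial_functions.coord) simp
  moreover have "(\<lambda>j\<in>I. x (i, j)) \<in> B \<longleftrightarrow> (\<lambda>j. x (i, j)) \<in> B"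
    if "x \<in> ({..<n} \<times> I) \<rightarrow>\<^sub>E UNIV" for x :: "_ \<Rightarrow> real"
  proof -
    have "(\<lambda>j\<in>I. x (i, j)) = (\<lambda>j. x (i, j))"
    proof
      fix j show "(\<lambda>j\<in>I. x (i, j)) j = x (i, j)"
        using PiE_arb[OF that, of "(i, j)"] by (cases "j \<in> I") auto
    qed
    then show ?thesis by simp
  qed
  ultimately show ?thesis by (rule iffD1[OF sa_pred_cong, rotated])
qed

lemma coords_sym_prod: "coords (sym_prod n X) = {..<n} \<times> coords X"
  unfolding sym_prod_def sa_space.simps by (rule refl)

lemma pdom_sym_prod: "pdom (sym_prod n X) =
    {x \<in> ({..<n} \<times> coords X) \<rightarrow>\<^sub>E UNIV. \<forall>i\<in>{..<n}. (\<lambda>j. x (i, j)) \<in> pdom X}"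
  by (simp only: sym_prod_def sa_space.simps Ball_def lessThan_iff)

lemma param_sym_prod: "param (sym_prod n X) x = tuple_mset n (\<lambda>i. param X (\<lambda>j. x (i, j)))"
  unfolding sym_prod_def sa_space.simps by (rule refl)

lemma semialgebraic_pdom_sym_prod:
  assumes "semialgebraic (coords X) (pdom X)"
  shows "semialgebraic (coords (sym_prod n X)) (pdom (sym_prod n X))"
proof -
  have "sa_pred ({..<n} \<times> coords X) (\<lambda>x. \<forall>i\<in>{..<n}. (\<lambda>j. x (i, j)) \<in> pdom X)"
    by (intro sa_pred_ball sa_pred_member[OF assms]) simp_all
  then show ?thesis unfolding sa_pred_def coords_sym_prod pdom_sym_prod .
qed

text \<open>
  The number of points in \<open>A\<close> is the number of indices whose coordinates lie in the preimage of \<open>A\<close>.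
\<close>

lemma sa_set_points_in:
  assumes pdom: "semialgebraic (coords X) (pdom X)" and top: "topspace (topo X) = UNIV"
    and F: "finite F" "\<And>A k. (A, k) \<in> F \<Longrightarrow> sa_set X A"
  shows "sa_set (sym_prod n X) {M. size M = n \<and> (\<forall>(A, k)\<in>F. points_in A M = k)}"
    (is "sa_set _ ?S")
proof -
  let ?B = "\<lambda>A. {x \<in> pdom X. param X x \<in> A}"
  have "sa_pred ({..<n} \<times> coords X) (\<lambda>x. x \<in> pdom (sym_prod n X) \<and>
      (\<forall>p\<in>F. card {i \<in> {..<n}. (\<lambda>j. x (i, j)) \<in> ?B (fst p)} = snd p))"
  proof (intro sa_pred_conj sa_pred_ball F(1) sa_pred_card)
    show "sa_pred ({..<n} \<times> coords X) (\<lambda>x. x \<in> pdom (sym_prod n X))"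
      using semialgebraic_pdom_sym_prod[OF pdom] by (simp only: coords_sym_prod sa_pred_mem)
    fix p i assume "p \<in> F" "i \<in> {..<n}"
    then have "semialgebraic (coords X) (?B (fst p))" "i < n"
      using F(2)[of "fst p" "snd p"] by (simp_all add: sa_set_def)
    then show "sa_pred ({..<n} \<times> coords X) (\<lambda>x. (\<lambda>j. x (i, j)) \<in> ?B (fst p))"
      by (rule sa_pred_member)
  qed simp
  then have "semialgebraic (coords (sym_prod n X)) {x \<in> pdom (sym_prod n X). param (sym_prod n X) x \<in> ?S}"
    unfolding sa_pred_def coords_sym_prod
  proof (rule back_subst[of "semialgebraic ({..<n} \<times> coords X)"], intro set_eqI)
    fix x
    have pts: "points_in A (param (sym_prod n X) x) = card {i \<in> {..<n}. (\<lambda>j. x (i, j)) \<in> ?B A}"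
      if "x \<in> pdom (sym_prod n X)" for A
    proof -
      have "(\<lambda>j. x (i, j)) \<in> pdom X" if "i \<in> {..<n}" for i
        using \<open>x \<in> pdom (sym_prod n X)\<close> that unfolding pdom_sym_prod by blast
      then have "{i \<in> {..<n}. (\<lambda>j. x (i, j)) \<in> ?B A} = {i \<in> {..<n}. param X (\<lambda>j. x (i, j)) \<in> A}"
        by blast
      then show ?thesis unfolding param_sym_prod points_in_tuple_mset by (simp only:)
    qed
    have ext: "x \<in> pdom (sym_prod n X) \<Longrightarrow> x \<in> ({..<n} \<times> coords X) \<rightarrow>\<^sub>E UNIV"
      unfolding pdom_sym_prod by blast
    have "param (sym_prod n X) x \<in> ?S \<longleftrightarrow> (\<forall>p\<in>F. points_in (fst p) (param (sym_prod n X) x) = snd p)"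
      unfolding mem_Collect_eq by (simp only: param_sym_prod size_tuple_mset case_prod_unfold simp_thms)
    then have "x \<in> pdom (sym_prod n X) \<Longrightarrow> param (sym_prod n X) x \<in> ?S \<longleftrightarrow>
        (\<forall>p\<in>F. card {i \<in> {..<n}. (\<lambda>j. x (i, j)) \<in> ?B (fst p)} = snd p)"
      by (simp only: pts)
    with ext show "x \<in> {x \<in> ({..<n} \<times> coords X) \<rightarrow>\<^sub>E UNIV. x \<in> pdom (sym_prod n X) \<and>
          (\<forall>p\<in>F. card {i \<in> {..<n}. (\<lambda>j. x (i, j)) \<in> ?B (fst p)} = snd p)}
        \<longleftrightarrow> x \<in> {x \<in> pdom (sym_prod n X). param (sym_prod n X) x \<in> ?S}"
      unfolding mem_Collect_eq by argo
  qed
  moreover have "?S \<subseteq> topspace (topo (sym_prod n X))"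
    unfolding topspace_sym_prod top by blast
  ultimately show ?thesis by (simp only: sa_set_def simp_thms)
qed

lemma semialgebraic_pdom_cp1_space: "semialgebraic (coords cp1_space) (pdom cp1_space)"
proof -
  have "sa_pred {..<4} (\<lambda>x. \<exists>i\<in>{..<4::nat}. x i \<noteq> 0)"
    by (intro sa_pred_bex sa_pred_not sa_pred_eq polynomial_functions.intros finite_lessThan)
  then show ?thesis unfolding sa_pred_def cp1_space_def sa_space.simps Bex_def lessThan_iff .
qed

lemma semialgebraic_pdom_complex_space: "semialgebraic (coords complex_space) (pdom complex_space)"
  unfolding complex_space_def sa_space.simps by (rule semialgebraic_space)

lemma cp1_infinity_eq_hpoint_iff:
  assumes "p \<noteq> 0" shows "cp1_infinity = hpoint (fst p) (snd p) \<longleftrightarrow> snd p = 0"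
proof -
  have nz: "(1, 0) \<noteq> (0 :: complex \<times> complex)" "(fst p, snd p) \<noteq> 0"
    using assms by (simp_all add: zero_prod_def prod_eq_iff)
  show ?thesis
    unfolding cp1_infinity_def hpoint_eq_iff[OF nz]
  proof
    assume "snd p = 0"
    then show "\<exists>c. c \<noteq> 0 \<and> fst p = c * 1 \<and> snd p = c * 0"
      using assms by (intro exI[of _ "fst p"]) (simp add: zero_prod_def prod_eq_iff)
  qed auto
qed

lemma cp1_of_complex_eq_hpoint_iff:
  assumes "p \<noteq> 0" shows "cp1_of_complex z = hpoint (fst p) (snd p) \<longleftrightarrow> fst p = snd p * z"
proof -
  have nz: "(z, 1) \<noteq> (0 :: complex \<times> complex)" "(fst p, snd p) \<noteq> 0"
    using assms by (simp_all add: zero_prod_def prod_eq_iff)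
  show ?thesis
    unfolding cp1_of_complex_def hpoint_eq_iff[OF nz]
  proof
    assume eq: "fst p = snd p * z"
    then have "snd p \<noteq> 0" using assms by (auto simp: zero_prod_def prod_eq_iff)
    then show "\<exists>c. c \<noteq> 0 \<and> fst p = c * z \<and> snd p = c * 1"
      using eq by (intro exI[of _ "snd p"]) simp
  qed auto
qed

lemma sa_set_cp1_UNIV: "sa_set cp1_space UNIV"
  using semialgebraic_pdom_cp1_space unfolding sa_set_def topo_cp1_space by simp

lemma sa_set_complex_UNIV: "sa_set complex_space UNIV"
  using semialgebraic_pdom_complex_space unfolding sa_set_def topo_complex_space by simp

lemma sa_set_cp1_infinity: "sa_set cp1_space {cp1_infinity}"
proof -
  have "sa_pred {..<4} (\<lambda>x. x \<in> pdom cp1_space \<and> (x 2 = 0 \<and> x 3 = 0))"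
    using semialgebraic_pdom_cp1_space unfolding cp1_space_def sa_space.simps
    by (intro sa_pred_conj sa_pred_eq polynomial_functions.intros sa_pred_mem) simp_all
  then have "semialgebraic {..<4} {x \<in> pdom cp1_space. param cp1_space x \<in> {cp1_infinity}}"
    unfolding sa_pred_def
  proof (rule back_subst[of "semialgebraic {..<4}"], intro set_eqI)
    fix x
    have "snd (homogeneous x) = 0 \<longleftrightarrow> x 2 = 0 \<and> x 3 = 0"
      by (simp add: homogeneous_def complex_eq_iff)
    then have "x \<in> pdom cp1_space \<Longrightarrow> param cp1_space x = cp1_infinity \<longleftrightarrow> x 2 = 0 \<and> x 3 = 0"
      unfolding pdom_cp1_space param_cp1_space mem_Collect_eq
      using cp1_infinity_eq_hpoint_iff[of "homogeneous x"] by argo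
    moreover have "x \<in> pdom cp1_space \<Longrightarrow> x \<in> {..<4} \<rightarrow>\<^sub>E UNIV" unfolding pdom_cp1_space by blast
    ultimately show "x \<in> {x \<in> {..<4} \<rightarrow>\<^sub>E UNIV. x \<in> pdom cp1_space \<and> (x 2 = 0 \<and> x 3 = 0)}
        \<longleftrightarrow> x \<in> {x \<in> pdom cp1_space. param cp1_space x \<in> {cp1_infinity}}"
      unfolding mem_Collect_eq singleton_iff by argo
  qed
  moreover have "coords cp1_space = {..<4}" unfolding cp1_space_def by (rule sa_space.simps)
  ultimately show ?thesis unfolding sa_set_def topo_cp1_space by simp
qed

lemma sa_set_underlined_stratum:
  assumes "stability_theory \<Omega>" and "k + l + m = r"
  shows "sa_set (sym_prod n cp1_space) (underlined_stratum \<Omega> n k l m)"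
proof -
  let ?F = "{({cp1_infinity}, n - r), (stable \<Omega> - {cp1_infinity}, k),
    (semistable \<Omega> - {cp1_infinity}, l), (unstable \<Omega> - {cp1_infinity}, m)}"
  have sets: "sa_set cp1_space \<Omega>" "sa_set cp1_space (closure \<Omega>)"
    using assms(1) stability_theory_closure[OF assms(1)] by (simp_all add: stability_theory_def)
  have "sa_set cp1_space (stable \<Omega>)" "sa_set cp1_space (semistable \<Omega>)" "sa_set cp1_space (unstable \<Omega>)"
    unfolding stable_def semistable_def unstable_def Compl_eq_Diff_UNIV
    by (intro sa_set_diff sets sa_set_cp1_UNIV)+
  then have "sa_set cp1_space A" if "(A, j) \<in> ?F" for A j
    using that sa_set_cp1_infinity sa_set_diff[OF _ sa_set_cp1_infinity] by blast
  then have "sa_set (sym_prod n cp1_space) {M. size M = n \<and> (\<forall>(A, j)\<in>?F. points_in A M = j)}"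
    by (intro sa_set_points_in semialgebraic_pdom_cp1_space) (simp_all add: topo_cp1_space)
  moreover have "{M. size M = n \<and> (\<forall>(A, j)\<in>?F. points_in A M = j)} = underlined_stratum \<Omega> n k l m"
    using assms(2) by (simp add: underlined_stratum_def points_in_singleton)
  ultimately show ?thesis by simp
qed

lemma sa_set_stratum_remove_infinity:
  assumes "stability_theory \<Omega>"
  shows "sa_set (sym_prod r complex_space) (stratum (remove_infinity \<Omega>) r k l m)"
proof -
  let ?R = "remove_infinity \<Omega>"
  let ?F = "{(stable ?R, k), (semistable ?R, l), (unstable ?R, m)}"
  have sets: "sa_set complex_space ?R" "sa_set complex_space (closure ?R)"
    using monic_stability_theory_remove_infinity[OF assms]
      monic_stability_theory_remove_infinity[OF stability_theory_closure[OF assms]]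
    by (simp_all add: monic_stability_theory_def closure_remove_infinity)
  have "sa_set complex_space (stable ?R)" "sa_set complex_space (semistable ?R)"
    "sa_set complex_space (unstable ?R)"
    unfolding stable_def semistable_def unstable_def Compl_eq_Diff_UNIV
    by (intro sa_set_diff sets sa_set_complex_UNIV)+
  then have "sa_set complex_space A" if "(A, j) \<in> ?F" for A j
    using that by blast
  then have "sa_set (sym_prod r complex_space) {M. size M = r \<and> (\<forall>(A, j)\<in>?F. points_in A M = j)}"
    by (intro sa_set_points_in semialgebraic_pdom_complex_space) (simp_all add: topo_complex_space)
  moreover have "{M. size M = r \<and> (\<forall>(A, j)\<in>?F. points_in A M = j)} = stratum ?R r k l m"
    by (simp add: stratum_def)
  ultimately show ?thesis by simp
qed


text \<open>
  The \<open>s\<close>-th pair of homogeneous coordinates in \<open>x\<close> represents the \<open>i\<close>-th entry of the padded tuple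
  with affine coordinates \<open>y\<close>.  The equations are the real and imaginary parts of \<open>u = v z\<close>, or \<open>v = 0\<close>
  when the entry is \<open>\<infinity>\<close>.
\<close>

definition represents_padded_point ::
  "nat \<Rightarrow> (nat \<times> nat \<Rightarrow> real) \<Rightarrow> (nat \<times> nat \<Rightarrow> real) \<Rightarrow> nat \<Rightarrow> nat \<Rightarrow> bool" where
  "represents_padded_point r x y s i \<longleftrightarrow>
     (if i < r then x (s, 0) = x (s, 2) * y (i, 0) - x (s, 3) * y (i, 1) \<and>
        x (s, 1) = x (s, 2) * y (i, 1) + x (s, 3) * y (i, 0)
      else x (s, 2) = 0 \<and> x (s, 3) = 0)"

text \<open>
  Two tuples give the same multiset iff they differ by a permutation.
\<close>

lemma param_cp1_eq_add_infinities_iff: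
  assumes "r \<le> n" and x: "x \<in> pdom (sym_prod n cp1_space)"
  shows "param (sym_prod n cp1_space) x = add_infinities (n - r) (param (sym_prod r complex_space) y)
    \<longleftrightarrow> (\<exists>\<sigma>\<in>{\<sigma>. \<sigma> permutes {..<n}}. \<forall>i\<in>{..<n}. represents_padded_point r x y (\<sigma> i) i)"
proof -
  define h where "h i = homogeneous (\<lambda>j. x (i, j))" for i
  define z where "z = (\<lambda>i. Complex (y (i, 0)) (y (i, 1)))"
  have "param complex_space w = Complex (w 0) (w 1)" for w
    unfolding complex_space_def sa_space.simps by (rule refl)
  then have y: "param (sym_prod r complex_space) y = tuple_mset r z"
    unfolding param_sym_prod z_def by (simp only:)
  have "param (sym_prod n cp1_space) x = add_infinities (n - r) (param (sym_prod r complex_space) y)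
    \<longleftrightarrow> tuple_mset n (\<lambda>i. hpoint (fst (h i)) (snd (h i))) = tuple_mset n (pad_tuple r z)"
    unfolding y add_infinities_tuple_mset[OF assms(1)] unfolding param_sym_prod param_cp1_space h_def
    by (rule refl)
  also have "\<dots> \<longleftrightarrow> (\<exists>\<sigma>. \<sigma> permutes {..<n} \<and>
      (\<forall>i<n. pad_tuple r z i = hpoint (fst (h (\<sigma> i))) (snd (h (\<sigma> i)))))"
    by (rule tuple_mset_eq_iff)
  also have "\<dots> \<longleftrightarrow> (\<exists>\<sigma>. \<sigma> permutes {..<n} \<and> (\<forall>i<n. represents_padded_point r x y (\<sigma> i) i))"
  proof (intro ex_cong1 conj_cong refl all_cong)
    fix \<sigma> i assume "\<sigma> permutes {..<n}" "i < n"
    then have "\<sigma> i \<in> {..<n}" using permutes_in_image by fastforce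
    then have "h (\<sigma> i) \<noteq> 0"
      using x unfolding pdom_sym_prod pdom_cp1_space h_def by blast
    note iff = cp1_of_complex_eq_hpoint_iff[OF this] cp1_infinity_eq_hpoint_iff[OF this]
    show "pad_tuple r z i = hpoint (fst (h (\<sigma> i))) (snd (h (\<sigma> i)))
        \<longleftrightarrow> represents_padded_point r x y (\<sigma> i) i"
      unfolding pad_tuple_def represents_padded_point_def
      by (cases "i < r")
        (simp_all only: if_True if_False iff, simp_all add: h_def homogeneous_def z_def complex_eq_iff)
  qed
  finally show ?thesis by (simp only: Bex_def Ball_def mem_Collect_eq lessThan_iff)
qed

text \<open>
  On \<open>S\<close>, where the multiplicity of \<open>\<infinity>\<close> is known, \<open>affine_part M = N\<close> is equivalent to
  \<open>M = add_infinities (n - r) N\<close>, which is a condition on the points without any case distinction on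
  which of them are infinite.
\<close>

lemma sa_set_graph_affine_part:
  assumes S: "sa_set (sym_prod n cp1_space) S" and "r \<le> n"
    and inf: "\<And>M. M \<in> S \<Longrightarrow> size M = n \<and> count M cp1_infinity = n - r"
  shows "sa_set (sa_prod (sym_prod n cp1_space) (sym_prod r complex_space)) ((\<lambda>M. (M, affine_part M)) ` S)"
proof -
  let ?P = "sym_prod n cp1_space" and ?C = "sym_prod r complex_space"
  let ?I = "coords ?P <+> coords ?C"
  let ?G = "(\<lambda>M. (M, affine_part M)) ` S"
  let ?E = "\<lambda>x y. \<exists>\<sigma>\<in>{\<sigma>. \<sigma> permutes {..<n}}. \<forall>i\<in>{..<n}. represents_padded_point r x y (\<sigma> i) i"
  have G: "(M, N) \<in> ?G \<longleftrightarrow> M \<in> S \<and> M = add_infinities (n - r) N" for M N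
  proof
    assume "(M, N) \<in> ?G"
    then have "M \<in> S" "N = affine_part M" by auto
    then show "M \<in> S \<and> M = add_infinities (n - r) N"
      using add_infinities_affine_part[of M "n - r"] inf[of M] by simp
  next
    assume M: "M \<in> S \<and> M = add_infinities (n - r) N"
    then have "N = affine_part M" by (metis affine_part_add_infinities)
    then show "(M, N) \<in> ?G" using M by blast
  qed
  have coords: "coords (sa_prod ?P ?C) = ?I"
    unfolding sa_prod_def sa_space.simps by (rule refl)
  have coordsP: "coords ?P = {..<n} \<times> {..<4}" and coordsC: "coords ?C = {..<r} \<times> {..<2}"
    unfolding coords_sym_prod cp1_space_def complex_space_def sa_space.simps by (rule refl)+
  have eqs: "sa_pred ?I (\<lambda>w. ?E (w \<circ> Inl) (w \<circ> Inr))"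
  proof (intro sa_pred_bex sa_pred_ball finite_permutations finite_lessThan)
    fix \<sigma> i assume "\<sigma> \<in> {\<sigma>. \<sigma> permutes {..<n}}" "i \<in> {..<n}"
    then have "\<sigma> i < n" using permutes_in_image[of \<sigma> "{..<n}" i] by simp
    then have l: "Inl (\<sigma> i, j) \<in> ?I" if "j < 4" for j
      using that unfolding coordsP by blast
    have r: "Inr (i, j) \<in> ?I" if "i < r" "j < 2" for j
      using that unfolding coordsC by blast
    show "sa_pred ?I (\<lambda>w. represents_padded_point r (w \<circ> Inl) (w \<circ> Inr) (\<sigma> i) i)"
    proof (cases "i < r")
      case True
      then show ?thesis
        unfolding represents_padded_point_def if_P[OF True] comp_apply
        by (intro sa_pred_conj sa_pred_eq polynomial_function_intros l r) simp_all
    next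
      case False
      then show ?thesis
        unfolding represents_padded_point_def if_not_P[OF False] comp_apply
        by (intro sa_pred_conj sa_pred_eq polynomial_functions.intros l) simp_all
    qed
  qed
  have "semialgebraic (coords ?P) {x \<in> pdom ?P. param ?P x \<in> S}"
    using S unfolding sa_set_def by blast
  then have "sa_pred ?I (\<lambda>w. w \<circ> Inl \<in> {x \<in> pdom ?P. param ?P x \<in> S})"
    by (intro sa_pred_Inl sa_pred_mem)
  moreover have "sa_pred ?I (\<lambda>w. w \<circ> Inr \<in> pdom ?C)"
    by (intro sa_pred_Inr sa_pred_mem semialgebraic_pdom_sym_prod semialgebraic_pdom_complex_space)
  ultimately have "sa_pred ?I (\<lambda>w. (w \<circ> Inl \<in> {x \<in> pdom ?P. param ?P x \<in> S} \<and> w \<circ> Inr \<in> pdom ?C) \<and>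
      ?E (w \<circ> Inl) (w \<circ> Inr))"
    using eqs by (intro sa_pred_conj)
  then have "semialgebraic (coords (sa_prod ?P ?C))
      {w \<in> pdom (sa_prod ?P ?C). param (sa_prod ?P ?C) w \<in> ?G}"
    unfolding sa_pred_def coords
  proof (rule back_subst[of "semialgebraic ?I"], intro set_eqI)
    fix w :: "(nat \<times> nat) + (nat \<times> nat) \<Rightarrow> real"
    define x where "x = w \<circ> Inl"
    define y where "y = w \<circ> Inr"
    note eq = param_cp1_eq_add_infinities_iff[OF assms(2), of x y]
    have p: "w \<in> pdom (sa_prod ?P ?C) \<longleftrightarrow> w \<in> ?I \<rightarrow>\<^sub>E UNIV \<and> x \<in> pdom ?P \<and> y \<in> pdom ?C"
      unfolding x_def y_def sa_prod_def sa_space.simps mem_Collect_eq by (rule refl)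
    have "param (sa_prod ?P ?C) w = (param ?P x, param ?C y)"
      unfolding x_def y_def sa_prod_def sa_space.simps by (rule refl)
    then have q: "param (sa_prod ?P ?C) w \<in> ?G \<longleftrightarrow> param ?P x \<in> S \<and>
        param ?P x = add_infinities (n - r) (param ?C y)"
      by (simp only: G)
    show "w \<in> {w \<in> ?I \<rightarrow>\<^sub>E UNIV. (w \<circ> Inl \<in> {x \<in> pdom ?P. param ?P x \<in> S} \<and> w \<circ> Inr \<in> pdom ?C) \<and>
        ?E (w \<circ> Inl) (w \<circ> Inr)} \<longleftrightarrow> w \<in> {w \<in> pdom (sa_prod ?P ?C). param (sa_prod ?P ?C) w \<in> ?G}"
    proof (cases "x \<in> pdom ?P")
      case True
      show ?thesis unfolding mem_Collect_eq[of w] p q eq[OF True] x_def[symmetric] y_def[symmetric]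
        unfolding mem_Collect_eq[of x] by argo
    next
      case False
      then show ?thesis unfolding mem_Collect_eq[of w] p x_def[symmetric] mem_Collect_eq[of x] by argo
    qed
  qed
  moreover have "?G \<subseteq> topspace (topo (sa_prod ?P ?C))"
  proof -
    have "topo (sa_prod ?P ?C) = prod_topology (topo ?P) (topo ?C)"
      unfolding sa_prod_def sa_space.simps by (rule refl)
    moreover have "size (affine_part M) = r" if "M \<in> S" for M
      using inf[OF that] size_add_infinities[of "n - r" "affine_part M"]
        add_infinities_affine_part[of M "n - r"] assms(2) by simp
    ultimately show ?thesis
      using inf by (auto simp: topspace_sym_prod topo_cp1_space topo_complex_space)
  qed
  ultimately show ?thesis unfolding sa_set_def by blast
qed

theorem proposition12:
  fixes \<Omega> :: "cp1 set" and k l m r n :: nat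
  assumes "stability_theory \<Omega>"
    and "k + l + m = r" and "r \<le> n"
  shows "semialgebraically_homeomorphic
    (sym_prod n cp1_space) (underlined_stratum \<Omega> n k l m)
    (sym_prod r complex_space) (stratum (remove_infinity \<Omega>) r k l m)"
proof -
  let ?A = "underlined_stratum \<Omega> n k l m" and ?B = "stratum (remove_infinity \<Omega>) r k l m"
  let ?L = "{M. count M cp1_infinity = n - r}"
  have A: "size M = n \<and> count M cp1_infinity = n - r" if "M \<in> ?A" for M
    using that assms(2) by (simp add: underlined_stratum_def)
  have size: "size (affine_part M) = r" if "M \<in> ?A" for M
    using A[OF that] size_add_infinities[of "n - r" "affine_part M"]
      add_infinities_affine_part[of M "n - r"] assms(3) by simp
  have image: "affine_part ` ?A = ?B"
  proof (intro equalityI subsetI)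
    fix N assume "N \<in> affine_part ` ?A"
    then obtain M where M: "M \<in> ?A" "N = affine_part M" by blast
    then have "add_infinities (n - r) N \<in> ?A" using add_infinities_affine_part A by metis
    then show "N \<in> ?B"
      using add_infinities_in_stratum_iff[OF assms(2,3)] size M by metis
  next
    fix N assume N: "N \<in> ?B"
    then have "size N = r" by (simp add: stratum_def)
    then have "add_infinities (n - r) N \<in> ?A"
      using add_infinities_in_stratum_iff[OF assms(2,3)] N by metis
    then show "N \<in> affine_part ` ?A" by (metis affine_part_add_infinities imageI)
  qed
  have top: "topo (sym_prod n cp1_space) = sym_cp1 n" "topo (sym_prod r complex_space) = sym_complex r"
    unfolding topo_sym_prod topo_cp1_space topo_complex_space by (rule refl)+
  have "?A \<subseteq> topspace (sym_cp1 n)" "?B \<subseteq> topspace (sym_complex r)"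
    using topspace_sym_prod[of n cp1_space] topspace_sym_prod[of r complex_space] A
    unfolding top topo_cp1_space topo_complex_space by (auto simp: stratum_def)
  moreover have "?A \<subseteq> ?L" using A by blast
  ultimately have "affine_part ` (topspace (subtopology (sym_cp1 n) ?L) \<inter> ?A) = topspace (sym_complex r) \<inter> ?B"
    unfolding topspace_subtopology image[symmetric] by blast
  then have "homeomorphic_map (subtopology (subtopology (sym_cp1 n) ?L) ?A)
      (subtopology (sym_complex r) ?B) affine_part"
    by (rule homeomorphic_map_subtopologies[OF homeomorphic_map_affine_part[OF assms(3)]])
  then have "homeomorphic_map (subtopology (sym_cp1 n) ?A) (subtopology (sym_complex r) ?B) affine_part"
    using Int_absorb1[OF \<open>?A \<subseteq> ?L\<close>] by (simp only: subtopology_subtopology)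
  moreover have "semialgebraic_map (sym_prod n cp1_space) ?A (sym_prod r complex_space) ?B affine_part"
    unfolding semialgebraic_map_def
    using sa_set_underlined_stratum[OF assms(1,2)] sa_set_stratum_remove_infinity[OF assms(1)]
      sa_set_graph_affine_part[OF sa_set_underlined_stratum[OF assms(1,2)] assms(3) A] image by blast
  ultimately show ?thesis
    unfolding semialgebraically_homeomorphic_def top by blast
qed

end
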